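(* Let $a$ be any one of $\mathfrak{S}^*,\mathcal{R}\mathfrak{S}^*,\mathcal{A}^*,\overline{\mathcal{A}}^*$. For a composition $\alpha$ let $\mathcal{U}_\alpha$ denote the $H_{|\alpha|}(0)$-module defined by the $a$-action on $\mathrm{SIT}(\alpha)$, and for $\beta\subseteq\alpha$ let $\mathcal{U}_{\alpha/\beta}$ denote the $H_{|\alpha|-|\beta|}(0)$-module defined by the $a$-action on $\mathrm{SIT}(\alpha/\beta)$. Let $\alpha\vDash n$. Then for fixed $0\le m\le n$ we have, as $H_m(0)\otimes H_{n-m}(0)$-modules, $$\mathcal{U}_\alpha\big\downarrow^{H_n(0)}_{H_m(0)\otimes H_{n-m}(0)}\cong\bigoplus_{\substack{\beta\vDash m\\ \beta\subseteq\alpha}}\mathcal{U}_\beta\otimes\mathcal{U}_{\alpha/\beta}.$$ In particular, $$\mathcal{U}_\alpha\big\downarrow^{H_n(0)}_{H_{n-1}(0)}\cong\bigoplus_{\substack{\beta\vDash n-1\\ \beta\subset\alpha}}\mathcal{U}_\beta.$$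
   Context: Compositions and tableaux. A composition $\alpha=(\alpha_1,\dots,\alpha_k)\vDash n$ is a finite sequence of positive integers with sum $n=|\alpha|$; $\ell(\alpha)=k$; $\emptyset$ is the empty composition of $0$. The diagram of $\alpha$ is the left-justified array of cells with $\alpha_i$ cells in row $i$, rows numbered from bottom to top. $\beta\subseteq\alpha$ means $\ell(\beta)\le\ell(\alpha)$ and $\beta_j\le\alpha_j$ for all $1\le j\le \ell(\beta)$; the skew diagram $\alpha/\beta$ is the set of cells of the diagram of $\alpha$ not in that of $\beta$, where $\beta$ is placed in the bottom-left corner of $\alpha$. $\mathrm{SIT}(\alpha/\beta)$ is the set of bijective fillings of the cells of $\alpha/\beta$ with $1,\dots,|\alpha|-|\beta|$ such that the entries in the cells of the leftmost column of $\alpha$ that are not in $\beta$ increase from bottom to top, and all rows increase from left to right; $\mathrm{SIT}(\alpha)=\mathrm{SIT}(\alpha/\emptyset)$. Descent sets. For $T\in\mathrm{SIT}(\alpha/\beta)$ and $1\le i\le |\alpha|-|\beta|-1$: $i\in\mathrm{Des}_{\mathfrak{S}^*}(T)$ iff $i+1$ is in a row strictly above $i$; $i\in\mathrm{Des}_{\mathcal{R}\mathfrak{S}^*}(T)$ iff $i+1$ is in a row weakly below $i$; $i\in\mathrm{Des}_{\mathcal{A}^*}(T)$ iff $i+1$ is in a row strictly below $i$; $i\in\mathrm{Des}_{\overline{\mathcal{A}}^*}(T)$ iff $i+1$ is in a row weakly above $i$. 0-Hecke algebra and actions. $H_N(0)$ is the $\mathbb{C}$-algebra with generators $\pi_1,\dots,\pi_{N-1}$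 and relations $\pi_i^2=\pi_i$, $\pi_i\pi_{i+1}\pi_i=\pi_{i+1}\pi_i\pi_{i+1}$, $\pi_i\pi_j=\pi_j\pi_i$ for $|i-j|\ge2$; $H_0(0)=H_1(0)=\mathbb{C}$. $H_m(0)\otimes H_{n-m}(0)$ is identified with the subalgebra of $H_n(0)$ generated by $\{\pi_1,\dots,\pi_{m-1},\pi_{m+1},\dots,\pi_{n-1}\}$ via $\pi_i\mapsto\pi_i\otimes1$ for $1\le i\le m-1$ and $\pi_i\mapsto1\otimes\pi_{i-m}$ for $m+1\le i\le n-1$; $H_{n-1}(0)$ is the subalgebra generated by $\pi_1,\dots,\pi_{n-2}$. Let $s_i$ switch the entries $i,i+1$ of a tableau. The $a$-action of $H_{|\alpha|-|\beta|}(0)$ on the complex vector space with basis $\mathrm{SIT}(\alpha/\beta)$ is: $\pi_i(T)=T$ if $i\notin\mathrm{Des}_a(T)$; $\pi_i(T)=s_i(T)$ if $i\in\mathrm{Des}_a(T)$ and $s_i(T)\in\mathrm{SIT}(\alpha/\beta)$; $\pi_i(T)=0$ otherwise. *)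

theory Defs
  imports
    Complex_Main "HOL-Combinatorics.Transposition" "HOL-Library.Poly_Mapping"
    "HOL-Algebra.QuotRing" "HOL-Algebra.Generated_Rings"
begin

section \<open>Free complex vector spaces\<close>

text \<open>
  The complex vector space with basis \<open>B\<close> consists of the finitely supported functions
  \<open>'x \<Rightarrow>\<^sub>0 complex\<close> whose support lies in \<open>B\<close>; the basis vector belonging to \<open>x\<close> is
  \<open>basis_vec x\<close>.
\<close>

definition pm_smult :: "complex \<Rightarrow> ('x \<Rightarrow>\<^sub>0 complex) \<Rightarrow> 'x \<Rightarrow>\<^sub>0 complex"
  where "pm_smult c f = Poly_Mapping.map ((*) c) f"

lemma lookup_pm_smult [simp]:
  "Poly_Mapping.lookup (pm_smult c f) x = c * Poly_Mapping.lookup f x"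
  by (simp add: pm_smult_def Poly_Mapping.map.rep_eq when_def)

global_interpretation pm: vector_space "pm_smult :: complex \<Rightarrow> ('x \<Rightarrow>\<^sub>0 complex) \<Rightarrow> _"
  defines pm_span = pm.span
  by unfold_locales
    (auto intro!: poly_mapping_eqI simp: Poly_Mapping.lookup_add algebra_simps)

abbreviation basis_vec :: "'x \<Rightarrow> 'x \<Rightarrow>\<^sub>0 complex"
  where "basis_vec x \<equiv> Poly_Mapping.single x 1"

definition free_space :: "'x set \<Rightarrow> (complex, 'x \<Rightarrow>\<^sub>0 complex) module"
  where "free_space B =
    \<lparr>carrier = {f. Poly_Mapping.keys f \<subseteq> B}, mult = undefined, one = undefined,
     zero = 0, add = (+), smult = pm_smult\<rparr>"

definition linear_ext :: "('x \<Rightarrow> 'y \<Rightarrow>\<^sub>0 complex) \<Rightarrow> ('x \<Rightarrow>\<^sub>0 complex) \<Rightarrow> 'y \<Rightarrow>\<^sub>0 complex"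
  where "linear_ext \<phi> f = (\<Sum>x\<in>Poly_Mapping.keys f. pm_smult (Poly_Mapping.lookup f x) (\<phi> x))"

definition bilinear_ext ::
  "('x \<Rightarrow> 'y \<Rightarrow> 'z) \<Rightarrow> ('x \<Rightarrow>\<^sub>0 complex) \<Rightarrow> ('y \<Rightarrow>\<^sub>0 complex) \<Rightarrow> 'z \<Rightarrow>\<^sub>0 complex"
  where "bilinear_ext \<phi> f g =
    (\<Sum>x\<in>Poly_Mapping.keys f. \<Sum>y\<in>Poly_Mapping.keys g.
       Poly_Mapping.single (\<phi> x y) (Poly_Mapping.lookup f x * Poly_Mapping.lookup g y))"


section \<open>Complex algebras\<close>

text \<open>
  A (not necessarily commutative) complex algebra is given by a record of type
  \<open>(complex, 'a) module\<close>, whose ring fields carry the multiplication and whose field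
  \<open>smult\<close> is the multiplication by complex scalars.
\<close>

definition monoid_algebra :: "('g, 'b) monoid_scheme \<Rightarrow> (complex, 'g \<Rightarrow>\<^sub>0 complex) module"
  where "monoid_algebra G =
    (free_space (carrier G))\<lparr>mult := bilinear_ext (mult G), one := basis_vec \<one>\<^bsub>G\<^esub>\<rparr>"

definition quotient_algebra ::
  "(complex, 'a) module \<Rightarrow> 'a set \<Rightarrow> (complex, 'a set) module"
  where "quotient_algebra A I =
    ring.extend (A Quot I) \<lparr>smult = (\<lambda>c C. \<Union>x\<in>C. I +>\<^bsub>A\<^esub> (c \<odot>\<^bsub>A\<^esub> x))\<rparr>"

definition algebra_embedding ::
  "(complex, 'a) module \<Rightarrow> (complex, 'b) module \<Rightarrow> ('a \<Rightarrow> 'b) \<Rightarrow> bool"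
  where "algebra_embedding A B \<phi> \<longleftrightarrow>
    \<phi> \<in> ring_hom A B \<and>
    (\<forall>c. \<forall>x\<in>carrier A. \<phi> (c \<odot>\<^bsub>A\<^esub> x) = c \<odot>\<^bsub>B\<^esub> \<phi> x) \<and>
    inj_on \<phi> (carrier A)"

definition generated_subalgebra :: "(complex, 'a) module \<Rightarrow> 'a set \<Rightarrow> 'a set"
  where "generated_subalgebra A S = generate_ring A (S \<union> {c \<odot>\<^bsub>A\<^esub> \<one>\<^bsub>A\<^esub> |c. True})"


section \<open>Modules over noncommutative rings\<close>

text \<open>
  The locale \<^locale>\<open>module\<close> of HOL-Algebra requires a commutative ring of scalars.
\<close>

locale left_module = R?: ring R + M?: abelian_group M
  for R :: "('a, 'r) ring_scheme" (structure) and M :: "('a, 'v) module" (structure) +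
  assumes lsmult_closed: "\<lbrakk>a \<in> carrier R; x \<in> carrier M\<rbrakk> \<Longrightarrow> a \<odot>\<^bsub>M\<^esub> x \<in> carrier M"
    and lsmult_l_distr: "\<lbrakk>a \<in> carrier R; b \<in> carrier R; x \<in> carrier M\<rbrakk> \<Longrightarrow>
      (a \<oplus>\<^bsub>R\<^esub> b) \<odot>\<^bsub>M\<^esub> x = a \<odot>\<^bsub>M\<^esub> x \<oplus>\<^bsub>M\<^esub> b \<odot>\<^bsub>M\<^esub> x"
    and lsmult_r_distr: "\<lbrakk>a \<in> carrier R; x \<in> carrier M; y \<in> carrier M\<rbrakk> \<Longrightarrow>
      a \<odot>\<^bsub>M\<^esub> (x \<oplus>\<^bsub>M\<^esub> y) = a \<odot>\<^bsub>M\<^esub> x \<oplus>\<^bsub>M\<^esub> a \<odot>\<^bsub>M\<^esub> y"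
    and lsmult_assoc: "\<lbrakk>a \<in> carrier R; b \<in> carrier R; x \<in> carrier M\<rbrakk> \<Longrightarrow>
      (a \<otimes>\<^bsub>R\<^esub> b) \<odot>\<^bsub>M\<^esub> x = a \<odot>\<^bsub>M\<^esub> (b \<odot>\<^bsub>M\<^esub> x)"
    and lsmult_one: "x \<in> carrier M \<Longrightarrow> \<one>\<^bsub>R\<^esub> \<odot>\<^bsub>M\<^esub> x = x"

definition module_iso ::
  "('a, 'r) ring_scheme \<Rightarrow> ('a, 'u) module \<Rightarrow> ('a, 'v) module \<Rightarrow> bool"
  where "module_iso A M N \<longleftrightarrow>
    left_module A M \<and> left_module A N \<and>
    (\<exists>f. bij_betw f (carrier M) (carrier N) \<and>
      (\<forall>x\<in>carrier M. \<forall>y\<in>carrier M. f (x \<oplus>\<^bsub>M\<^esub> y) = f x \<oplus>\<^bsub>N\<^esub> f y) \<and>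
      (\<forall>a\<in>carrier A. \<forall>x\<in>carrier M. f (a \<odot>\<^bsub>M\<^esub> x) = a \<odot>\<^bsub>N\<^esub> f x))"

definition restrict_scalars :: "('b \<Rightarrow> 'a) \<Rightarrow> ('a, 'v) module \<Rightarrow> ('b, 'v) module"
  where "restrict_scalars \<iota> M =
    \<lparr>carrier = carrier M, mult = mult M, one = one M, zero = zero M, add = add M,
     smult = (\<lambda>b x. \<iota> b \<odot>\<^bsub>M\<^esub> x)\<rparr>"

definition direct_sum :: "'i set \<Rightarrow> ('i \<Rightarrow> ('a, 'v) module) \<Rightarrow> ('a, 'i \<Rightarrow> 'v) module"
  where "direct_sum I M =
    \<lparr>carrier = {x \<in> \<Pi>\<^sub>E i\<in>I. carrier (M i). finite {i \<in> I. x i \<noteq> \<zero>\<^bsub>M i\<^esub>}},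
     mult = undefined, one = undefined,
     zero = (\<lambda>i\<in>I. \<zero>\<^bsub>M i\<^esub>),
     add = (\<lambda>x y. \<lambda>i\<in>I. x i \<oplus>\<^bsub>M i\<^esub> y i),
     smult = (\<lambda>a x. \<lambda>i\<in>I. a \<odot>\<^bsub>M i\<^esub> x i)\<rparr>"


section \<open>Tensor products over the complex numbers\<close>

text \<open>
  The tensor product of \<open>U\<close> and \<open>V\<close> is the quotient of the vector space with basis
  \<open>carrier U \<times> carrier V\<close> by the subspace \<open>tensor_relations U V\<close>.
\<close>

definition tensor_relations ::
  "(complex, 'u) module \<Rightarrow> (complex, 'v) module \<Rightarrow> ('u \<times> 'v \<Rightarrow>\<^sub>0 complex) set"
  where "tensor_relations U V = pm_span
    ({basis_vec (x \<oplus>\<^bsub>U\<^esub> x', y) - basis_vec (x, y) - basis_vec (x', y) |x x' y.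
        x \<in> carrier U \<and> x' \<in> carrier U \<and> y \<in> carrier V} \<union>
     {basis_vec (x, y \<oplus>\<^bsub>V\<^esub> y') - basis_vec (x, y) - basis_vec (x, y') |x y y'.
        x \<in> carrier U \<and> y \<in> carrier V \<and> y' \<in> carrier V} \<union>
     {basis_vec (c \<odot>\<^bsub>U\<^esub> x, y) - pm_smult c (basis_vec (x, y)) |c x y.
        x \<in> carrier U \<and> y \<in> carrier V} \<union>
     {basis_vec (x, c \<odot>\<^bsub>V\<^esub> y) - pm_smult c (basis_vec (x, y)) |c x y.
        x \<in> carrier U \<and> y \<in> carrier V})"

text \<open>
  For algebras, the product \<open>(a \<otimes> b)(a' \<otimes> b') = aa' \<otimes> bb'\<close> is induced by the monoid
  algebra of the product of the two multiplicative monoids.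
\<close>

definition tensor_algebra ::
  "(complex, 'a) module \<Rightarrow> (complex, 'b) module \<Rightarrow> (complex, ('a \<times> 'b \<Rightarrow>\<^sub>0 complex) set) module"
  where "tensor_algebra A B =
    quotient_algebra (monoid_algebra (A \<times>\<times> B)) (tensor_relations A B)"

definition pure_tensor ::
  "(complex, 'a) module \<Rightarrow> (complex, 'b) module \<Rightarrow> 'a \<Rightarrow> 'b \<Rightarrow> ('a \<times> 'b \<Rightarrow>\<^sub>0 complex) set"
  where "pure_tensor A B a b =
    tensor_relations A B +>\<^bsub>free_space (carrier A \<times> carrier B)\<^esub> basis_vec (a, b)"

definition complex_space ::
  "(complex, 'a) module \<Rightarrow> ('a, 'u) module \<Rightarrow> (complex, 'u) module"
  where "complex_space A M = restrict_scalars (\<lambda>c. c \<odot>\<^bsub>A\<^esub> \<one>\<^bsub>A\<^esub>) M"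

text \<open>
  The module over the tensor product of \<open>A\<close> and \<open>B\<close> formed from an \<open>A\<close>-module \<open>M\<close> and a
  \<open>B\<close>-module \<open>N\<close>, with \<open>(a \<otimes> b)(u \<otimes> v) = au \<otimes> bv\<close>. As in \<^const>\<open>rcoset_mult\<close>, the action
  is defined on cosets by taking all representatives.
\<close>

definition tensor_module ::
  "(complex, 'a) module \<Rightarrow> (complex, 'b) module \<Rightarrow> ('a, 'u) module \<Rightarrow> ('b, 'v) module \<Rightarrow>
    (('a \<times> 'b \<Rightarrow>\<^sub>0 complex) set, ('u \<times> 'v \<Rightarrow>\<^sub>0 complex) set) module"
  where "tensor_module A B M N =
    (let F = free_space (carrier M \<times> carrier N);
         D = tensor_relations (complex_space A M) (complex_space B N)
     in \<lparr>carrier = a_rcosets\<^bsub>F\<^esub> D, mult = undefined, one = undefined,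
         zero = D, add = set_add F,
         smult = (\<lambda>t C. \<Union>f\<in>t. \<Union>g\<in>C.
           D +>\<^bsub>F\<^esub> bilinear_ext (\<lambda>(a, b) (u, v). (a \<odot>\<^bsub>M\<^esub> u, b \<odot>\<^bsub>N\<^esub> v)) f g)\<rparr>)"


section \<open>The 0-Hecke algebra\<close>

text \<open>
  The algebra generated by \<open>\<pi>\<^sub>1, \<dots>, \<pi>\<^sub>N\<^sub>-\<^sub>1\<close> subject to the 0-Hecke relations is the quotient of
  the free algebra, i.e. of the monoid algebra of words in the letters \<open>1, \<dots>, N - 1\<close>. For
  \<open>N = 0\<close> and \<open>N = 1\<close> the only word is the empty one, and the algebra is \<open>\<complex>\<close>.
\<close>

definition free_algebra :: "nat \<Rightarrow> (complex, nat list \<Rightarrow>\<^sub>0 complex) module"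
  where "free_algebra N = monoid_algebra \<lparr>carrier = lists {1..<N}, mult = (@), one = []\<rparr>"

definition hecke_relations :: "nat \<Rightarrow> (nat list \<Rightarrow>\<^sub>0 complex) set"
  where "hecke_relations N =
    {basis_vec [i, i] - basis_vec [i] |i. i \<in> {1..<N}} \<union>
    {basis_vec [i, i + 1, i] - basis_vec [i + 1, i, i + 1] |i. i \<in> {1..<N} \<and> i + 1 \<in> {1..<N}} \<union>
    {basis_vec [i, j] - basis_vec [j, i] |i j.
       i \<in> {1..<N} \<and> j \<in> {1..<N} \<and> \<bar>int i - int j\<bar> \<ge> 2}"

type_synonym hecke_elem = "(nat list \<Rightarrow>\<^sub>0 complex) set"

definition hecke_ideal :: "nat \<Rightarrow> (nat list \<Rightarrow>\<^sub>0 complex) set"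
  where "hecke_ideal N = Idl\<^bsub>free_algebra N\<^esub> (hecke_relations N)"

definition hecke :: "nat \<Rightarrow> (complex, hecke_elem) module"
  where "hecke N = quotient_algebra (free_algebra N) (hecke_ideal N)"

definition hecke_gen :: "nat \<Rightarrow> nat \<Rightarrow> hecke_elem"
  where "hecke_gen N i = hecke_ideal N +>\<^bsub>free_algebra N\<^esub> basis_vec [i]"

text \<open>
  The identification of \<open>H\<^sub>m(0) \<otimes> H\<^sub>n\<^sub>-\<^sub>m(0)\<close> with the subalgebra of \<open>H\<^sub>n(0)\<close> generated by the
  \<open>\<pi>\<^sub>i\<close> with \<open>i \<noteq> m\<close>, and that of \<open>H\<^sub>n\<^sub>-\<^sub>1(0)\<close> with the subalgebra generated by
  \<open>\<pi>\<^sub>1, \<dots>, \<pi>\<^sub>n\<^sub>-\<^sub>2\<close>. Both maps are determined on the carrier by these conditions.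
\<close>

definition hecke_tensor_identification ::
  "nat \<Rightarrow> nat \<Rightarrow> ((hecke_elem \<times> hecke_elem \<Rightarrow>\<^sub>0 complex) set \<Rightarrow> hecke_elem) \<Rightarrow> bool"
  where "hecke_tensor_identification n m \<iota> \<longleftrightarrow>
    algebra_embedding (tensor_algebra (hecke m) (hecke (n - m))) (hecke n) \<iota> \<and>
    \<iota> ` carrier (tensor_algebra (hecke m) (hecke (n - m))) =
      generated_subalgebra (hecke n) (hecke_gen n ` ({1..<n} - {m})) \<and>
    (\<forall>i\<in>{1..<m}.
      \<iota> (pure_tensor (hecke m) (hecke (n - m)) (hecke_gen m i) \<one>\<^bsub>hecke (n - m)\<^esub>) =
        hecke_gen n i) \<and>
    (\<forall>i\<in>{m + 1..<n}.
      \<iota> (pure_tensor (hecke m) (hecke (n - m)) \<one>\<^bsub>hecke m\<^esub> (hecke_gen (n - m) (i - m))) =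
        hecke_gen n i)"

definition hecke_pred_identification :: "nat \<Rightarrow> (hecke_elem \<Rightarrow> hecke_elem) \<Rightarrow> bool"
  where "hecke_pred_identification n \<iota> \<longleftrightarrow>
    algebra_embedding (hecke (n - 1)) (hecke n) \<iota> \<and>
    \<iota> ` carrier (hecke (n - 1)) =
      generated_subalgebra (hecke n) (hecke_gen n ` {1..<n - 1}) \<and>
    (\<forall>i\<in>{1..<n - 1}. \<iota> (hecke_gen (n - 1) i) = hecke_gen n i)"


section \<open>Compositions and tableaux\<close>

definition composition :: "nat \<Rightarrow> nat list \<Rightarrow> bool"
  where "composition n \<alpha> \<longleftrightarrow> (\<forall>p\<in>set \<alpha>. 0 < p) \<and> sum_list \<alpha> = n"

definition comp_subset :: "nat list \<Rightarrow> nat list \<Rightarrow> bool"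
  where "comp_subset \<beta> \<alpha> \<longleftrightarrow> length \<beta> \<le> length \<alpha> \<and> (\<forall>j<length \<beta>. \<beta> ! j \<le> \<alpha> ! j)"

text \<open>
  A cell is a pair (row, column), both numbered from 1; row 1 is the bottom row and column 1
  the leftmost column.
\<close>

definition diagram :: "nat list \<Rightarrow> (nat \<times> nat) set"
  where "diagram \<alpha> = {(r, c). 1 \<le> r \<and> r \<le> length \<alpha> \<and> 1 \<le> c \<and> c \<le> \<alpha> ! (r - 1)}"

definition skew_diagram :: "nat list \<Rightarrow> nat list \<Rightarrow> (nat \<times> nat) set"
  where "skew_diagram \<alpha> \<beta> = diagram \<alpha> - diagram \<beta>"

text \<open>
  A filling is a function on all cells with the dummy value 0 outside of the skew diagram, so
  that fillings of the same diagram are equal iff they agree on its cells.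
\<close>

type_synonym filling = "nat \<times> nat \<Rightarrow> nat"

definition SIT :: "nat list \<Rightarrow> nat list \<Rightarrow> filling set"
  where "SIT \<alpha> \<beta> = {T.
    bij_betw T (skew_diagram \<alpha> \<beta>) {1..sum_list \<alpha> - sum_list \<beta>} \<and>
    (\<forall>x. x \<notin> skew_diagram \<alpha> \<beta> \<longrightarrow> T x = 0) \<and>
    (\<forall>r r'. (r, 1) \<in> skew_diagram \<alpha> \<beta> \<and> (r', 1) \<in> skew_diagram \<alpha> \<beta> \<and> r < r' \<longrightarrow>
       T (r, 1) < T (r', 1)) \<and>
    (\<forall>r c c'. (r, c) \<in> skew_diagram \<alpha> \<beta> \<and> (r, c') \<in> skew_diagram \<alpha> \<beta> \<and> c < c' \<longrightarrow>
       T (r, c) < T (r, c'))}"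

definition entry_row :: "filling \<Rightarrow> nat \<Rightarrow> nat"
  where "entry_row T k = (THE r. \<exists>c. T (r, c) = k)"

text \<open>
  The four descent sets, in the order \<open>\<SS>\<^sup>*\<close>, \<open>\<R>\<SS>\<^sup>*\<close>, \<open>\<A>\<^sup>*\<close> and overlined \<open>\<A>\<^sup>*\<close>;
  \<open>row_condition a r r'\<close> compares the row \<open>r\<close> of \<open>i\<close> with the row \<open>r'\<close> of \<open>i + 1\<close>.
\<close>

datatype variant = S_star | RS_star | A_star | A_bar_star

fun row_condition :: "variant \<Rightarrow> nat \<Rightarrow> nat \<Rightarrow> bool" where
  "row_condition S_star r r' \<longleftrightarrow> r < r'"
| "row_condition RS_star r r' \<longleftrightarrow> r' \<le> r"
| "row_condition A_star r r' \<longleftrightarrow> r' < r"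
| "row_condition A_bar_star r r' \<longleftrightarrow> r \<le> r'"

definition Des :: "variant \<Rightarrow> nat list \<Rightarrow> nat list \<Rightarrow> filling \<Rightarrow> nat set"
  where "Des a \<alpha> \<beta> T = {i. 1 \<le> i \<and> i < sum_list \<alpha> - sum_list \<beta> \<and>
    row_condition a (entry_row T i) (entry_row T (i + 1))}"


section \<open>The modules on standard immaculate tableaux\<close>

definition swap_entries :: "nat \<Rightarrow> filling \<Rightarrow> filling"
  where "swap_entries i T = Transposition.transpose i (i + 1) \<circ> T"

definition pi_basis ::
  "variant \<Rightarrow> nat list \<Rightarrow> nat list \<Rightarrow> nat \<Rightarrow> filling \<Rightarrow> filling \<Rightarrow>\<^sub>0 complex"
  where "pi_basis a \<alpha> \<beta> i T =
    (if i \<notin> Des a \<alpha> \<beta> T then basis_vec T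
     else if swap_entries i T \<in> SIT \<alpha> \<beta> then basis_vec (swap_entries i T)
     else 0)"

definition word_action ::
  "variant \<Rightarrow> nat list \<Rightarrow> nat list \<Rightarrow> nat list \<Rightarrow> (filling \<Rightarrow>\<^sub>0 complex) \<Rightarrow> filling \<Rightarrow>\<^sub>0 complex"
  where "word_action a \<alpha> \<beta> w v = foldr (\<lambda>i. linear_ext (pi_basis a \<alpha> \<beta> i)) w v"

text \<open>
  An element of the 0-Hecke algebra is a coset of elements of the free algebra; it acts as any
  of its representatives, which all act in the same way.
\<close>

definition SIT_module ::
  "variant \<Rightarrow> nat list \<Rightarrow> nat list \<Rightarrow> (hecke_elem, filling \<Rightarrow>\<^sub>0 complex) module"
  where "SIT_module a \<alpha> \<beta> =
    \<lparr>carrier = carrier (free_space (SIT \<alpha> \<beta>)), mult = undefined, one = undefined,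
     zero = 0, add = (+),
     smult = (\<lambda>C v. the_elem ((\<lambda>f. linear_ext (\<lambda>w. word_action a \<alpha> \<beta> w v) f) ` C))\<rparr>"

end

theory Submission
  imports Defs
begin

text \<open>
  In a standard immaculate tableau of shape \<open>\<alpha>\<close> the entries \<open>\<le> m\<close> fill the diagram of a composition
  \<open>\<beta>\<close> of \<open>m\<close>, and cutting the tableau there is a bijection from \<open>SIT(\<alpha>)\<close> to the disjoint union of the sets
  \<open>SIT(\<beta>) \<times> SIT(\<alpha>/\<beta>)\<close>. The action of \<open>\<pi>\<^sub>i\<close> depends only on the cells of \<open>i\<close> and \<open>i + 1\<close>, so for \<open>i < m\<close> it
  concerns only the lower part and for \<open>i > m\<close> only the upper part. The linear extension of the
  bijection therefore commutes with the generators of the tensor product, hence with all of it.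
  The tensor product does embed into the 0-Hecke algebra because killing \<open>\<pi>\<^sub>m\<close> is a left inverse.
\<close>

section \<open>Linear and bilinear extension\<close>

text \<open>All four actions are treated at once: of \<open>row_condition\<close> only transitivity
  and antisymmetry are used. The obstacle is that 0-Hecke algebras, their tensor products and the
  tensor modules are quotients whose elements are literally cosets, with operations given by all
  representatives. No basis of such a quotient is ever computed. A map out of a quotient is a linear
  extension on the covering free space together with a check on the relations, and injectivity
  always comes from an explicit map back. This is why the embedding of the tensor product rests on a
  left inverse and not on the dimension n! of H_n(0), and why the module isomorphism is given by
  maps to the summands together with maps back. The isomorphism is asserted for every identification
  \<iota>. Being an algebra homomorphism with prescribed values on generators is all that is used of
  \<iota>, so its construction only serves to show that such a map exists.\<close>

abbreviation "keys \<equiv> Poly_Mapping.keys"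

abbreviation free_on :: "'x set \<Rightarrow> ('x \<Rightarrow>\<^sub>0 complex) set"
  where "free_on B \<equiv> {f. keys f \<subseteq> B}"

lemma keys_pm_smult: "keys (pm_smult c f) \<subseteq> keys f"
  by (auto simp: in_keys_iff)

lemma single_eq_smult: "Poly_Mapping.single x c = pm_smult c (basis_vec x)"
  by (rule poly_mapping_eqI) (simp add: Poly_Mapping.lookup_single when_def)

lemma subspace_free_on: "pm.subspace (free_on B)"
  unfolding pm.subspace_def
  by (auto dest!: subsetD [OF Poly_Mapping.keys_add] subsetD [OF keys_pm_smult])

lemmas free_on_add = pm.subspace_add [OF subspace_free_on, simplified]
  and free_on_smult = pm.subspace_scale [OF subspace_free_on, simplified]
  and free_on_diff = pm.subspace_diff [OF subspace_free_on, simplified]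

lemma poly_mapping_expansion:
  "f = (\<Sum>x\<in>keys f. pm_smult (Poly_Mapping.lookup f x) (basis_vec x))"
proof (rule poly_mapping_eqI)
  fix y
  have "(\<Sum>x\<in>keys f. Poly_Mapping.lookup f x * (1 when x = y))
      = (\<Sum>x\<in>keys f. if x = y then Poly_Mapping.lookup f y else 0)"
    by (rule sum.cong) (auto simp: when_def)
  then show "Poly_Mapping.lookup f y = Poly_Mapping.lookup
      (\<Sum>x\<in>keys f. pm_smult (Poly_Mapping.lookup f x) (basis_vec x)) y"
    by (auto simp: Poly_Mapping.lookup_sum Poly_Mapping.lookup_single in_keys_iff)
qed

text \<open>Every element is a finite combination of basis vectors, so a property stable under
  linear combinations needs checking on \<open>B\<close> only. Nesting this rule replaces all
  manipulations of double and triple sums below.\<close>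

lemma free_on_induct [consumes 1, case_names zero add smult basis]:
  assumes f: "keys f \<subseteq> B"
    and zero: "P 0"
    and add: "\<And>f g. \<lbrakk>keys f \<subseteq> B; keys g \<subseteq> B; P f; P g\<rbrakk> \<Longrightarrow> P (f + g)"
    and smult: "\<And>c f. \<lbrakk>keys f \<subseteq> B; P f\<rbrakk> \<Longrightarrow> P (pm_smult c f)"
    and basis: "\<And>x. x \<in> B \<Longrightarrow> P (basis_vec x)"
  shows "P f"
proof -
  \<comment> \<open>The support is carried along because the cases \<open>add\<close> and
    \<open>smult\<close> apply only to elements supported on \<open>B\<close>.\<close>
  have "keys (\<Sum>x\<in>S. pm_smult (c x) (basis_vec x)) \<subseteq> B \<and>
      P (\<Sum>x\<in>S. pm_smult (c x) (basis_vec x))" if "finite S" "S \<subseteq> B" for S c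
    using that
  proof (induction S rule: finite_induct)
    case (insert x S)
    have x: "keys (basis_vec x) \<subseteq> B"
      using insert.prems by simp
    with insert show ?case
      using add [OF free_on_smult [OF x]] smult [OF x] basis free_on_add [OF free_on_smult [OF x]]
      by simp
  qed (simp add: zero)
  from this [OF _ f] have "P (\<Sum>x\<in>keys f. pm_smult (Poly_Mapping.lookup f x) (basis_vec x))"
    by auto
  then show ?thesis
    by (simp flip: poly_mapping_expansion)
qed

text \<open>The sum defining \<open>linear_ext\<close> ranges over the support, which differs for
  \<open>f\<close>, \<open>g\<close> and \<open>f + g\<close>. Over a common finite superset
  additivity holds term by term.\<close>

lemma linear_ext_superset:
  assumes "finite S" and "keys f \<subseteq> S"
  shows "linear_ext \<phi> f = (\<Sum>x\<in>S. pm_smult (Poly_Mapping.lookup f x) (\<phi> x))"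
  unfolding linear_ext_def
  by (rule sum.mono_neutral_left) (use assms in \<open>auto simp: in_keys_iff\<close>)

lemma linear_ext_zero [simp]: "linear_ext \<phi> 0 = 0"
  by (simp add: linear_ext_def)

lemma linear_ext_add: "linear_ext \<phi> (f + g) = linear_ext \<phi> f + linear_ext \<phi> g"
proof -
  let ?S = "keys f \<union> keys g"
  have "linear_ext \<phi> h = (\<Sum>x\<in>?S. pm_smult (Poly_Mapping.lookup h x) (\<phi> x))"
    if "h \<in> {f, g, f + g}" for h
    by (rule linear_ext_superset) (use that Poly_Mapping.keys_add [of f g] in auto)
  then show ?thesis
    by (simp add: Poly_Mapping.lookup_add pm.scale_left_distrib sum.distrib)
qed

lemma linear_ext_smult: "linear_ext \<phi> (pm_smult c f) = pm_smult c (linear_ext \<phi> f)"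
proof -
  have "linear_ext \<phi> (pm_smult c f)
      = (\<Sum>x\<in>keys f. pm_smult (Poly_Mapping.lookup (pm_smult c f) x) (\<phi> x))"
    by (rule linear_ext_superset) (rule finite_keys, rule keys_pm_smult)
  then show ?thesis
    by (simp add: linear_ext_def pm.scale_sum_right)
qed

lemma linear_ext_single [simp]: "linear_ext \<phi> (Poly_Mapping.single x c) = pm_smult c (\<phi> x)"
  by (cases "c = 0") (auto simp: linear_ext_def)

lemma linear_ext_uminus: "linear_ext \<phi> (- f) = - linear_ext \<phi> f"
  using linear_ext_smult [of \<phi> "-1" f] by simp

lemma linear_ext_diff: "linear_ext \<phi> (f - g) = linear_ext \<phi> f - linear_ext \<phi> g"
  using linear_ext_add [of \<phi> f "- g"] by (simp add: linear_ext_uminus)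

lemmas linear_ext_linear = linear_ext_add linear_ext_smult linear_ext_uminus linear_ext_diff

lemma linear_ext_fun_zero [simp]: "linear_ext (\<lambda>x. 0) f = 0"
  by (simp add: linear_ext_def)

lemma linear_ext_fun_add: "linear_ext (\<lambda>x. \<phi> x + \<psi> x) f = linear_ext \<phi> f + linear_ext \<psi> f"
  by (simp add: linear_ext_def sum.distrib pm.scale_right_distrib)

lemma linear_ext_fun_smult: "linear_ext (\<lambda>x. pm_smult c (\<phi> x)) f = pm_smult c (linear_ext \<phi> f)"
  by (simp add: linear_ext_def pm.scale_sum_right mult.commute)

lemma linear_ext_in_subspace:
  assumes "pm.subspace H" and "\<And>x. x \<in> keys f \<Longrightarrow> \<phi> x \<in> H"
  shows "linear_ext \<phi> f \<in> H"
  unfolding linear_ext_def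
  by (intro pm.subspace_sum pm.subspace_scale) (use assms in auto)

lemma keys_linear_ext:
  "(\<And>x. x \<in> keys f \<Longrightarrow> keys (\<phi> x) \<subseteq> B) \<Longrightarrow>
    keys (linear_ext \<phi> f) \<subseteq> B"
  using linear_ext_in_subspace [OF subspace_free_on, of f \<phi> B] by auto

text \<open>Both composites are linear, so their difference stays in the subspace \<open>H\<close>
  once it lies there on basis vectors. With tensor relations as \<open>H\<close> this reduces the
  equivariance of cutting to single tableaux.\<close>

lemma linear_ext_commute_mod:
  assumes H: "pm.subspace H"
    and basis: "\<And>T. T \<in> B \<Longrightarrow> linear_ext \<phi> (P T) - linear_ext R (\<phi> T) \<in> H"
    and x: "keys x \<subseteq> B"
  shows "linear_ext \<phi> (linear_ext P x) - linear_ext R (linear_ext \<phi> x) \<in> H"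
  using x
proof (induction x rule: free_on_induct)
  case (add x y)
  then show ?case
    using pm.subspace_add [OF H add(3,4)] by (simp add: linear_ext_linear algebra_simps)
next
  case (smult c x)
  then show ?case
    using pm.subspace_scale [OF H smult(2)] by (simp add: linear_ext_linear pm.scale_right_diff_distrib)
qed (simp_all add: basis pm.subspace_0 [OF H])

text \<open>Reading the double sum as two nested linear extensions makes bilinearity a consequence
  of linearity.\<close>

lemma bilinear_ext_eq:
  "bilinear_ext \<phi> f g = linear_ext (\<lambda>x. linear_ext (\<lambda>y. basis_vec (\<phi> x y)) g) f"
  unfolding bilinear_ext_def linear_ext_def pm.scale_sum_right pm.scale_scale
  by (intro sum.cong refl single_eq_smult)

lemma bilinear_ext_linear:
  "bilinear_ext \<phi> (f + f') g = bilinear_ext \<phi> f g + bilinear_ext \<phi> f' g"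
  "bilinear_ext \<phi> f (g + g') = bilinear_ext \<phi> f g + bilinear_ext \<phi> f g'"
  "bilinear_ext \<phi> (pm_smult c f) g = pm_smult c (bilinear_ext \<phi> f g)"
  "bilinear_ext \<phi> f (pm_smult c g) = pm_smult c (bilinear_ext \<phi> f g)"
  "bilinear_ext \<phi> (f - f') g = bilinear_ext \<phi> f g - bilinear_ext \<phi> f' g"
  "bilinear_ext \<phi> f (g - g') = bilinear_ext \<phi> f g - bilinear_ext \<phi> f g'"
proof -
  show *: "bilinear_ext \<phi> f (g + g') = bilinear_ext \<phi> f g + bilinear_ext \<phi> f g'" for g g'
    by (simp add: bilinear_ext_eq linear_ext_linear linear_ext_fun_add)
  show **: "bilinear_ext \<phi> f (pm_smult c g) = pm_smult c (bilinear_ext \<phi> f g)" for c g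
    by (simp add: bilinear_ext_eq linear_ext_linear linear_ext_fun_smult)
  show "bilinear_ext \<phi> f (g - g') = bilinear_ext \<phi> f g - bilinear_ext \<phi> f g'"
    using * [of g "- g'"] ** [of "-1" g'] by simp
qed (simp_all add: bilinear_ext_eq linear_ext_linear)

lemma bilinear_ext_zero [simp]: "bilinear_ext \<phi> 0 g = 0" "bilinear_ext \<phi> f 0 = 0"
  by (simp_all add: bilinear_ext_def)

lemma bilinear_ext_basis [simp]: "bilinear_ext \<phi> (basis_vec x) (basis_vec y) = basis_vec (\<phi> x y)"
  by (simp add: bilinear_ext_eq)

lemma keys_bilinear_ext:
  "(\<And>x y. \<lbrakk>x \<in> keys f; y \<in> keys g\<rbrakk> \<Longrightarrow> \<phi> x y \<in> B) \<Longrightarrow>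
    keys (bilinear_ext \<phi> f g) \<subseteq> B"
  unfolding bilinear_ext_eq by (intro keys_linear_ext) auto

lemma free_space_simps [simp]:
  "carrier (free_space B) = free_on B" "zero (free_space B) = 0"
  "add (free_space B) = (+)" "smult (free_space B) = pm_smult"
  by (simp_all add: free_space_def)

lemma monoid_algebra_simps [simp]:
  "carrier (monoid_algebra G) = free_on (carrier G)" "zero (monoid_algebra G) = 0"
  "add (monoid_algebra G) = (+)" "smult (monoid_algebra G) = pm_smult"
  "mult (monoid_algebra G) = bilinear_ext (mult G)"
  "one (monoid_algebra G) = basis_vec \<one>\<^bsub>G\<^esub>"
  by (simp_all add: monoid_algebra_def free_space_def)

section \<open>Cosets of a subspace\<close>

text \<open>A coset uses only the addition of its ambient structure. Without that structure as a
  parameter, one set of rules serves the Hecke algebras, the tensor algebras and the tensor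
  modules.\<close>

definition lin_coset :: "('x \<Rightarrow>\<^sub>0 complex) set \<Rightarrow> ('x \<Rightarrow>\<^sub>0 complex) \<Rightarrow> ('x \<Rightarrow>\<^sub>0 complex) set"
  where "lin_coset H f = (\<lambda>h. h + f) ` H"

lemma a_r_coset_eq_lin_coset: "add F = (+) \<Longrightarrow> H +>\<^bsub>F\<^esub> f = lin_coset H f"
  by (auto simp: a_r_coset_def r_coset_def lin_coset_def)

lemma mem_lin_coset_iff: "g \<in> lin_coset H f \<longleftrightarrow> g - f \<in> H"
  by (auto simp: lin_coset_def image_iff) (metis diff_add_cancel)

lemma lin_coset_zero [simp]: "lin_coset H 0 = H"
  by (simp add: lin_coset_def)

lemma lin_coset_eq_iff:
  assumes "pm.subspace H"
  shows "lin_coset H f = lin_coset H g \<longleftrightarrow> f - g \<in> H"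
proof
  assume "lin_coset H f = lin_coset H g"
  moreover have "f \<in> lin_coset H f"
    using pm.subspace_0 [OF assms] by (simp add: mem_lin_coset_iff)
  ultimately show "f - g \<in> H"
    by (simp add: mem_lin_coset_iff)
next
  assume fg: "f - g \<in> H"
  have "h - f \<in> H \<longleftrightarrow> h - g \<in> H" for h
    using pm.subspace_add [OF assms _ fg, of "h - f"] pm.subspace_diff [OF assms _ fg, of "h - g"]
    by auto
  then show "lin_coset H f = lin_coset H g"
    by (auto simp: mem_lin_coset_iff)
qed

lemma set_add_lin_coset:
  assumes "add F = (+)" and H: "pm.subspace H"
  shows "lin_coset H f <+>\<^bsub>F\<^esub> lin_coset H g = lin_coset H (f + g)"
proof -
  have "h + h' - (f + g) \<in> H" if "h - f \<in> H" "h' - g \<in> H" for h h'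
    using pm.subspace_add [OF H that] by (simp add: algebra_simps)
  moreover have "\<exists>h1\<in>H. \<exists>h2\<in>H. h = h1 + f + (h2 + g)" if "h - (f + g) \<in> H" for h
    using that pm.subspace_0 [OF H]
    \<comment> \<open>The whole deviation from \<open>f + g\<close> is put into the first summand,
      and \<open>0\<close> into the second.\<close>
    by (intro bexI [of _ "h - (f + g)"] bexI [of _ 0]) (auto simp: algebra_simps)
  ultimately show ?thesis
    using assms(1)
    by (auto simp: set_add_def set_mult_def mem_lin_coset_iff) (auto simp: lin_coset_def)
qed

lemma a_rcosets_eq: "add F = (+) \<Longrightarrow> a_rcosets\<^bsub>F\<^esub> H = lin_coset H ` carrier F"
  by (auto simp: A_RCOSETS_def RCOSETS_def r_coset_def lin_coset_def)

text \<open>Operations on cosets are defined as unions over all representatives. If each of them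
  yields the same coset, and there is at least one, the union collapses to that coset.\<close>

lemma Union_lin_coset_const:
  "pm.subspace H \<Longrightarrow> (\<And>x. x \<in> X \<Longrightarrow> \<phi> x - g \<in> H) \<Longrightarrow> X \<noteq> {} \<Longrightarrow>
    (\<Union>x\<in>X. lin_coset H (\<phi> x)) = lin_coset H g"
  by (simp add: lin_coset_eq_iff [symmetric])

lemma Union2_lin_coset_const:
  "pm.subspace H \<Longrightarrow> (\<And>x y. x \<in> X \<Longrightarrow> y \<in> Y \<Longrightarrow> \<phi> x y - g \<in> H) \<Longrightarrow> X \<noteq> {} \<Longrightarrow> Y \<noteq> {} \<Longrightarrow>
    (\<Union>x\<in>X. \<Union>y\<in>Y. lin_coset H (\<phi> x y)) = lin_coset H g"
  by (simp add: lin_coset_eq_iff [symmetric])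

section \<open>Complex algebras\<close>

text \<open>The last two axioms make the scalars central. Hence scaling by \<open>c\<close> is
  multiplication by \<open>c \<odot> \<one>\<close>, which is how scalars enter
  \<open>generated_subalgebra\<close> and \<open>complex_space\<close>.\<close>

locale complex_algebra = ring A for A :: "(complex, 'a) module" (structure) +
  assumes asmult_closed: "x \<in> carrier A \<Longrightarrow> c \<odot> x \<in> carrier A"
    and asmult_r_distr: "\<lbrakk>x \<in> carrier A; y \<in> carrier A\<rbrakk> \<Longrightarrow> c \<odot> (x \<oplus> y) = c \<odot> x \<oplus> c \<odot> y"
    and asmult_l_distr: "x \<in> carrier A \<Longrightarrow> (c + d) \<odot> x = c \<odot> x \<oplus> d \<odot> x"
    and asmult_assoc: "x \<in> carrier A \<Longrightarrow> (c * d) \<odot> x = c \<odot> (d \<odot> x)"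
    and asmult_one: "x \<in> carrier A \<Longrightarrow> 1 \<odot> x = x"
    and asmult_mult_l: "\<lbrakk>x \<in> carrier A; y \<in> carrier A\<rbrakk> \<Longrightarrow> (c \<odot> x) \<otimes> y = c \<odot> (x \<otimes> y)"
    and asmult_mult_r: "\<lbrakk>x \<in> carrier A; y \<in> carrier A\<rbrakk> \<Longrightarrow> x \<otimes> (c \<odot> y) = c \<odot> (x \<otimes> y)"
begin

lemma asmult_eq_mult: "x \<in> carrier A \<Longrightarrow> c \<odot> x = (c \<odot> \<one>) \<otimes> x"
  by (simp add: asmult_mult_l)

end

section \<open>Monoid algebras and their quotients\<close>

context monoid
begin

lemma keys_mult: "\<lbrakk>keys f \<subseteq> carrier G; keys g \<subseteq> carrier G\<rbrakk> \<Longrightarrow>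
    keys (bilinear_ext (mult G) f g) \<subseteq> carrier G"
  by (rule keys_bilinear_ext) auto

lemma bilinear_ext_assoc:
  assumes f: "keys f \<subseteq> carrier G" and g: "keys g \<subseteq> carrier G"
    and h: "keys h \<subseteq> carrier G"
  shows "bilinear_ext (mult G) (bilinear_ext (mult G) f g) h =
    bilinear_ext (mult G) f (bilinear_ext (mult G) g h)"
  using f
proof (induction f rule: free_on_induct)
  case (basis x)
  show ?case
    using g
  proof (induction g rule: free_on_induct)
    case (basis y)
    show ?case
      using h
    proof (induction h rule: free_on_induct)
      case (basis z)
      then show ?case
        using \<open>x \<in> carrier G\<close> \<open>y \<in> carrier G\<close> by (simp add: m_assoc)
    qed (simp_all add: bilinear_ext_linear)
  qed (simp_all add: bilinear_ext_linear)
qed (simp_all add: bilinear_ext_linear)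

lemma bilinear_ext_one:
  assumes f: "keys f \<subseteq> carrier G"
  shows "bilinear_ext (mult G) (basis_vec \<one>) f = f" "bilinear_ext (mult G) f (basis_vec \<one>) = f"
  using f by (induction f rule: free_on_induct) (simp_all add: bilinear_ext_linear)

lemma ring_monoid_algebra: "ring (monoid_algebra G)"
proof (intro ringI abelian_groupI monoidI)
  fix f assume "f \<in> carrier (monoid_algebra G)"
  then show "\<exists>g\<in>carrier (monoid_algebra G). g \<oplus>\<^bsub>monoid_algebra G\<^esub> f = \<zero>\<^bsub>monoid_algebra G\<^esub>"
    by (intro bexI [of _ "- f"]) auto
qed (simp_all add: free_on_add keys_mult bilinear_ext_assoc bilinear_ext_one bilinear_ext_linear ac_simps)

end

text \<open>The common form of the two kinds of algebras in the theorem: \<open>G\<close> is the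
  monoid of words for a Hecke algebra, and the product of two multiplicative monoids for a tensor
  algebra. The ideal is described by its closure properties because it arises as an
  \<open>Idl\<close> in the one case and as a linear span in the other.\<close>

locale monoid_quotient = monoid G for G :: "('g, 'b) monoid_scheme" (structure) +
  fixes I :: "('g \<Rightarrow>\<^sub>0 complex) set"
  assumes subspace: "pm.subspace I" and subset: "I \<subseteq> free_on (carrier G)"
    and l_closed: "\<lbrakk>keys f \<subseteq> carrier G; g \<in> I\<rbrakk> \<Longrightarrow> bilinear_ext (mult G) f g \<in> I"
    and r_closed: "\<lbrakk>f \<in> I; keys g \<subseteq> carrier G\<rbrakk> \<Longrightarrow> bilinear_ext (mult G) f g \<in> I"
begin

abbreviation "Q \<equiv> quotient_algebra (monoid_algebra G) I"
abbreviation "q \<equiv> lin_coset I"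

lemma q_eq_iff: "q f = q g \<longleftrightarrow> f - g \<in> I"
  by (rule lin_coset_eq_iff [OF subspace])

lemma q_self: "f \<in> q f"
  using pm.subspace_0 [OF subspace] by (simp add: mem_lin_coset_iff)

lemma q_subset: "\<lbrakk>keys f \<subseteq> carrier G; g \<in> q f\<rbrakk> \<Longrightarrow> keys g \<subseteq> carrier G"
  using subset free_on_add [of "g - f" "carrier G" f] by (auto simp: mem_lin_coset_iff)

lemma carrier_Q: "carrier Q = q ` free_on (carrier G)"
  by (simp add: quotient_algebra_def ring.defs FactRing_def a_rcosets_eq)

lemma zero_Q: "\<zero>\<^bsub>Q\<^esub> = q 0"
  by (simp add: quotient_algebra_def ring.defs FactRing_def)

lemma one_Q: "\<one>\<^bsub>Q\<^esub> = q (basis_vec \<one>)"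
  by (simp add: quotient_algebra_def ring.defs FactRing_def a_r_coset_eq_lin_coset)

lemma add_Q: "q f \<oplus>\<^bsub>Q\<^esub> q g = q (f + g)"
  by (simp add: quotient_algebra_def ring.defs FactRing_def set_add_lin_coset subspace)

lemma smult_Q: "c \<odot>\<^bsub>Q\<^esub> q f = q (pm_smult c f)"
proof -
  have "pm_smult c g - pm_smult c f \<in> I" if "g \<in> q f" for g
    using pm.subspace_scale [OF subspace, of "g - f" c] that
    by (simp add: mem_lin_coset_iff pm.scale_right_diff_distrib)
  then have "(\<Union>x\<in>q f. q (pm_smult c x)) = q (pm_smult c f)"
    using q_self by (intro Union_lin_coset_const [OF subspace]) auto
  then show ?thesis
    by (simp add: quotient_algebra_def ring.defs a_r_coset_eq_lin_coset)
qed

lemma mult_Q: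
  assumes "keys f \<subseteq> carrier G" "keys g \<subseteq> carrier G"
  shows "q f \<otimes>\<^bsub>Q\<^esub> q g = q (bilinear_ext (mult G) f g)"
proof -
  have "bilinear_ext (mult G) f' g' - bilinear_ext (mult G) f g \<in> I" if "f' \<in> q f" "g' \<in> q g" for f' g'
  proof -
    \<comment> \<open>The usual splitting f'g' - fg = (f' - f)g' + f(g' - g). The ideal absorbs
      \<open>g'\<close> because representatives of an element of the quotient are again supported on
      the monoid.\<close>
    have "bilinear_ext (mult G) (f' - f) g' + bilinear_ext (mult G) f (g' - g) \<in> I"
      using that assms q_subset
      by (intro pm.subspace_add [OF subspace] l_closed r_closed) (auto simp: mem_lin_coset_iff)
    then show ?thesis
      by (simp add: bilinear_ext_linear)
  qed
  then have "(\<Union>x\<in>q f. \<Union>y\<in>q g. q (bilinear_ext (mult G) x y)) = q (bilinear_ext (mult G) f g)"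
    using q_self by (intro Union2_lin_coset_const [OF subspace]) auto
  then show ?thesis
    by (simp add: quotient_algebra_def ring.defs FactRing_def rcoset_mult_def a_r_coset_eq_lin_coset)
qed

lemma q_closed: "keys f \<subseteq> carrier G \<Longrightarrow> q f \<in> carrier Q"
  by (auto simp: carrier_Q)

lemma complex_algebra_Q: "complex_algebra Q"
proof (intro complex_algebra.intro ringI abelian_groupI monoidI complex_algebra_axioms.intro)
  fix x assume "x \<in> carrier Q"
  then obtain f where "keys f \<subseteq> carrier G" "x = q f"
    by (auto simp: carrier_Q)
  then show "\<exists>y\<in>carrier Q. y \<oplus>\<^bsub>Q\<^esub> x = \<zero>\<^bsub>Q\<^esub>"
    by (intro bexI [of _ "q (- f)"]) (auto simp: add_Q zero_Q intro!: q_closed)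
qed (auto simp: carrier_Q zero_Q one_Q add_Q mult_Q smult_Q keys_mult bilinear_ext_linear
      bilinear_ext_assoc bilinear_ext_one pm.scale_left_distrib pm.scale_right_distrib ac_simps
      free_on_add free_on_smult simp del: lin_coset_zero)

lemma Q_cases:
  assumes "x \<in> carrier Q"
  obtains f where "keys f \<subseteq> carrier G" "x = q f"
  using assms by (auto simp: carrier_Q)

lemma Q_induct [consumes 1, case_names add smult basis]:
  assumes "x \<in> carrier Q"
    and add: "\<And>x y. \<lbrakk>x \<in> carrier Q; y \<in> carrier Q; P x; P y\<rbrakk> \<Longrightarrow> P (x \<oplus>\<^bsub>Q\<^esub> y)"
    and smult: "\<And>c x. \<lbrakk>x \<in> carrier Q; P x\<rbrakk> \<Longrightarrow> P (c \<odot>\<^bsub>Q\<^esub> x)"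
    and basis: "\<And>g. g \<in> carrier G \<Longrightarrow> P (q (basis_vec g))"
  shows "P x"
proof -
  have "P (q f)" if "keys f \<subseteq> carrier G" for f
    using that
  proof (induction f rule: free_on_induct)
    case zero
    \<comment> \<open>The rule asks for no zero case: zero is the multiple by \<open>0\<close> of
      the class of the unit.\<close>
    have "P (0 \<odot>\<^bsub>Q\<^esub> q (basis_vec \<one>))"
      by (intro smult basis q_closed) auto
    then show ?case
      by (simp add: smult_Q)
  next
    case (add f g)
    then show ?case
      using assms(2) [of "q f" "q g"] by (simp add: q_closed add_Q)
  next
    case (smult c f)
    then show ?case
      using assms(3) [of "q f" c] by (simp add: q_closed smult_Q)
  next
    case (basis g)
    then show ?case
      using assms(4) by simp
  qed
  then show ?thesis
    using assms(1) by (auto simp: carrier_Q)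
qed

end

section \<open>Algebra homomorphisms and generated subalgebras\<close>

definition algebra_hom :: "(complex, 'a) module \<Rightarrow> (complex, 'b) module \<Rightarrow> ('a \<Rightarrow> 'b) \<Rightarrow> bool"
  where "algebra_hom A B h \<longleftrightarrow>
    h \<in> ring_hom A B \<and> (\<forall>c. \<forall>x\<in>carrier A. h (c \<odot>\<^bsub>A\<^esub> x) = c \<odot>\<^bsub>B\<^esub> h x)"

lemma algebra_homD:
  assumes "algebra_hom A B h"
  shows "x \<in> carrier A \<Longrightarrow> h x \<in> carrier B"
    and "\<lbrakk>x \<in> carrier A; y \<in> carrier A\<rbrakk> \<Longrightarrow> h (x \<oplus>\<^bsub>A\<^esub> y) = h x \<oplus>\<^bsub>B\<^esub> h y"
    and "\<lbrakk>x \<in> carrier A; y \<in> carrier A\<rbrakk> \<Longrightarrow> h (x \<otimes>\<^bsub>A\<^esub> y) = h x \<otimes>\<^bsub>B\<^esub> h y"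
    and "h \<one>\<^bsub>A\<^esub> = \<one>\<^bsub>B\<^esub>"
    and "x \<in> carrier A \<Longrightarrow> h (c \<odot>\<^bsub>A\<^esub> x) = c \<odot>\<^bsub>B\<^esub> h x"
    and "h \<in> ring_hom A B"
  using assms by (auto simp: algebra_hom_def ring_hom_def)

lemma algebra_homI:
  assumes "\<And>x. x \<in> carrier A \<Longrightarrow> h x \<in> carrier B"
    and "\<And>x y. \<lbrakk>x \<in> carrier A; y \<in> carrier A\<rbrakk> \<Longrightarrow> h (x \<oplus>\<^bsub>A\<^esub> y) = h x \<oplus>\<^bsub>B\<^esub> h y"
    and "\<And>x y. \<lbrakk>x \<in> carrier A; y \<in> carrier A\<rbrakk> \<Longrightarrow> h (x \<otimes>\<^bsub>A\<^esub> y) = h x \<otimes>\<^bsub>B\<^esub> h y"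
    and "h \<one>\<^bsub>A\<^esub> = \<one>\<^bsub>B\<^esub>"
    and "\<And>c x. x \<in> carrier A \<Longrightarrow> h (c \<odot>\<^bsub>A\<^esub> x) = c \<odot>\<^bsub>B\<^esub> h x"
  shows "algebra_hom A B h"
  using assms by (auto simp: algebra_hom_def ring_hom_def)

lemma algebra_embedding_eq: "algebra_embedding A B h \<longleftrightarrow> algebra_hom A B h \<and> inj_on h (carrier A)"
  by (auto simp: algebra_embedding_def algebra_hom_def)

text \<open>The scalar multiples of one, which belong to the generating set, are mapped to each
  other, so each rule of \<open>generate_ring\<close> can be pushed forward and pulled back along
  \<open>h\<close>. This computes the images of the identifications from their values on
  generators.\<close>

lemma generated_subalgebra_hom:
  assumes "complex_algebra A" and "complex_algebra B" and hom: "algebra_hom A B h"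
    and S: "S \<subseteq> carrier A"
  shows "h ` generated_subalgebra A S = generated_subalgebra B (h ` S)"
proof -
  interpret A: complex_algebra A by fact
  interpret B: complex_algebra B by fact
  interpret h: ring_hom_ring A B h
    by (intro ring_hom_ringI2 A.ring_axioms B.ring_axioms algebra_homD(6) [OF hom])
  have hs: "h (c \<odot>\<^bsub>A\<^esub> \<one>\<^bsub>A\<^esub>) = c \<odot>\<^bsub>B\<^esub> \<one>\<^bsub>B\<^esub>" for c
    by (simp add: algebra_homD(5) [OF hom])
  let ?S = "S \<union> {c \<odot>\<^bsub>A\<^esub> \<one>\<^bsub>A\<^esub> |c. True}"
  have im: "h ` S \<union> {c \<odot>\<^bsub>B\<^esub> \<one>\<^bsub>B\<^esub> |c. True} = h ` ?S"
    by (auto simp: hs [symmetric])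
  have car: "x \<in> carrier A" if "x \<in> generate_ring A ?S" for x
    using A.generate_ring_in_carrier [OF _ that] S A.asmult_closed by auto
  have "h x \<in> generate_ring B (h ` ?S)" if "x \<in> generate_ring A ?S" for x
    using that
  proof (induction rule: generate_ring.induct)
    case one
    show ?case using generate_ring.one [of B] by simp
  next
    case (a_inv x)
    then show ?case using car generate_ring.a_inv [of "h x" B] by simp
  next
    case (eng_add x y)
    then show ?case using car generate_ring.eng_add [of "h x" B _ "h y"] by simp
  next
    case (eng_mult x y)
    then show ?case using car generate_ring.eng_mult [of "h x" B _ "h y"] by simp
  qed (blast intro: generate_ring.incl)
  moreover have "y \<in> h ` generate_ring A ?S" if "y \<in> generate_ring B (h ` ?S)" for y
    using that
  proof (induction rule: generate_ring.induct)
    case one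
    show ?case using generate_ring.one [of A] by (force simp flip: h.hom_one)
  next
    case (a_inv y)
    then show ?case using car generate_ring.a_inv by (force simp flip: h.hom_a_inv)
  next
    case (eng_add y z)
    then show ?case using car generate_ring.eng_add by (force simp flip: h.hom_add)
  next
    case (eng_mult y z)
    then show ?case using car generate_ring.eng_mult by (force simp flip: h.hom_mult)
  qed (blast intro: generate_ring.incl)
  ultimately show ?thesis
    unfolding generated_subalgebra_def im by blast
qed

lemma generated_subalgebra_closed:
  "x \<in> S \<Longrightarrow> x \<in> generated_subalgebra A S"
  "\<one>\<^bsub>A\<^esub> \<in> generated_subalgebra A S"
  "\<lbrakk>x \<in> generated_subalgebra A S; y \<in> generated_subalgebra A S\<rbrakk> \<Longrightarrow>
    x \<oplus>\<^bsub>A\<^esub> y \<in> generated_subalgebra A S"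
  "\<lbrakk>x \<in> generated_subalgebra A S; y \<in> generated_subalgebra A S\<rbrakk> \<Longrightarrow>
    x \<otimes>\<^bsub>A\<^esub> y \<in> generated_subalgebra A S"
  unfolding generated_subalgebra_def
  by (simp_all add: generate_ring.incl generate_ring.one generate_ring.eng_add generate_ring.eng_mult)

lemma generated_subalgebra_mono: "S \<subseteq> T \<Longrightarrow> generated_subalgebra A S \<subseteq> generated_subalgebra A T"
proof
  fix x assume "S \<subseteq> T" and x: "x \<in> generated_subalgebra A S"
  from x show "x \<in> generated_subalgebra A T"
    unfolding generated_subalgebra_def
    by (induction rule: generate_ring.induct) (use \<open>S \<subseteq> T\<close> in \<open>auto intro: generate_ring.intros\<close>)
qed

context complex_algebra
begin

lemma generated_subalgebra_subset: "S \<subseteq> carrier A \<Longrightarrow> generated_subalgebra A S \<subseteq> carrier A"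
  unfolding generated_subalgebra_def by (rule generate_ring_incl) (auto simp: asmult_closed)

lemma generated_subalgebra_asmult:
  assumes "S \<subseteq> carrier A" and x: "x \<in> generated_subalgebra A S"
  shows "c \<odot> x \<in> generated_subalgebra A S"
proof -
  have "c \<odot> \<one> \<in> generated_subalgebra A S"
    unfolding generated_subalgebra_def by (rule generate_ring.incl) auto
  then have "(c \<odot> \<one>) \<otimes> x \<in> generated_subalgebra A S"
    using x by (rule generated_subalgebra_closed)
  then show ?thesis
    using generated_subalgebra_subset assms by (simp add: asmult_eq_mult [of x c] subset_iff)
qed

text \<open>The fixed points of an algebra endomorphism form a subalgebra. The endomorphism of
  interest is an identification followed by its intended left inverse.\<close>

lemma algebra_hom_fix_generated:
  assumes h: "algebra_hom A A h" and "S \<subseteq> carrier A" and fixed: "\<And>s. s \<in> S \<Longrightarrow> h s = s"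
    and x: "x \<in> generated_subalgebra A S"
  shows "h x = x"
proof -
  interpret h: ring_hom_ring A A h
    by (intro ring_hom_ringI2 ring_axioms algebra_homD(6) [OF h])
  have car: "y \<in> carrier A" if "y \<in> generate_ring A (S \<union> {c \<odot> \<one> |c. True})" for y
    using generated_subalgebra_subset [OF assms(2)] that by (auto simp: generated_subalgebra_def)
  show ?thesis
    using x unfolding generated_subalgebra_def
    by (induction rule: generate_ring.induct)
      (use fixed car in \<open>auto simp: algebra_homD(5) [OF h]\<close>)
qed

end

lemma algebra_hom_comp:
  "\<lbrakk>algebra_hom A B h; algebra_hom B C k\<rbrakk> \<Longrightarrow> algebra_hom A C (k \<circ> h)"
  by (auto simp: algebra_homD intro!: algebra_homI)

text \<open>The universal property of the quotient. Multiplicativity and the unit are demanded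
  modulo \<open>I'\<close> only, so that \<open>\<phi>\<close> may return arbitrarily chosen
  representatives. The choice by \<open>SOME\<close> in \<open>h\<close> is harmless since two
  representatives differ by an element of \<open>I\<close>, which \<open>\<phi>\<close> sends into
  \<open>I'\<close>.\<close>

lemma quotient_algebra_hom_exists:
  assumes G: "monoid_quotient G I" and G': "monoid_quotient G' I'"
    and keys: "\<And>x. x \<in> carrier G \<Longrightarrow> keys (\<phi> x) \<subseteq> carrier G'"
    and mult: "\<And>x y. \<lbrakk>x \<in> carrier G; y \<in> carrier G\<rbrakk> \<Longrightarrow>
      \<phi> (x \<otimes>\<^bsub>G\<^esub> y) - bilinear_ext (mult G') (\<phi> x) (\<phi> y) \<in> I'"
    and one: "\<phi> \<one>\<^bsub>G\<^esub> - basis_vec \<one>\<^bsub>G'\<^esub> \<in> I'"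
    and I: "\<And>f. f \<in> I \<Longrightarrow> linear_ext \<phi> f \<in> I'"
  obtains h where
    "algebra_hom (quotient_algebra (monoid_algebra G) I) (quotient_algebra (monoid_algebra G') I') h"
    and "\<And>f. keys f \<subseteq> carrier G \<Longrightarrow> h (lin_coset I f) = lin_coset I' (linear_ext \<phi> f)"
proof -
  interpret G: monoid_quotient G I by fact
  interpret G': monoid_quotient G' I' by fact
  define h where "h C = G'.q (linear_ext \<phi> (SOME f. f \<in> C))" for C
  have h: "h (G.q f) = G'.q (linear_ext \<phi> f)" for f
  proof -
    have "(SOME g. g \<in> G.q f) \<in> G.q f"
      by (rule someI) (rule G.q_self)
    then have "linear_ext \<phi> ((SOME g. g \<in> G.q f) - f) \<in> I'"
      by (intro I) (simp add: mem_lin_coset_iff)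
    then show ?thesis
      by (simp add: h_def G'.q_eq_iff linear_ext_linear)
  qed
  have keys': "keys (linear_ext \<phi> f) \<subseteq> carrier G'"
    if "keys f \<subseteq> carrier G" for f
    using that by (intro keys_linear_ext keys) auto
  have mult': "G'.q (linear_ext \<phi> (bilinear_ext (mult G) f g)) =
      G'.q (bilinear_ext (mult G') (linear_ext \<phi> f) (linear_ext \<phi> g))"
    if f: "keys f \<subseteq> carrier G" and g: "keys g \<subseteq> carrier G" for f g
    using f
  proof (induction f rule: free_on_induct)
    case (basis x)
    show ?case
      using g
    proof (induction g rule: free_on_induct)
      case (basis y)
      then show ?case
        using \<open>x \<in> _\<close> by (simp add: mult G'.q_eq_iff)
    qed (simp_all add: bilinear_ext_linear linear_ext_linear flip: G'.add_Q G'.smult_Q)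
  qed (simp_all add: bilinear_ext_linear linear_ext_linear flip: G'.add_Q G'.smult_Q)
  have "algebra_hom G.Q G'.Q h"
    by (rule algebra_homI)
      (auto elim!: G.Q_cases simp: G.add_Q G.mult_Q G.smult_Q G.one_Q h G'.add_Q G'.mult_Q G'.smult_Q
        G'.one_Q linear_ext_linear keys' mult' G'.q_closed G'.q_eq_iff one)
  with h show ?thesis
    by (intro that)
qed

section \<open>Modules\<close>

lemma (in left_module) lsmult_zero: "x \<in> carrier M \<Longrightarrow> \<zero>\<^bsub>R\<^esub> \<odot>\<^bsub>M\<^esub> x = \<zero>\<^bsub>M\<^esub>"
  using lsmult_l_distr [of "\<zero>\<^bsub>R\<^esub>" "\<zero>\<^bsub>R\<^esub>" x] lsmult_closed [of "\<zero>\<^bsub>R\<^esub>" x]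
  by simp

lemma restrict_scalars_simps [simp]:
  "carrier (restrict_scalars \<iota> M) = carrier M" "add (restrict_scalars \<iota> M) = add M"
  "zero (restrict_scalars \<iota> M) = zero M" "b \<odot>\<^bsub>restrict_scalars \<iota> M\<^esub> x = \<iota> b \<odot>\<^bsub>M\<^esub> x"
  by (simp_all add: restrict_scalars_def)

lemma abelian_group_cong:
  assumes "abelian_group M" "carrier N = carrier M" "add N = add M" "zero N = zero M"
  shows "abelian_group N"
proof -
  interpret abelian_group M by fact
  show ?thesis
    by (intro abelian_groupI) (auto simp: assms a_ac intro: bexI [OF _ a_inv_closed] l_neg)
qed

lemma left_module_restrict_scalars:
  assumes "left_module B M" and "ring A" and "\<iota> \<in> ring_hom A B"
  shows "left_module A (restrict_scalars \<iota> M)"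
proof -
  interpret M: left_module B M by fact
  interpret A: ring A by fact
  interpret h: ring_hom_ring A B \<iota>
    using assms(3) by (intro ring_hom_ringI2 A.ring_axioms M.R.ring_axioms)
  show ?thesis
    by (intro left_module.intro A.ring_axioms abelian_group_cong [OF M.M.abelian_group_axioms]
        left_module_axioms.intro)
      (auto simp: M.lsmult_closed M.lsmult_l_distr M.lsmult_r_distr M.lsmult_assoc M.lsmult_one)
qed

text \<open>Over a finite index set the condition of finite support is automatic, so the carrier is
  the full extensional product.\<close>

lemma direct_sum_simps:
  "zero (direct_sum I M) = (\<lambda>i\<in>I. \<zero>\<^bsub>M i\<^esub>)"
  "x \<oplus>\<^bsub>direct_sum I M\<^esub> y = (\<lambda>i\<in>I. x i \<oplus>\<^bsub>M i\<^esub> y i)"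
  "a \<odot>\<^bsub>direct_sum I M\<^esub> x = (\<lambda>i\<in>I. a \<odot>\<^bsub>M i\<^esub> x i)"
  "finite I \<Longrightarrow> carrier (direct_sum I M) = (\<Pi>\<^sub>E i\<in>I. carrier (M i))"
  by (simp_all add: direct_sum_def)

lemma left_module_direct_sum:
  assumes "ring A" and "finite I" and M: "\<And>i. i \<in> I \<Longrightarrow> left_module A (M i)"
  shows "left_module A (direct_sum I M)"
proof -
  have ag: "abelian_group (M i)" if "i \<in> I" for i
    using M [OF that] by (rule left_module.axioms)
  note ag' = abelian_group.axioms(1) [OF ag]
  show ?thesis
  proof (intro left_module.intro \<open>ring A\<close> abelian_groupI left_module_axioms.intro)
    fix x assume x: "x \<in> carrier (direct_sum I M)"
    then show "\<exists>y\<in>carrier (direct_sum I M). y \<oplus>\<^bsub>direct_sum I M\<^esub> x = \<zero>\<^bsub>direct_sum I M\<^esub>"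
      using \<open>finite I\<close>
      by (intro bexI [of _ "\<lambda>i\<in>I. \<ominus>\<^bsub>M i\<^esub> x i"])
        (auto simp: direct_sum_simps PiE_mem [of _ I "\<lambda>i. carrier (M i)"] abelian_group.l_neg [OF ag]
          abelian_group.a_inv_closed [OF ag])
  qed (use \<open>finite I\<close> in \<open>auto simp: direct_sum_simps PiE_mem [of _ I "\<lambda>i. carrier (M i)"]
      abelian_monoid.a_closed [OF ag'] abelian_monoid.zero_closed [OF ag']
      abelian_monoid.a_assoc [OF ag'] abelian_monoid.l_zero [OF ag']
      abelian_monoid.a_comm [OF ag'] abelian_monoid.a_lcomm [OF ag'] abelian_monoid.r_zero [OF ag'] left_module.lsmult_closed [OF M]
      left_module.lsmult_l_distr [OF M] left_module.lsmult_r_distr [OF M]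
      left_module.lsmult_assoc [OF M] left_module.lsmult_one [OF M]
      intro!: restrict_ext PiE_ext [of _ I "\<lambda>i. carrier (M i)"]\<close>)
qed

text \<open>The maps \<open>f i\<close> and \<open>g i\<close> play the projections and inclusions
  of a direct sum decomposition: \<open>f_g\<close> is orthogonality and \<open>g_f\<close>
  completeness. They make the combined map bijective, so additivity and equivariance are demanded of
  \<open>f\<close> alone. The ring elements that commute with \<open>f i\<close> form a subring,
  which is why equivariance is demanded only for ring generators.\<close>

lemma module_iso_direct_sumI:
  fixes V :: "('a, 'v::ab_group_add) module"
  assumes gen: "carrier A = generate_ring A S"
    and V: "left_module A V" and V_add: "add V = (+)" and V_zero: "\<zero>\<^bsub>V\<^esub> = 0"
    and I: "finite I" and W: "\<And>i. i \<in> I \<Longrightarrow> left_module A (W i)"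
    and f_closed: "\<And>i x. \<lbrakk>i \<in> I; x \<in> carrier V\<rbrakk> \<Longrightarrow> f i x \<in> carrier (W i)"
    and f_add: "\<And>i x y. \<lbrakk>i \<in> I; x \<in> carrier V; y \<in> carrier V\<rbrakk> \<Longrightarrow> f i (x + y) = f i x \<oplus>\<^bsub>W i\<^esub> f i y"
    and f_gen: "\<And>i s x. \<lbrakk>i \<in> I; s \<in> S; x \<in> carrier V\<rbrakk> \<Longrightarrow> f i (s \<odot>\<^bsub>V\<^esub> x) = s \<odot>\<^bsub>W i\<^esub> f i x"
    and g_closed: "\<And>i w. \<lbrakk>i \<in> I; w \<in> carrier (W i)\<rbrakk> \<Longrightarrow> g i w \<in> carrier V"
    and f_g: "\<And>i j w. \<lbrakk>i \<in> I; j \<in> I; w \<in> carrier (W i)\<rbrakk> \<Longrightarrow> f j (g i w) = (if i = j then w else \<zero>\<^bsub>W j\<^esub>)"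
    and g_f: "\<And>x. x \<in> carrier V \<Longrightarrow> (\<Sum>i\<in>I. g i (f i x)) = x"
  shows "module_iso A V (direct_sum I W)"
proof -
  interpret V: left_module A V by fact
  have V_sum: "(\<Sum>i\<in>J. h i) \<in> carrier V" if "\<And>i. i \<in> J \<Longrightarrow> h i \<in> carrier V" for h :: "_ \<Rightarrow> 'v" and J
    using that V.M.a_closed V.M.zero_closed
    by (induction J rule: infinite_finite_induct) (auto simp: V_add V_zero)
  have f_zero: "f i 0 = \<zero>\<^bsub>W i\<^esub>" if "i \<in> I" for i
  proof -
    interpret W: left_module A "W i" by (rule W) fact
    have "0 \<in> carrier V"
      using V.M.zero_closed by (simp add: V_zero)
    with f_add [OF that this this] f_closed [OF that this] show ?thesis
      by simp
  qed
  have equiv: "f i (s \<odot>\<^bsub>V\<^esub> x) = s \<odot>\<^bsub>W i\<^esub> f i x"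
    if "i \<in> I" "s \<in> carrier A" "x \<in> carrier V" for i s x
  proof -
    interpret W: left_module A "W i" by (rule W) fact
    have "s \<in> generate_ring A S"
      using that gen by simp
    then show ?thesis
      using \<open>x \<in> carrier V\<close>
    proof (induction arbitrary: x rule: generate_ring.induct)
      case one
      then show ?case
        using \<open>i \<in> I\<close> by (simp add: V.lsmult_one W.lsmult_one f_closed)
    next
      case (incl s)
      then show ?case
        using \<open>i \<in> I\<close> by (simp add: f_gen)
    next
      case (a_inv s)
      have s: "s \<in> carrier A"
        using a_inv gen by simp
      \<comment> \<open>The images under \<open>f i\<close> of (-s)x and the elements (-s)(f i x)
        are both inverse to s(f i x), hence equal by uniqueness of additive inverses.\<close>
      have "f i (\<ominus>\<^bsub>A\<^esub> s \<odot>\<^bsub>V\<^esub> x + s \<odot>\<^bsub>V\<^esub> x) = \<zero>\<^bsub>W i\<^esub>"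
        using V.lsmult_l_distr [of "\<ominus>\<^bsub>A\<^esub> s" s x] s a_inv.prems V.lsmult_zero [of x] f_zero \<open>i \<in> I\<close>
        by (simp add: V_add V_zero V.R.l_neg)
      then have "f i (\<ominus>\<^bsub>A\<^esub> s \<odot>\<^bsub>V\<^esub> x) \<oplus>\<^bsub>W i\<^esub> s \<odot>\<^bsub>W i\<^esub> f i x = \<zero>\<^bsub>W i\<^esub>"
        using f_add s a_inv \<open>i \<in> I\<close> by (simp add: V.lsmult_closed)
      moreover have "(\<ominus>\<^bsub>A\<^esub> s) \<odot>\<^bsub>W i\<^esub> f i x \<oplus>\<^bsub>W i\<^esub> s \<odot>\<^bsub>W i\<^esub> f i x = \<zero>\<^bsub>W i\<^esub>"
        using W.lsmult_l_distr [of "\<ominus>\<^bsub>A\<^esub> s" s "f i x"] s a_inv.prems W.lsmult_zero f_closed \<open>i \<in> I\<close>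
        by (simp add: V.R.l_neg)
      ultimately show ?case
        using s a_inv.prems f_closed \<open>i \<in> I\<close> V.lsmult_closed W.lsmult_closed
        by (metis W.M.minus_equality V.R.a_inv_closed)
    next
      case (eng_add s t)
      then have "s \<in> carrier A" "t \<in> carrier A"
        using gen by auto
      then show ?case
        using eng_add f_add [of i "s \<odot>\<^bsub>V\<^esub> x" "t \<odot>\<^bsub>V\<^esub> x"] \<open>i \<in> I\<close>
        by (simp add: V.lsmult_l_distr W.lsmult_l_distr f_closed V.lsmult_closed V_add)
    next
      case (eng_mult s t)
      then have "s \<in> carrier A" "t \<in> carrier A"
        using gen by auto
      then show ?case
        using eng_mult \<open>i \<in> I\<close>
        by (simp add: V.lsmult_assoc W.lsmult_assoc f_closed V.lsmult_closed)
    qed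
  qed
  \<comment> \<open>Stated for subsets \<open>J\<close> because the induction adds one index at a
    time. For \<open>J = I\<close> it says that the projections recover the family
    \<open>w\<close>.\<close>
  have f_sum: "f j (\<Sum>i\<in>J. g i (w i)) = (if j \<in> J then w j else \<zero>\<^bsub>W j\<^esub>)"
    if "finite J" "J \<subseteq> I" "j \<in> I" and w: "\<And>i. i \<in> I \<Longrightarrow> w i \<in> carrier (W i)" for j w J
    using that(1,2)
  proof (induction J rule: finite_induct)
    case (insert i J)
    interpret W: left_module A "W j" by (rule W) fact
    have "(\<Sum>i\<in>J. g i (w i)) \<in> carrier V"
      using insert.prems w by (intro V_sum g_closed) auto
    then show ?case
      using insert w \<open>j \<in> I\<close> by (auto simp: f_add g_closed f_g)
  qed (use f_zero \<open>j \<in> I\<close> in simp)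
  let ?F = "\<lambda>x. \<lambda>i\<in>I. f i x" and ?G = "\<lambda>w. \<Sum>i\<in>I. g i (w i)"
  have "bij_betw ?F (carrier V) (carrier (direct_sum I W))"
  proof (rule bij_betwI [where g = ?G])
    show "?F \<in> carrier V \<rightarrow> carrier (direct_sum I W)"
      using f_closed I by (auto simp: direct_sum_simps)
    show "?G \<in> carrier (direct_sum I W) \<rightarrow> carrier V"
      using I by (auto simp: direct_sum_simps PiE_mem [of _ I "\<lambda>i. carrier (W i)"] intro!: V_sum g_closed)
    show "?G (?F x) = x" if "x \<in> carrier V" for x
      using g_f [OF that] by simp
    show "?F (?G w) = w" if "w \<in> carrier (direct_sum I W)" for w
      using that I
      by (intro PiE_ext [of _ I "\<lambda>i. carrier (W i)"]) (auto simp: direct_sum_simps f_sum f_closed V_sum g_closed PiE_mem [of _ I "\<lambda>i. carrier (W i)"])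
  qed
  moreover have "left_module A (direct_sum I W)"
    using V.R.ring_axioms I W by (rule left_module_direct_sum)
  ultimately show ?thesis
    unfolding module_iso_def
    by (intro conjI V exI [of _ ?F]) (auto simp: direct_sum_simps V_add f_add equiv)
qed

section \<open>Tensor products\<close>

text \<open>Covers both the multiplication of an algebra and its action on a module, so that one
  argument shows that products in the tensor algebra and the action on the tensor module are well
  defined.\<close>

definition bilinear_map ::
  "(complex, 'a) module \<Rightarrow> (complex, 'u) module \<Rightarrow> (complex, 'w) module \<Rightarrow> ('a \<Rightarrow> 'u \<Rightarrow> 'w) \<Rightarrow> bool"
  where "bilinear_map U V W \<phi> \<longleftrightarrow>
    (\<forall>x\<in>carrier U. \<forall>y\<in>carrier V. \<phi> x y \<in> carrier W) \<and>
    (\<forall>x\<in>carrier U. \<forall>x'\<in>carrier U. \<forall>y\<in>carrier V. \<phi> (x \<oplus>\<^bsub>U\<^esub> x') y = \<phi> x y \<oplus>\<^bsub>W\<^esub> \<phi> x' y) \<and>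
    (\<forall>x\<in>carrier U. \<forall>y\<in>carrier V. \<forall>y'\<in>carrier V. \<phi> x (y \<oplus>\<^bsub>V\<^esub> y') = \<phi> x y \<oplus>\<^bsub>W\<^esub> \<phi> x y') \<and>
    (\<forall>c. \<forall>x\<in>carrier U. \<forall>y\<in>carrier V. \<phi> (c \<odot>\<^bsub>U\<^esub> x) y = c \<odot>\<^bsub>W\<^esub> \<phi> x y) \<and>
    (\<forall>c. \<forall>x\<in>carrier U. \<forall>y\<in>carrier V. \<phi> x (c \<odot>\<^bsub>V\<^esub> y) = c \<odot>\<^bsub>W\<^esub> \<phi> x y)"

lemma subspace_tensor_relations: "pm.subspace (tensor_relations U V)"
  unfolding tensor_relations_def by (rule pm.subspace_span)

lemma tensor_relations_base:
  "\<lbrakk>x \<in> carrier U; x' \<in> carrier U; y \<in> carrier V\<rbrakk> \<Longrightarrow>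
    basis_vec (x \<oplus>\<^bsub>U\<^esub> x', y) - basis_vec (x, y) - basis_vec (x', y) \<in> tensor_relations U V"
  "\<lbrakk>x \<in> carrier U; y \<in> carrier V; y' \<in> carrier V\<rbrakk> \<Longrightarrow>
    basis_vec (x, y \<oplus>\<^bsub>V\<^esub> y') - basis_vec (x, y) - basis_vec (x, y') \<in> tensor_relations U V"
  "\<lbrakk>x \<in> carrier U; y \<in> carrier V\<rbrakk> \<Longrightarrow>
    basis_vec (c \<odot>\<^bsub>U\<^esub> x, y) - pm_smult c (basis_vec (x, y)) \<in> tensor_relations U V"
  "\<lbrakk>x \<in> carrier U; y \<in> carrier V\<rbrakk> \<Longrightarrow>
    basis_vec (x, c \<odot>\<^bsub>V\<^esub> y) - pm_smult c (basis_vec (x, y)) \<in> tensor_relations U V"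
  unfolding tensor_relations_def by (rule pm.span_base, blast)+

lemma tensor_relations_induct:
  assumes f: "f \<in> tensor_relations U V" and K: "pm.subspace {h. P h}"
    and "\<And>x x' y. \<lbrakk>x \<in> carrier U; x' \<in> carrier U; y \<in> carrier V\<rbrakk> \<Longrightarrow>
      P (basis_vec (x \<oplus>\<^bsub>U\<^esub> x', y) - basis_vec (x, y) - basis_vec (x', y))"
    and "\<And>x y y'. \<lbrakk>x \<in> carrier U; y \<in> carrier V; y' \<in> carrier V\<rbrakk> \<Longrightarrow>
      P (basis_vec (x, y \<oplus>\<^bsub>V\<^esub> y') - basis_vec (x, y) - basis_vec (x, y'))"
    and "\<And>c x y. \<lbrakk>x \<in> carrier U; y \<in> carrier V\<rbrakk> \<Longrightarrow>
      P (basis_vec (c \<odot>\<^bsub>U\<^esub> x, y) - pm_smult c (basis_vec (x, y)))"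
    and "\<And>c x y. \<lbrakk>x \<in> carrier U; y \<in> carrier V\<rbrakk> \<Longrightarrow>
      P (basis_vec (x, c \<odot>\<^bsub>V\<^esub> y) - pm_smult c (basis_vec (x, y)))"
  shows "P f"
  using f unfolding tensor_relations_def
  by (induction rule: pm.span_induct) (use K assms(3-) in auto)

lemma tensor_relations_subset:
  assumes "\<And>x y. \<lbrakk>x \<in> carrier U; y \<in> carrier U\<rbrakk> \<Longrightarrow> x \<oplus>\<^bsub>U\<^esub> y \<in> carrier U"
    and "\<And>x y. \<lbrakk>x \<in> carrier V; y \<in> carrier V\<rbrakk> \<Longrightarrow> x \<oplus>\<^bsub>V\<^esub> y \<in> carrier V"
    and "\<And>c x. x \<in> carrier U \<Longrightarrow> c \<odot>\<^bsub>U\<^esub> x \<in> carrier U"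
    and "\<And>c x. x \<in> carrier V \<Longrightarrow> c \<odot>\<^bsub>V\<^esub> x \<in> carrier V"
  shows "tensor_relations U V \<subseteq> free_on (carrier U \<times> carrier V)"
proof
  fix f assume "f \<in> tensor_relations U V"
  then show "f \<in> free_on (carrier U \<times> carrier V)"
    unfolding mem_Collect_eq
    by (rule tensor_relations_induct [OF _ subspace_free_on])
      (intro free_on_diff free_on_smult; use assms in simp)+
qed

text \<open>The universal property of the tensor product, for maps that are bilinear modulo
  \<open>K\<close>. It is used with an ideal as \<open>K\<close> to map out of a tensor algebra, and
  with the zero subspace to glue tableaux.\<close>

lemma linear_ext_tensor_relations:
  assumes f: "f \<in> tensor_relations U V" and K: "pm.subspace K"
    and "\<And>x x' y. \<lbrakk>x \<in> carrier U; x' \<in> carrier U; y \<in> carrier V\<rbrakk> \<Longrightarrow>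
      \<phi> (x \<oplus>\<^bsub>U\<^esub> x') y - \<phi> x y - \<phi> x' y \<in> K"
    and "\<And>x y y'. \<lbrakk>x \<in> carrier U; y \<in> carrier V; y' \<in> carrier V\<rbrakk> \<Longrightarrow>
      \<phi> x (y \<oplus>\<^bsub>V\<^esub> y') - \<phi> x y - \<phi> x y' \<in> K"
    and "\<And>c x y. \<lbrakk>x \<in> carrier U; y \<in> carrier V\<rbrakk> \<Longrightarrow> \<phi> (c \<odot>\<^bsub>U\<^esub> x) y - pm_smult c (\<phi> x y) \<in> K"
    and "\<And>c x y. \<lbrakk>x \<in> carrier U; y \<in> carrier V\<rbrakk> \<Longrightarrow> \<phi> x (c \<odot>\<^bsub>V\<^esub> y) - pm_smult c (\<phi> x y) \<in> K"
  shows "linear_ext (\<lambda>(x, y). \<phi> x y) f \<in> K"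
proof -
  have "pm.subspace {f. linear_ext (\<lambda>(x, y). \<phi> x y) f \<in> K}"
    using K by (auto simp: pm.subspace_def linear_ext_linear)
  then show ?thesis
    by (rule tensor_relations_induct [OF f])
      (use assms(3-) in \<open>simp_all add: linear_ext_linear\<close>)
qed

text \<open>By linearity the other argument may be a single pair. A defining relation is then sent
  to a defining relation of the same kind, because \<open>\<phi>\<close> and \<open>\<psi>\<close>
  are additive and homogeneous in each variable.\<close>

lemma bilinear_ext_tensor_relations:
  assumes \<phi>: "bilinear_map A M P \<phi>" and \<psi>: "bilinear_map B N R \<psi>"
  shows "\<lbrakk>f \<in> tensor_relations A B; keys g \<subseteq> carrier M \<times> carrier N\<rbrakk> \<Longrightarrow>
      bilinear_ext (\<lambda>(a, b) (u, v). (\<phi> a u, \<psi> b v)) f g \<in> tensor_relations P R"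
    and "\<lbrakk>keys f \<subseteq> carrier A \<times> carrier B; g \<in> tensor_relations M N\<rbrakk> \<Longrightarrow>
      bilinear_ext (\<lambda>(a, b) (u, v). (\<phi> a u, \<psi> b v)) f g \<in> tensor_relations P R"
proof -
  let ?\<Phi> = "\<lambda>(a, b) (u, v). (\<phi> a u, \<psi> b v)" and ?D = "tensor_relations P R"
  note sub = subspace_tensor_relations [of P R]
  note D = pm.subspace_0 [OF sub] pm.subspace_add [OF sub] pm.subspace_scale [OF sub]
  have sub1: "pm.subspace {f. bilinear_ext ?\<Phi> f g \<in> ?D}" for g
    using D by (auto simp: pm.subspace_def bilinear_ext_linear)
  have sub2: "pm.subspace {g. bilinear_ext ?\<Phi> f g \<in> ?D}" for f
    using D by (auto simp: pm.subspace_def bilinear_ext_linear)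
  note bil = \<phi> [unfolded bilinear_map_def] \<psi> [unfolded bilinear_map_def]
  show "bilinear_ext ?\<Phi> f g \<in> ?D"
    if f: "f \<in> tensor_relations A B" and g: "keys g \<subseteq> carrier M \<times> carrier N"
    using g
  proof (induction g rule: free_on_induct)
    case (basis x)
    then obtain u v where x: "x = (u, v)" and uv: "u \<in> carrier M" "v \<in> carrier N"
      by auto
    show ?case
      unfolding x
      by (rule tensor_relations_induct [OF f sub1])
        (use bil uv in \<open>simp_all add: bilinear_ext_linear tensor_relations_base\<close>)
  qed (simp_all add: bilinear_ext_linear D)
  show "bilinear_ext ?\<Phi> f g \<in> ?D"
    if g: "g \<in> tensor_relations M N" and f: "keys f \<subseteq> carrier A \<times> carrier B"
    using f
  proof (induction f rule: free_on_induct)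
    case (basis x)
    then obtain a b where x: "x = (a, b)" and ab: "a \<in> carrier A" "b \<in> carrier B"
      by auto
    show ?case
      unfolding x
      by (rule tensor_relations_induct [OF g sub2])
        (use bil ab in \<open>simp_all add: bilinear_ext_linear tensor_relations_base\<close>)
  qed (simp_all add: bilinear_ext_linear D)
qed

lemma complex_space_simps [simp]:
  "carrier (complex_space A M) = carrier M" "add (complex_space A M) = add M"
  "c \<odot>\<^bsub>complex_space A M\<^esub> x = (c \<odot>\<^bsub>A\<^esub> \<one>\<^bsub>A\<^esub>) \<odot>\<^bsub>M\<^esub> x"
  by (simp_all add: complex_space_def)

lemma (in complex_algebra) bilinear_map_mult: "bilinear_map A A A (mult A)"
  by (simp add: bilinear_map_def l_distr r_distr asmult_mult_l asmult_mult_r)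

text \<open>Scalars act on \<open>M\<close> through the central elements
  \<open>c \<odot> \<one>\<close>, so they can be moved past the action of any algebra
  element.\<close>

lemma (in complex_algebra) bilinear_map_smult:
  assumes "left_module A M"
  shows "bilinear_map A (complex_space A M) (complex_space A M) (smult M)"
proof -
  interpret M: left_module A M by fact
  have "(c \<odot> a) \<odot>\<^bsub>M\<^esub> u = (c \<odot> \<one>) \<odot>\<^bsub>M\<^esub> (a \<odot>\<^bsub>M\<^esub> u)" "a \<odot>\<^bsub>M\<^esub> ((c \<odot> \<one>) \<odot>\<^bsub>M\<^esub> u) = (c \<odot> \<one>) \<odot>\<^bsub>M\<^esub> (a \<odot>\<^bsub>M\<^esub> u)"
    if "a \<in> carrier A" "u \<in> carrier M" for c a u
    using that
    by (simp_all add: M.lsmult_assoc [symmetric] asmult_closed asmult_mult_l asmult_mult_r)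
  note * = this M.lsmult_closed M.lsmult_l_distr M.lsmult_r_distr
  show ?thesis
    unfolding bilinear_map_def complex_space_simps
    by (intro conjI ballI allI; rule *; assumption)
qed

lemma tensor_monoid_quotient:
  assumes "complex_algebra A" and "complex_algebra B"
  shows "monoid_quotient (A \<times>\<times> B) (tensor_relations A B)"
proof -
  interpret A: complex_algebra A by fact
  interpret B: complex_algebra B by fact
  note bil = bilinear_ext_tensor_relations [OF A.bilinear_map_mult B.bilinear_map_mult]
  show ?thesis
  proof (intro monoid_quotient.intro monoid_quotient_axioms.intro)
    show "Group.monoid (A \<times>\<times> B)"
      by (intro DirProd_monoid A.monoid_axioms B.monoid_axioms)
    show "tensor_relations A B \<subseteq> free_on (carrier (A \<times>\<times> B))"
      using tensor_relations_subset [of A B] by (auto simp: DirProd_def A.asmult_closed B.asmult_closed)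
  qed (use bil in \<open>auto simp: DirProd_def subspace_tensor_relations\<close>)
qed

lemma pure_tensor_eq: "pure_tensor A B a b = lin_coset (tensor_relations A B) (basis_vec (a, b))"
  by (simp add: pure_tensor_def a_r_coset_eq_lin_coset)

locale algebra_pair = A: complex_algebra A + B: complex_algebra B
  for A :: "(complex, 'a) module" and B :: "(complex, 'b) module"
begin

sublocale AB: monoid_quotient "A \<times>\<times> B" "tensor_relations A B"
  by (intro tensor_monoid_quotient A.complex_algebra_axioms B.complex_algebra_axioms)

lemma tensor_algebra_eq: "tensor_algebra A B = AB.Q"
  by (simp add: tensor_algebra_def)

lemma complex_algebra_tensor: "complex_algebra (tensor_algebra A B)"
  unfolding tensor_algebra_eq by (rule AB.complex_algebra_Q)

lemma carrier_AB: "carrier (A \<times>\<times> B) = carrier A \<times> carrier B"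
  and one_AB: "\<one>\<^bsub>A \<times>\<times> B\<^esub> = (\<one>\<^bsub>A\<^esub>, \<one>\<^bsub>B\<^esub>)"
  by (simp_all add: DirProd_def)

lemma pure_tensor_closed:
  "\<lbrakk>a \<in> carrier A; b \<in> carrier B\<rbrakk> \<Longrightarrow> pure_tensor A B a b \<in> carrier (tensor_algebra A B)"
  unfolding pure_tensor_eq tensor_algebra_eq by (rule AB.q_closed) (simp add: carrier_AB)

lemma pure_tensor_mult:
  "\<lbrakk>a \<in> carrier A; b \<in> carrier B; a' \<in> carrier A; b' \<in> carrier B\<rbrakk> \<Longrightarrow>
    pure_tensor A B a b \<otimes>\<^bsub>tensor_algebra A B\<^esub> pure_tensor A B a' b' =
    pure_tensor A B (a \<otimes>\<^bsub>A\<^esub> a') (b \<otimes>\<^bsub>B\<^esub> b')"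
  unfolding pure_tensor_eq tensor_algebra_eq by (simp add: AB.mult_Q carrier_AB)

lemma algebra_hom_pure_left: "algebra_hom A (tensor_algebra A B) (\<lambda>a. pure_tensor A B a \<one>\<^bsub>B\<^esub>)"
proof (rule algebra_homI)
  show "pure_tensor A B (x \<otimes>\<^bsub>A\<^esub> y) \<one>\<^bsub>B\<^esub> =
      pure_tensor A B x \<one>\<^bsub>B\<^esub> \<otimes>\<^bsub>tensor_algebra A B\<^esub> pure_tensor A B y \<one>\<^bsub>B\<^esub>"
    if "x \<in> carrier A" "y \<in> carrier A" for x y
    using that by (simp add: pure_tensor_mult)
qed (auto simp: pure_tensor_eq tensor_algebra_eq carrier_AB one_AB AB.add_Q AB.smult_Q AB.one_Q
    AB.q_eq_iff tensor_relations_base diff_diff_eq [symmetric] intro!: AB.q_closed)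

lemma algebra_hom_pure_right: "algebra_hom B (tensor_algebra A B) (\<lambda>b. pure_tensor A B \<one>\<^bsub>A\<^esub> b)"
proof (rule algebra_homI)
  show "pure_tensor A B \<one>\<^bsub>A\<^esub> (x \<otimes>\<^bsub>B\<^esub> y) =
      pure_tensor A B \<one>\<^bsub>A\<^esub> x \<otimes>\<^bsub>tensor_algebra A B\<^esub> pure_tensor A B \<one>\<^bsub>A\<^esub> y"
    if "x \<in> carrier B" "y \<in> carrier B" for x y
    using that by (simp add: pure_tensor_mult)
qed (auto simp: pure_tensor_eq tensor_algebra_eq carrier_AB one_AB AB.add_Q AB.smult_Q AB.one_Q
    AB.q_eq_iff tensor_relations_base diff_diff_eq [symmetric] intro!: AB.q_closed)

text \<open>A pure tensor factors as a \<otimes> b = (a \<otimes> 1)(1 \<otimes> b), and each factor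
  lies in the image of one of the two algebras, which is generated by the image of its
  generators.\<close>

lemma generated_tensor_algebra:
  assumes S: "S \<subseteq> carrier A" "generated_subalgebra A S = carrier A"
    and T: "T \<subseteq> carrier B" "generated_subalgebra B T = carrier B"
  shows "generated_subalgebra (tensor_algebra A B)
      ((\<lambda>s. pure_tensor A B s \<one>\<^bsub>B\<^esub>) ` S \<union> pure_tensor A B \<one>\<^bsub>A\<^esub> ` T) =
    carrier (tensor_algebra A B)" (is "generated_subalgebra ?T ?G = _")
proof
  have G: "?G \<subseteq> carrier ?T"
    using S T by (auto intro: pure_tensor_closed)
  interpret T: complex_algebra ?T
    by (rule complex_algebra_tensor)
  show "generated_subalgebra ?T ?G \<subseteq> carrier ?T"
    by (rule T.generated_subalgebra_subset [OF G])
  have left: "pure_tensor A B a \<one>\<^bsub>B\<^esub> \<in> generated_subalgebra ?T ?G" if "a \<in> carrier A" for a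
    using generated_subalgebra_hom [OF A.complex_algebra_axioms T.complex_algebra_axioms
        algebra_hom_pure_left S(1)] that
      generated_subalgebra_mono [of "(\<lambda>s. pure_tensor A B s \<one>\<^bsub>B\<^esub>) ` S" ?G ?T] S(2)
    by blast
  have right: "pure_tensor A B \<one>\<^bsub>A\<^esub> b \<in> generated_subalgebra ?T ?G" if "b \<in> carrier B" for b
    using generated_subalgebra_hom [OF B.complex_algebra_axioms T.complex_algebra_axioms
        algebra_hom_pure_right T(1)] that
      generated_subalgebra_mono [of "pure_tensor A B \<one>\<^bsub>A\<^esub> ` T" ?G ?T] T(2)
    by blast
  show "carrier ?T \<subseteq> generated_subalgebra ?T ?G"
  proof
    fix x assume x: "x \<in> carrier ?T"
    show "x \<in> generated_subalgebra ?T ?G"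
      using x unfolding tensor_algebra_eq
    proof (induction rule: AB.Q_induct)
      case (add x y)
      then show ?case
        by (simp add: generated_subalgebra_closed)
    next
      case (smult c x)
      then show ?case
        using T.generated_subalgebra_asmult [OF G] by (simp add: tensor_algebra_eq)
    next
      case (basis z)
      then obtain a b where z: "z = (a, b)" and ab: "a \<in> carrier A" "b \<in> carrier B"
        by (auto simp: carrier_AB)
      have "AB.q (basis_vec z) =
          pure_tensor A B a \<one>\<^bsub>B\<^esub> \<otimes>\<^bsub>?T\<^esub> pure_tensor A B \<one>\<^bsub>A\<^esub> b"
        using ab by (simp add: pure_tensor_mult) (simp add: pure_tensor_eq z)
      also have "\<dots> \<in> generated_subalgebra ?T ?G"
        using ab by (intro generated_subalgebra_closed left right)
      finally show ?case
        by (simp add: tensor_algebra_eq)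
    qed
  qed
qed

text \<open>The universal property of the tensor product of algebras: homomorphisms with commuting
  images combine to a \<otimes> b \<mapsto> h(a)k(b).\<close>

lemma tensor_algebra_hom_exists:
  assumes G: "monoid_quotient G I" and Q: "Q = quotient_algebra (monoid_algebra G) I"
    and h: "algebra_hom A Q h" and k: "algebra_hom B Q k"
    and comm: "\<And>a b. \<lbrakk>a \<in> carrier A; b \<in> carrier B\<rbrakk> \<Longrightarrow> h a \<otimes>\<^bsub>Q\<^esub> k b = k b \<otimes>\<^bsub>Q\<^esub> h a"
  obtains \<iota> where "algebra_hom (tensor_algebra A B) Q \<iota>"
    and "\<And>a b. \<lbrakk>a \<in> carrier A; b \<in> carrier B\<rbrakk> \<Longrightarrow> \<iota> (pure_tensor A B a b) = h a \<otimes>\<^bsub>Q\<^esub> k b"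
proof -
  interpret G: monoid_quotient G I by fact
  interpret Q: complex_algebra Q
    unfolding Q by (rule G.complex_algebra_Q)
  \<comment> \<open>A map out of the tensor algebra is specified with values in the free space above
    \<open>Q\<close>, so a representative of each product h(a)k(b) is chosen.\<close>
  have "\<exists>f. a \<in> carrier A \<longrightarrow> b \<in> carrier B \<longrightarrow>
      keys f \<subseteq> carrier G \<and> G.q f = h a \<otimes>\<^bsub>Q\<^esub> k b" for a b
  proof (cases "a \<in> carrier A \<and> b \<in> carrier B")
    case True
    then have "h a \<otimes>\<^bsub>Q\<^esub> k b \<in> carrier Q"
      using algebra_homD(1) [OF h] algebra_homD(1) [OF k] by simp
    then show ?thesis
      unfolding Q by (elim G.Q_cases) auto
  qed auto
  then obtain \<phi> where \<phi>: "\<And>a b. \<lbrakk>a \<in> carrier A; b \<in> carrier B\<rbrakk> \<Longrightarrow>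
      keys (\<phi> a b) \<subseteq> carrier G \<and> G.q (\<phi> a b) = h a \<otimes>\<^bsub>Q\<^esub> k b"
    by metis
  note hom = algebra_homD [OF h] algebra_homD [OF k]
  \<comment> \<open>The interchange of the two inner factors, which makes the map multiplicative, is
    where commutation of the images enters.\<close>
  have swap: "h a \<otimes>\<^bsub>Q\<^esub> h a' \<otimes>\<^bsub>Q\<^esub> (k b \<otimes>\<^bsub>Q\<^esub> k b') = h a \<otimes>\<^bsub>Q\<^esub> k b \<otimes>\<^bsub>Q\<^esub> (h a' \<otimes>\<^bsub>Q\<^esub> k b')"
    if "a \<in> carrier A" "a' \<in> carrier A" "b \<in> carrier B" "b' \<in> carrier B" for a a' b b'
  proof -
    have car: "h a \<in> carrier Q" "h a' \<in> carrier Q" "k b \<in> carrier Q" "k b' \<in> carrier Q"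
      using that by (auto intro: algebra_homD(1) [OF h] algebra_homD(1) [OF k])
    have "h a' \<otimes>\<^bsub>Q\<^esub> (k b \<otimes>\<^bsub>Q\<^esub> k b') = k b \<otimes>\<^bsub>Q\<^esub> (h a' \<otimes>\<^bsub>Q\<^esub> k b')"
      using comm [of a' b] that car by (simp flip: Q.m_assoc)
    then show ?thesis
      using car by (simp add: Q.m_assoc)
  qed
  have lin: "G.q (f + g) = G.q f \<oplus>\<^bsub>Q\<^esub> G.q g" "G.q (pm_smult c f) = c \<odot>\<^bsub>Q\<^esub> G.q f" for c f g
    by (simp_all add: Q G.add_Q G.smult_Q)
  have m: "G.q (bilinear_ext (mult G) f g) = G.q f \<otimes>\<^bsub>Q\<^esub> G.q g"
    if "keys f \<subseteq> carrier G" "keys g \<subseteq> carrier G" for f g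
    using that by (simp add: Q G.mult_Q)
  show thesis
  proof (rule quotient_algebra_hom_exists [OF AB.monoid_quotient_axioms G, of "case_prod \<phi>"])
    show "linear_ext (case_prod \<phi>) f \<in> I" if "f \<in> tensor_relations A B" for f
      using that
      by (rule linear_ext_tensor_relations [OF _ G.subspace])
        (simp_all add: diff_diff_eq \<phi> lin hom Q.l_distr Q.r_distr Q.asmult_mult_l Q.asmult_mult_r
          A.asmult_closed B.asmult_closed flip: G.q_eq_iff)
    show "case_prod \<phi> (x \<otimes>\<^bsub>A \<times>\<times> B\<^esub> y) - bilinear_ext (mult G) (case_prod \<phi> x) (case_prod \<phi> y) \<in> I"
      if "x \<in> carrier (A \<times>\<times> B)" "y \<in> carrier (A \<times>\<times> B)" for x y
      using that by (auto simp: carrier_AB \<phi> m hom swap simp flip: G.q_eq_iff)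
    show "case_prod \<phi> \<one>\<^bsub>A \<times>\<times> B\<^esub> - basis_vec \<one>\<^bsub>G\<^esub> \<in> I"
      by (simp add: one_AB \<phi> hom flip: G.q_eq_iff) (simp add: Q G.one_Q)
    show "keys (case_prod \<phi> x) \<subseteq> carrier G" if "x \<in> carrier (A \<times>\<times> B)" for x
      using that \<phi> by (auto simp: carrier_AB)
    fix \<iota>
    assume \<iota>: "algebra_hom AB.Q (quotient_algebra (monoid_algebra G) I) \<iota>"
      "\<And>f. keys f \<subseteq> carrier (A \<times>\<times> B) \<Longrightarrow>
        \<iota> (AB.q f) = G.q (linear_ext (case_prod \<phi>) f)"
    show thesis
    proof (rule that)
      show "algebra_hom (tensor_algebra A B) Q \<iota>"
        using \<iota>(1) by (simp add: Q tensor_algebra_eq)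
      show "\<iota> (pure_tensor A B a b) = h a \<otimes>\<^bsub>Q\<^esub> k b" if "a \<in> carrier A" "b \<in> carrier B" for a b
        using \<iota>(2) [of "basis_vec (a, b)"] \<phi> that by (simp add: pure_tensor_eq carrier_AB)
    qed
  qed
qed

end

locale tensor_modules = algebra_pair A B + M: left_module A M + N: left_module B N
  for A :: "(complex, 'a) module" and B :: "(complex, 'b) module"
    and M :: "('a, 'u) module" and N :: "('b, 'v) module"
begin

abbreviation "D \<equiv> tensor_relations (complex_space A M) (complex_space B N)"
abbreviation "act \<equiv> bilinear_ext (\<lambda>(a, b) (u, v). (a \<odot>\<^bsub>M\<^esub> u, b \<odot>\<^bsub>N\<^esub> v))"

lemma subspace_D: "pm.subspace D"
  by (rule subspace_tensor_relations)

lemma D_subset: "D \<subseteq> free_on (carrier M \<times> carrier N)"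
  using tensor_relations_subset [of "complex_space A M" "complex_space B N"]
  by (simp add: M.lsmult_closed N.lsmult_closed A.asmult_closed B.asmult_closed)

lemmas act_D = bilinear_ext_tensor_relations
  [OF A.bilinear_map_smult [OF M.left_module_axioms] B.bilinear_map_smult [OF N.left_module_axioms],
   simplified]

lemma keys_act:
  "\<lbrakk>keys f \<subseteq> carrier A \<times> carrier B; keys g \<subseteq> carrier M \<times> carrier N\<rbrakk> \<Longrightarrow>
    keys (act f g) \<subseteq> carrier M \<times> carrier N"
  by (rule keys_bilinear_ext) (auto intro: M.lsmult_closed N.lsmult_closed)

lemma tensor_module_simps:
  "carrier (tensor_module A B M N) = lin_coset D ` free_on (carrier M \<times> carrier N)"
  "\<zero>\<^bsub>tensor_module A B M N\<^esub> = lin_coset D 0"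
  "lin_coset D f \<oplus>\<^bsub>tensor_module A B M N\<^esub> lin_coset D g = lin_coset D (f + g)"
  by (simp_all add: tensor_module_def Let_def a_rcosets_eq set_add_lin_coset subspace_D)

text \<open>Changing the representative of the algebra element or of the module element changes the
  result by an element of \<open>D\<close>, since \<open>act\<close> sends relations in either
  argument to relations.\<close>

lemma smult_tensor_module:
  assumes f: "keys f \<subseteq> carrier A \<times> carrier B"
    and g: "keys g \<subseteq> carrier M \<times> carrier N"
  shows "AB.q f \<odot>\<^bsub>tensor_module A B M N\<^esub> lin_coset D g = lin_coset D (act f g)"
proof -
  have "act f' g' - act f g \<in> D" if "f' \<in> AB.q f" "g' \<in> lin_coset D g" for f' g'
  proof -
    have "g' - g \<in> free_on (carrier M \<times> carrier N)"
      using that(2) D_subset by (auto simp only: mem_lin_coset_iff)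
    then have "keys g' \<subseteq> carrier M \<times> carrier N"
      using free_on_add [of "g' - g" _ g] g by simp
    then have "act (f' - f) g' + act f (g' - g) \<in> D"
      using that f by (intro pm.subspace_add [OF subspace_D] act_D) (auto simp: mem_lin_coset_iff)
    then show ?thesis
      by (simp add: bilinear_ext_linear)
  qed
  then have "(\<Union>x\<in>AB.q f. \<Union>y\<in>lin_coset D g. lin_coset D (act x y)) = lin_coset D (act f g)"
    using AB.q_self pm.subspace_0 [OF subspace_D]
    by (intro Union2_lin_coset_const [OF subspace_D])
      (auto simp: mem_lin_coset_iff ex_in_conv [symmetric] intro: exI [of _ f] exI [of _ g])
  then show ?thesis
    by (simp add: tensor_module_def Let_def a_r_coset_eq_lin_coset)
qed

lemma act_mult:
  assumes f: "keys f \<subseteq> carrier A \<times> carrier B"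
    and f': "keys f' \<subseteq> carrier A \<times> carrier B"
    and g: "keys g \<subseteq> carrier M \<times> carrier N"
  shows "act (bilinear_ext (mult (A \<times>\<times> B)) f f') g = act f (act f' g)"
  using f
proof (induction f rule: free_on_induct)
  case (basis x)
  show ?case
    using f'
  proof (induction f' rule: free_on_induct)
    case (basis y)
    show ?case
      using g
    proof (induction g rule: free_on_induct)
      case (basis z)
      then show ?case
        using \<open>x \<in> _\<close> \<open>y \<in> _\<close> by (auto simp: M.lsmult_assoc N.lsmult_assoc DirProd_def)
    qed (simp_all add: bilinear_ext_linear)
  qed (simp_all add: bilinear_ext_linear)
qed (simp_all add: bilinear_ext_linear)

lemma act_one:
  "keys g \<subseteq> carrier M \<times> carrier N \<Longrightarrow> act (basis_vec (\<one>\<^bsub>A\<^esub>, \<one>\<^bsub>B\<^esub>)) g = g"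
  by (induction g rule: free_on_induct)
    (auto simp: bilinear_ext_linear DirProd_def M.lsmult_one N.lsmult_one)

lemma left_module_tensor_module: "left_module (tensor_algebra A B) (tensor_module A B M N)"
proof (intro left_module.intro abelian_groupI left_module_axioms.intro)
  show "ring (tensor_algebra A B)"
    unfolding tensor_algebra_eq using AB.complex_algebra_Q by (rule complex_algebra.axioms)
next
  fix x assume "x \<in> carrier (tensor_module A B M N)"
  then obtain f where "keys f \<subseteq> carrier M \<times> carrier N" "x = lin_coset D f"
    by (auto simp: tensor_module_simps)
  then show "\<exists>y\<in>carrier (tensor_module A B M N).
      y \<oplus>\<^bsub>tensor_module A B M N\<^esub> x = \<zero>\<^bsub>tensor_module A B M N\<^esub>"
    by (intro bexI [of _ "lin_coset D (- f)"]) (auto simp: tensor_module_simps simp del: lin_coset_zero)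
qed (auto simp: tensor_algebra_eq tensor_module_simps AB.carrier_Q carrier_AB smult_tensor_module
    AB.add_Q AB.one_Q AB.mult_Q bilinear_ext_linear keys_act act_mult act_one free_on_add
    ac_simps AB.keys_mult [unfolded carrier_AB] one_AB simp del: lin_coset_zero)

end

section \<open>The 0-Hecke algebra\<close>

abbreviation word_monoid :: "nat \<Rightarrow> nat list monoid"
  where "word_monoid N \<equiv> \<lparr>carrier = lists {1..<N}, mult = (@), one = []\<rparr>"

abbreviation "hecke_coset N \<equiv> lin_coset (hecke_ideal N)"

text \<open>The distance condition over the integers becomes a disjunction over the natural numbers,
  so that later case distinctions are linear arithmetic.\<close>

lemma hecke_relations_cases:
  assumes "r \<in> hecke_relations N"
  obtains (idem) i where "r = basis_vec [i, i] - basis_vec [i]" "1 \<le> i" "i < N"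
  | (braid) i where "r = basis_vec [i, i + 1, i] - basis_vec [i + 1, i, i + 1]" "1 \<le> i" "i + 1 < N"
  | (comm) i j where "r = basis_vec [i, j] - basis_vec [j, i]" "1 \<le> i" "i < N" "1 \<le> j" "j < N"
      "i + 2 \<le> j \<or> j + 2 \<le> i"
proof -
  consider i where "r = basis_vec [i, i] - basis_vec [i]" "i \<in> {1..<N}"
    | i where "r = basis_vec [i, i + 1, i] - basis_vec [i + 1, i, i + 1]" "i \<in> {1..<N}" "i + 1 \<in> {1..<N}"
    | i j where "r = basis_vec [i, j] - basis_vec [j, i]" "i \<in> {1..<N}" "j \<in> {1..<N}"
        "\<bar>int i - int j\<bar> \<ge> 2"
    using assms unfolding hecke_relations_def by blast
  then show thesis
  proof cases
    case 1
    then show ?thesis by (intro idem) auto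
  next
    case 2
    then show ?thesis by (intro braid) auto
  next
    case 3
    then show ?thesis by (intro comm) auto
  qed
qed

lemma monoid_word_monoid: "Group.monoid (word_monoid N)"
  by (rule Group.monoidI) auto

lemma ring_free_algebra: "ring (free_algebra N)"
  unfolding free_algebra_def by (rule monoid.ring_monoid_algebra [OF monoid_word_monoid])

lemma free_algebra_simps [simp]:
  "carrier (free_algebra N) = free_on (lists {1..<N})" "\<zero>\<^bsub>free_algebra N\<^esub> = 0"
  "add (free_algebra N) = (+)" "mult (free_algebra N) = bilinear_ext (@)"
  by (simp_all add: free_algebra_def)

lemma hecke_relations_subset: "hecke_relations N \<subseteq> carrier (free_algebra N)"
proof
  fix r assume "r \<in> hecke_relations N"
  then show "r \<in> carrier (free_algebra N)"
    unfolding free_algebra_simps mem_Collect_eq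
    by (cases rule: hecke_relations_cases) (simp_all, (rule free_on_diff; simp)+)
qed

lemma ideal_hecke_ideal: "ideal (hecke_ideal N) (free_algebra N)"
  unfolding hecke_ideal_def by (rule ring.genideal_ideal [OF ring_free_algebra hecke_relations_subset])

lemma hecke_relations_in_ideal: "hecke_relations N \<subseteq> hecke_ideal N"
  unfolding hecke_ideal_def by (rule ring.genideal_self [OF ring_free_algebra hecke_relations_subset])

lemma hecke_ideal_subset: "f \<in> hecke_ideal N \<Longrightarrow> keys f \<subseteq> lists {1..<N}"
  using additive_subgroup.a_subset [OF ideal.axioms(1) [OF ideal_hecke_ideal [of N]]] by auto

lemma hecke_ideal_mult:
  assumes "keys f \<subseteq> lists {1..<N}" and "g \<in> hecke_ideal N"
  shows "bilinear_ext (@) f g \<in> hecke_ideal N" "bilinear_ext (@) g f \<in> hecke_ideal N"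
  using ideal.I_l_closed [OF ideal_hecke_ideal assms(2), of f]
    ideal.I_r_closed [OF ideal_hecke_ideal assms(2), of f] assms(1)
  by (simp_all only: free_algebra_simps mem_Collect_eq)

text \<open>\<open>Idl\<close> provides closure under ring operations only. Closure under complex
  scalars follows because scaling by \<open>c\<close> is multiplication by \<open>c\<close> times
  the empty word.\<close>

lemma hecke_monoid_quotient: "monoid_quotient (word_monoid N) (hecke_ideal N)"
proof (intro monoid_quotient.intro monoid_word_monoid monoid_quotient_axioms.intro)
  note sub = ideal.axioms(1) [OF ideal_hecke_ideal [of N]]
  have one: "bilinear_ext (@) (basis_vec []) f = f" if "f \<in> hecke_ideal N" for f
    using monoid.bilinear_ext_one(1) [OF monoid_word_monoid, of f N] hecke_ideal_subset [OF that]
    by (simp only: partial_object.simps monoid.simps)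
  have "pm_smult c f \<in> hecke_ideal N" if "f \<in> hecke_ideal N" for c f
  proof -
    have "keys (pm_smult c (basis_vec [])) \<subseteq> lists {1..<N}"
      by (rule free_on_smult) simp
    then show ?thesis
      using hecke_ideal_mult(1) [OF _ that] one [OF that] by (metis bilinear_ext_linear(3))
  qed
  then show "pm.subspace (hecke_ideal N)"
    using additive_subgroup.zero_closed [OF sub] additive_subgroup.a_closed [OF sub]
    unfolding pm.subspace_def free_algebra_simps by blast
  show "hecke_ideal N \<subseteq> free_on (carrier (word_monoid N))"
    using hecke_ideal_subset by (simp add: subset_iff)
qed (simp_all add: hecke_ideal_mult)

global_interpretation hecke: monoid_quotient "word_monoid N" "hecke_ideal N" for N
  by (rule hecke_monoid_quotient)

lemma hecke_eq: "hecke N = quotient_algebra (monoid_algebra (word_monoid N)) (hecke_ideal N)"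
  by (simp add: hecke_def free_algebra_def)

lemma complex_algebra_hecke: "complex_algebra (hecke N)"
  unfolding hecke_eq by (rule hecke.complex_algebra_Q)

lemmas hecke_coset_simps = hecke.add_Q [folded hecke_eq] hecke.smult_Q [folded hecke_eq]
  hecke.mult_Q [folded hecke_eq, simplified] hecke.one_Q [folded hecke_eq, simplified]

lemmas hecke_induct [consumes 1, case_names add smult basis] =
  hecke.Q_induct [folded hecke_eq, unfolded partial_object.simps]

lemma hecke_gen_eq: "hecke_gen N i = hecke_coset N (basis_vec [i])"
  by (simp add: hecke_gen_def a_r_coset_eq_lin_coset)

lemma hecke_coset_closed: "keys f \<subseteq> lists {1..<N} \<Longrightarrow> hecke_coset N f \<in> carrier (hecke N)"
  unfolding hecke_eq by (rule hecke.q_closed) simp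

lemma hecke_gen_closed: "i \<in> {1..<N} \<Longrightarrow> hecke_gen N i \<in> carrier (hecke N)"
  unfolding hecke_gen_eq by (rule hecke_coset_closed) auto

text \<open>A word is the product of its letters, the empty word is the unit, and every element is a
  combination of words.\<close>

lemma generated_hecke: "generated_subalgebra (hecke N) (hecke_gen N ` {1..<N}) = carrier (hecke N)"
proof
  let ?G = "generated_subalgebra (hecke N) (hecke_gen N ` {1..<N})"
  have sub: "hecke_gen N ` {1..<N} \<subseteq> carrier (hecke N)"
    using hecke_gen_closed by auto
  then show "?G \<subseteq> carrier (hecke N)"
    by (rule complex_algebra.generated_subalgebra_subset [OF complex_algebra_hecke])
  have word: "hecke_coset N (basis_vec w) \<in> ?G" if "w \<in> lists {1..<N}" for w
    using that
  proof (induction w rule: list.induct)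
    case Nil
    show ?case
      using generated_subalgebra_closed(2) [of "hecke N"] by (simp only: hecke_coset_simps)
  next
    case (Cons i w)
    then have "hecke_gen N i \<otimes>\<^bsub>hecke N\<^esub> hecke_coset N (basis_vec w) \<in> ?G"
      by (intro generated_subalgebra_closed(4) [OF generated_subalgebra_closed(1)]) auto
    moreover have "hecke_gen N i \<otimes>\<^bsub>hecke N\<^esub> hecke_coset N (basis_vec w) = hecke_coset N (basis_vec (i # w))"
      unfolding hecke_gen_eq by (subst hecke_coset_simps(3)) (use Cons.prems in auto)
    ultimately show ?case
      by (simp only:)
  qed
  show "carrier (hecke N) \<subseteq> ?G"
  proof
    fix x assume "x \<in> carrier (hecke N)"
    then show "x \<in> ?G"
    proof (induction rule: hecke_induct)
      case (add x y)
      then show ?case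
        by (intro generated_subalgebra_closed(3))
    next
      case (smult c x)
      then show ?case
        by (intro complex_algebra.generated_subalgebra_asmult [OF complex_algebra_hecke sub])
    next
      case (basis w)
      then show ?case
        by (rule word)
    qed
  qed
qed

section \<open>Homomorphisms between 0-Hecke algebras\<close>

text \<open>The elements of the free algebra with property \<open>P\<close> form an ideal that
  contains the relations, and the Hecke ideal is the smallest such ideal.\<close>

lemma hecke_ideal_induct [consumes 1, case_names subspace left right relation]:
  assumes f: "f \<in> hecke_ideal N" and P: "pm.subspace {f. P f}"
    and left: "\<And>f g. \<lbrakk>keys f \<subseteq> lists {1..<N}; keys g \<subseteq> lists {1..<N}; P g\<rbrakk>
      \<Longrightarrow> P (bilinear_ext (@) f g)"
    and right: "\<And>f g. \<lbrakk>keys f \<subseteq> lists {1..<N}; keys g \<subseteq> lists {1..<N}; P f\<rbrakk>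
      \<Longrightarrow> P (bilinear_ext (@) f g)"
    and relation: "\<And>r. r \<in> hecke_relations N \<Longrightarrow> P r"
  shows "P f"
proof -
  interpret F: ring "free_algebra N"
    by (rule ring_free_algebra)
  let ?J = "{f. keys f \<subseteq> lists {1..<N} \<and> P f}"
  have neg: "\<ominus>\<^bsub>free_algebra N\<^esub> g = - g" if "keys g \<subseteq> lists {1..<N}" for g
    by (rule F.minus_equality) (use that in simp_all)
  have "ideal ?J (free_algebra N)"
  proof (rule idealI [OF ring_free_algebra])
    show "subgroup ?J (add_monoid (free_algebra N))"
    proof (intro subgroup.intro)
      fix g assume "g \<in> ?J"
      then show "inv\<^bsub>add_monoid (free_algebra N)\<^esub> g \<in> ?J"
        unfolding a_inv_def [symmetric] using neg pm.subspace_neg [OF P] by simp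
    qed (use pm.subspace_0 [OF P] pm.subspace_add [OF P] in \<open>simp_all add: Collect_mono_iff free_on_add\<close>)
  qed (use left right hecke.keys_mult [of _ N, simplified] in auto)
  then have "hecke_ideal N \<subseteq> ?J"
    unfolding hecke_ideal_def using hecke_relations_subset relation
    by (intro F.genideal_minimal) auto
  then show ?thesis
    using f by auto
qed

text \<open>The universal property of a presentation: a map that is multiplicative on words needs
  checking on the defining relations only. Values of \<open>\<phi>\<close> need not be single basis
  vectors; in particular a word may be sent to \<open>0\<close>.\<close>

lemma linear_ext_hecke_ideal:
  assumes "monoid_quotient G I"
    and keys: "\<And>w. w \<in> lists {1..<N} \<Longrightarrow> keys (\<phi> w) \<subseteq> carrier G"
    and mult: "\<And>u v. \<lbrakk>u \<in> lists {1..<N}; v \<in> lists {1..<N}\<rbrakk> \<Longrightarrow>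
      \<phi> (u @ v) = bilinear_ext (mult G) (\<phi> u) (\<phi> v)"
    and relation: "\<And>r. r \<in> hecke_relations N \<Longrightarrow> linear_ext \<phi> r \<in> I"
    and f: "f \<in> hecke_ideal N"
  shows "linear_ext \<phi> f \<in> I"
proof -
  interpret G: monoid_quotient G I by fact
  have keys': "keys (linear_ext \<phi> f) \<subseteq> carrier G"
    if "keys f \<subseteq> lists {1..<N}" for f
    using that by (intro keys_linear_ext keys) auto
  have mult': "linear_ext \<phi> (bilinear_ext (@) f g) =
      bilinear_ext (mult G) (linear_ext \<phi> f) (linear_ext \<phi> g)"
    if f: "keys f \<subseteq> lists {1..<N}" and g: "keys g \<subseteq> lists {1..<N}" for f g
    using f
  proof (induction f rule: free_on_induct)
    case (basis x)
    show ?case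
      using g by (induction g rule: free_on_induct)
        (use mult \<open>x \<in> _\<close> in \<open>auto simp: bilinear_ext_linear linear_ext_linear\<close>)
  qed (simp_all add: bilinear_ext_linear linear_ext_linear)
  have "pm.subspace {f. linear_ext \<phi> f \<in> I}"
    using G.subspace by (auto simp: pm.subspace_def linear_ext_linear)
  then show ?thesis
    by (rule hecke_ideal_induct [OF f])
      (simp_all add: mult' keys' G.l_closed G.r_closed relation)
qed

lemma hecke_relation_eq:
  "r - s \<in> hecke_relations N \<Longrightarrow> hecke_coset N r = hecke_coset N s"
  using hecke_relations_in_ideal by (auto simp: hecke.q_eq_iff)

lemma hecke_coset_relations:
  "\<lbrakk>1 \<le> i; i < N\<rbrakk> \<Longrightarrow> hecke_coset N (basis_vec [i, i]) = hecke_coset N (basis_vec [i])"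
  "\<lbrakk>1 \<le> i; i + 1 < N\<rbrakk> \<Longrightarrow>
    hecke_coset N (basis_vec [i, i + 1, i]) = hecke_coset N (basis_vec [i + 1, i, i + 1])"
  "\<lbrakk>1 \<le> i; i < N; 1 \<le> j; j < N; i + 2 \<le> j \<or> j + 2 \<le> i\<rbrakk> \<Longrightarrow>
    hecke_coset N (basis_vec [i, j]) = hecke_coset N (basis_vec [j, i])"
proof -
  show "hecke_coset N (basis_vec [i, i]) = hecke_coset N (basis_vec [i])" if "1 \<le> i" "i < N"
  proof (rule hecke_relation_eq)
    have "i \<in> {1..<N}"
      using that by simp
    then show "basis_vec [i, i] - basis_vec [i] \<in> hecke_relations N"
      unfolding hecke_relations_def by blast
  qed
  show "hecke_coset N (basis_vec [i, i + 1, i]) = hecke_coset N (basis_vec [i + 1, i, i + 1])"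
    if "1 \<le> i" "i + 1 < N"
  proof (rule hecke_relation_eq)
    have "i \<in> {1..<N}" "i + 1 \<in> {1..<N}"
      using that by simp_all
    then show "basis_vec [i, i + 1, i] - basis_vec [i + 1, i, i + 1] \<in> hecke_relations N"
      unfolding hecke_relations_def by blast
  qed
  show "hecke_coset N (basis_vec [i, j]) = hecke_coset N (basis_vec [j, i])"
    if "1 \<le> i" "i < N" "1 \<le> j" "j < N" "i + 2 \<le> j \<or> j + 2 \<le> i"
  proof (rule hecke_relation_eq)
    have "i \<in> {1..<N}" "j \<in> {1..<N}" "\<bar>int i - int j\<bar> \<ge> 2"
      using that by auto
    then show "basis_vec [i, j] - basis_vec [j, i] \<in> hecke_relations N"
      unfolding hecke_relations_def by blast
  qed
qed

abbreviation shift_word :: "nat \<Rightarrow> nat list \<Rightarrow> nat list"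
  where "shift_word d \<equiv> map (\<lambda>i. i + d)"

lemma shift_word_lists:
  assumes "w \<in> lists {1..<k}" and "k + d \<le> N"
  shows "shift_word d w \<in> lists {1..<N}"
proof -
  have "i + d \<in> {1..<N}" if "i \<in> set w" for i
    using assms that by (auto simp: in_lists_conv_set dest!: bspec)
  then show ?thesis
    by (simp only: in_lists_conv_set set_map) blast
qed

text \<open>The relations are invariant under translation of the indices. The shift \<open>0\<close>
  yields the map from H_(n-1)(0) and that from the first tensor factor, the shift \<open>m\<close>
  that from the second factor. The largest shifted letter is \<open>k - 1 + d\<close>, hence the
  bound.\<close>

lemma hecke_shift_exists:
  assumes "k + d \<le> N"
  obtains h where "algebra_hom (hecke k) (hecke N) h"
    and "\<And>w. w \<in> lists {1..<k} \<Longrightarrow>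
      h (hecke_coset k (basis_vec w)) = hecke_coset N (basis_vec (shift_word d w))"
proof (rule quotient_algebra_hom_exists [OF hecke_monoid_quotient hecke_monoid_quotient])
  let ?\<phi> = "\<lambda>w. basis_vec (shift_word d w)"
  show "linear_ext ?\<phi> f \<in> hecke_ideal N" if "f \<in> hecke_ideal k" for f
  proof (rule linear_ext_hecke_ideal [OF hecke_monoid_quotient _ _ _ that])
    fix r assume "r \<in> hecke_relations k"
    then have "hecke_coset N (linear_ext ?\<phi> r) = hecke_coset N 0"
    proof (cases rule: hecke_relations_cases)
      case (idem i)
      then show ?thesis
        using hecke_coset_relations(1) [of "i + d" N] assms
        by (simp add: linear_ext_linear hecke.q_eq_iff del: lin_coset_zero)
    next
      case (braid i)
      then show ?thesis
        using hecke_coset_relations(2) [of "i + d" N] assms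
        by (simp add: linear_ext_linear hecke.q_eq_iff del: lin_coset_zero)
    next
      case (comm i j)
      then have "i + d + 2 \<le> j + d \<or> j + d + 2 \<le> i + d"
        by linarith
      then show ?thesis
        using hecke_coset_relations(3) [of "i + d" N "j + d"] assms comm
        by (simp add: linear_ext_linear hecke.q_eq_iff del: lin_coset_zero)
    qed
    then show "linear_ext ?\<phi> r \<in> hecke_ideal N"
      by (simp add: hecke.q_eq_iff del: lin_coset_zero)
  qed (use shift_word_lists [OF _ assms] in simp_all)
  fix h
  assume "algebra_hom (quotient_algebra (monoid_algebra (word_monoid k)) (hecke_ideal k))
      (quotient_algebra (monoid_algebra (word_monoid N)) (hecke_ideal N)) h"
    and "\<And>f. keys f \<subseteq> carrier (word_monoid k) \<Longrightarrow>
      h (hecke_coset k f) = hecke_coset N (linear_ext ?\<phi> f)"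
  then show thesis
    by (intro that [of h]) (simp_all add: hecke_eq)
qed (use shift_word_lists [OF _ assms] pm.subspace_0 [OF hecke.subspace] in simp_all)

lemma (in monoid) commute_mult:
  assumes "x \<in> carrier G" "y \<in> carrier G" "z \<in> carrier G" "x \<otimes> y = y \<otimes> x" "x \<otimes> z = z \<otimes> x"
  shows "x \<otimes> (y \<otimes> z) = (y \<otimes> z) \<otimes> x"
  using assms by (metis m_assoc)

text \<open>One induction moves a single letter of \<open>u\<close> past the word \<open>v\<close>,
  a second one moves all of \<open>u\<close>.\<close>

lemma hecke_words_commute:
  assumes u: "u \<in> lists {1..<N}" and v: "v \<in> lists {1..<N}"
    and far: "\<And>i j. \<lbrakk>i \<in> set u; j \<in> set v\<rbrakk> \<Longrightarrow> i + 2 \<le> j"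
  shows "hecke_coset N (basis_vec u) \<otimes>\<^bsub>hecke N\<^esub> hecke_coset N (basis_vec v) =
    hecke_coset N (basis_vec v) \<otimes>\<^bsub>hecke N\<^esub> hecke_coset N (basis_vec u)"
proof -
  interpret H: Group.monoid "hecke N"
    by (intro ring.is_monoid complex_algebra.axioms(1) complex_algebra_hecke)
  let ?c = "\<lambda>w. hecke_coset N (basis_vec w)"
  have app: "?c (i # w) = ?c [i] \<otimes>\<^bsub>hecke N\<^esub> ?c w" if "i # w \<in> lists {1..<N}" for i w
    by (subst hecke_coset_simps(3)) (use that in auto)
  have one: "?c [] = \<one>\<^bsub>hecke N\<^esub>"
    by (simp only: hecke_coset_simps)
  have car: "?c w \<in> carrier (hecke N)" if "w \<in> lists {1..<N}" for w
    by (rule hecke_coset_closed) (use that in auto)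
  have letter: "?c [i] \<otimes>\<^bsub>hecke N\<^esub> ?c v = ?c v \<otimes>\<^bsub>hecke N\<^esub> ?c [i]" if i: "i \<in> set u" for i
    using v far [OF i]
  proof (induction v rule: list.induct)
    case Nil
    have "?c [i] \<in> carrier (hecke N)"
      by (rule car) (use u i in auto)
    then show ?case
      by (simp only: one H.l_one H.r_one)
  next
    case (Cons j v)
    have ij: "i \<in> {1..<N}" "j \<in> {1..<N}" "v \<in> lists {1..<N}" "i + 2 \<le> j"
      using u i Cons.prems by auto
    have "?c [i, j] = ?c [j, i]"
      by (rule hecke_coset_relations(3)) (use ij in auto)
    then have "?c [i] \<otimes>\<^bsub>hecke N\<^esub> ?c [j] = ?c [j] \<otimes>\<^bsub>hecke N\<^esub> ?c [i]"
      using app [of i "[j]"] app [of j "[i]"] ij by simp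
    moreover have "?c [i] \<otimes>\<^bsub>hecke N\<^esub> ?c v = ?c v \<otimes>\<^bsub>hecke N\<^esub> ?c [i]"
      using Cons ij(3) by auto
    ultimately have "?c [i] \<otimes>\<^bsub>hecke N\<^esub> (?c [j] \<otimes>\<^bsub>hecke N\<^esub> ?c v) =
        (?c [j] \<otimes>\<^bsub>hecke N\<^esub> ?c v) \<otimes>\<^bsub>hecke N\<^esub> ?c [i]"
      by (intro H.commute_mult car) (use ij in auto)
    then show ?case
      using app [OF Cons.prems(1)] by (simp only:)
  qed
  have cv: "?c v \<in> carrier (hecke N)"
    by (rule car [OF v])
  show ?thesis
    using u letter
  proof (induction u rule: list.induct)
    case Nil
    show ?case
      by (simp only: one H.l_one [OF cv] H.r_one [OF cv])
  next
    case (Cons i u)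
    have "i \<in> {1..<N}" "u \<in> lists {1..<N}"
      using Cons.prems by auto
    moreover have "?c u \<otimes>\<^bsub>hecke N\<^esub> ?c v = ?c v \<otimes>\<^bsub>hecke N\<^esub> ?c u"
      by (rule Cons.IH) (use Cons.prems in auto)
    moreover have "?c [i] \<otimes>\<^bsub>hecke N\<^esub> ?c v = ?c v \<otimes>\<^bsub>hecke N\<^esub> ?c [i]"
      by (rule Cons.prems) simp
    ultimately have "?c v \<otimes>\<^bsub>hecke N\<^esub> (?c [i] \<otimes>\<^bsub>hecke N\<^esub> ?c u) =
        (?c [i] \<otimes>\<^bsub>hecke N\<^esub> ?c u) \<otimes>\<^bsub>hecke N\<^esub> ?c v"
      by (intro H.commute_mult cv car) auto
    then show ?case
      using app [OF Cons.prems(1)] by (simp only:)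
  qed
qed

text \<open>
  Sending \<open>\<pi>\<^sub>m\<close> to \<open>0\<close> and fixing the other generators respects the 0-Hecke relations, since every
  relation that involves \<open>\<pi>\<^sub>m\<close> involves it on both sides. This yields left inverses of the two
  identifications and hence their injectivity.
\<close>

lemma hecke_pred_identification_exists:
  assumes "n \<ge> 1"
  obtains \<iota> where "hecke_pred_identification n \<iota>"
proof -
  have le: "n - 1 + 0 \<le> n"
    by simp
  obtain \<iota> where \<iota>: "algebra_hom (hecke (n - 1)) (hecke n) \<iota>"
    and \<iota>_word: "\<And>w. w \<in> lists {1..<n - 1} \<Longrightarrow>
      \<iota> (hecke_coset (n - 1) (basis_vec w)) = hecke_coset n (basis_vec (shift_word 0 w))"
    using hecke_shift_exists [OF le] by blast
  have \<iota>_gen: "\<iota> (hecke_gen (n - 1) i) = hecke_gen n i" if "i \<in> {1..<n - 1}" for i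
    using \<iota>_word [of "[i]"] that by (simp add: hecke_gen_eq)
  \<comment> \<open>A concatenation contains the letter \<open>n - 1\<close> iff one of its factors
    does. Killing the words with this letter is therefore exactly multiplicative.\<close>
  let ?\<phi> = "\<lambda>w. if n - 1 \<in> set w then 0 else basis_vec w"
  obtain \<rho> where \<rho>: "algebra_hom (hecke n) (hecke (n - 1)) \<rho>"
    and \<rho>_coset: "\<And>f. keys f \<subseteq> lists {1..<n} \<Longrightarrow>
      \<rho> (hecke_coset n f) = hecke_coset (n - 1) (linear_ext ?\<phi> f)"
  proof (rule quotient_algebra_hom_exists
      [OF hecke_monoid_quotient [of n] hecke_monoid_quotient [of "n - 1"], of ?\<phi>])
    show keys: "keys (?\<phi> w) \<subseteq> carrier (word_monoid (n - 1))"
      if "w \<in> carrier (word_monoid n)" for w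
    proof (cases "n - 1 \<in> set w")
      case False
      have "i \<in> {1..<n - 1}" if "i \<in> set w" for i
        using \<open>w \<in> _\<close> False that by (cases "i = n - 1") (auto simp: in_lists_conv_set)
      then show ?thesis
        using False by (auto simp: in_lists_conv_set)
    qed simp
    have mult: "?\<phi> (u @ v) = bilinear_ext (@) (?\<phi> u) (?\<phi> v)" for u v
      by simp
    then show "?\<phi> (u \<otimes>\<^bsub>word_monoid n\<^esub> v) - bilinear_ext (mult (word_monoid (n - 1))) (?\<phi> u) (?\<phi> v)
        \<in> hecke_ideal (n - 1)" for u v
      using pm.subspace_0 [OF hecke.subspace] by simp
    show "?\<phi> \<one>\<^bsub>word_monoid n\<^esub> - basis_vec \<one>\<^bsub>word_monoid (n - 1)\<^esub> \<in> hecke_ideal (n - 1)"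
      using pm.subspace_0 [OF hecke.subspace] by simp
    show "linear_ext ?\<phi> f \<in> hecke_ideal (n - 1)" if "f \<in> hecke_ideal n" for f
    proof (rule linear_ext_hecke_ideal [OF hecke_monoid_quotient _ _ _ that])
      fix r assume "r \<in> hecke_relations n"
      then have "linear_ext ?\<phi> r = 0 \<or> hecke_coset (n - 1) (linear_ext ?\<phi> r) = hecke_coset (n - 1) 0"
      proof (cases rule: hecke_relations_cases)
        case (idem i)
        then consider "i = n - 1" | "i < n - 1" by linarith
        then show ?thesis
          using hecke_coset_relations(1) [of i "n - 1"] idem
          by cases (auto simp: linear_ext_linear hecke.q_eq_iff simp del: lin_coset_zero)
      next
        case (braid i)
        then consider "i + 1 = n - 1" | "i + 1 < n - 1" by linarith
        then show ?thesis
          using hecke_coset_relations(2) [of i "n - 1"] braid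
          by cases (auto simp: linear_ext_linear hecke.q_eq_iff simp del: lin_coset_zero)
      next
        case (comm i j)
        then consider "i = n - 1 \<or> j = n - 1" | "i < n - 1" "j < n - 1" by linarith
        then show ?thesis
          using hecke_coset_relations(3) [of i "n - 1" j] comm
          by cases (auto simp: linear_ext_linear hecke.q_eq_iff simp del: lin_coset_zero)
      qed
      then show "linear_ext ?\<phi> r \<in> hecke_ideal (n - 1)"
        using pm.subspace_0 [OF hecke.subspace] by (auto simp: hecke.q_eq_iff simp del: lin_coset_zero)
    qed (use keys mult in simp_all)
    fix \<rho>
    assume "algebra_hom (quotient_algebra (monoid_algebra (word_monoid n)) (hecke_ideal n))
        (quotient_algebra (monoid_algebra (word_monoid (n - 1))) (hecke_ideal (n - 1))) \<rho>"
      and "\<And>f. keys f \<subseteq> carrier (word_monoid n) \<Longrightarrow>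
        \<rho> (hecke_coset n f) = hecke_coset (n - 1) (linear_ext ?\<phi> f)"
    then show thesis
      by (intro that [of \<rho>]) (simp_all add: hecke_eq)
  qed
  have \<rho>_gen: "\<rho> (hecke_gen n i) = hecke_gen (n - 1) i" if "i \<in> {1..<n - 1}" for i
    using \<rho>_coset [of "basis_vec [i]"] that by (auto simp: hecke_gen_eq)
  have gens: "hecke_gen (n - 1) ` {1..<n - 1} \<subseteq> carrier (hecke (n - 1))"
    using hecke_gen_closed by blast
  have "(\<rho> \<circ> \<iota>) x = x" if "x \<in> carrier (hecke (n - 1))" for x
  proof (rule complex_algebra.algebra_hom_fix_generated
      [OF complex_algebra_hecke algebra_hom_comp [OF \<iota> \<rho>] gens])
    show "(\<rho> \<circ> \<iota>) s = s" if "s \<in> hecke_gen (n - 1) ` {1..<n - 1}" for s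
      using that by (elim imageE) (simp only: comp_apply \<iota>_gen \<rho>_gen)
    show "x \<in> generated_subalgebra (hecke (n - 1)) (hecke_gen (n - 1) ` {1..<n - 1})"
      using that by (simp only: generated_hecke)
  qed
  then have "inj_on \<iota> (carrier (hecke (n - 1)))"
    by (intro inj_on_inverseI [of _ \<rho>]) simp
  moreover have "\<iota> ` carrier (hecke (n - 1)) = generated_subalgebra (hecke n) (hecke_gen n ` {1..<n - 1})"
    using generated_subalgebra_hom [OF complex_algebra_hecke complex_algebra_hecke \<iota> gens]
    by (simp only: generated_hecke image_image \<iota>_gen cong: image_cong)
  ultimately have "hecke_pred_identification n \<iota>"
    unfolding hecke_pred_identification_def algebra_embedding_eq using \<iota> \<iota>_gen by blast
  then show thesis
    by (rule that)
qed

global_interpretation hecke_pair: algebra_pair "hecke k" "hecke l" for k l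
  by (intro algebra_pair.intro complex_algebra_hecke)

abbreviation tensor_gens :: "nat \<Rightarrow> nat \<Rightarrow> (hecke_elem \<times> hecke_elem \<Rightarrow>\<^sub>0 complex) set set"
  where "tensor_gens k l \<equiv>
    (\<lambda>a. pure_tensor (hecke k) (hecke l) a \<one>\<^bsub>hecke l\<^esub>) ` hecke_gen k ` {1..<k} \<union>
    pure_tensor (hecke k) (hecke l) \<one>\<^bsub>hecke k\<^esub> ` hecke_gen l ` {1..<l}"

lemma generated_tensor_hecke:
  "generated_subalgebra (tensor_algebra (hecke k) (hecke l)) (tensor_gens k l) =
    carrier (tensor_algebra (hecke k) (hecke l))"
  by (rule hecke_pair.generated_tensor_algebra [OF _ generated_hecke _ generated_hecke])
    (use hecke_gen_closed in blast)+

lemma hecke_one_closed: "\<one>\<^bsub>hecke N\<^esub> \<in> carrier (hecke N)"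
  by (intro monoid.one_closed ring.is_monoid complex_algebra.axioms(1) complex_algebra_hecke)

lemma tensor_gens_closed: "tensor_gens k l \<subseteq> carrier (tensor_algebra (hecke k) (hecke l))"
  using hecke_pair.pure_tensor_closed hecke_gen_closed hecke_one_closed by blast

text \<open>Both products are bilinear in \<open>a\<close> and \<open>b\<close>, so words suffice.
  Letters from the first factor are at most \<open>m - 1\<close> and letters from the second at
  least \<open>m + 1\<close>; the gap left by the missing generator \<open>\<pi>\<^sub>m\<close>
  makes them commute.\<close>

lemma hecke_shifts_commute:
  assumes h: "algebra_hom (hecke m) (hecke n) h" and k: "algebra_hom (hecke l) (hecke n) k"
    and h_word: "\<And>w. w \<in> lists {1..<m} \<Longrightarrow>
      h (hecke_coset m (basis_vec w)) = hecke_coset n (basis_vec (shift_word 0 w))"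
    and k_word: "\<And>w. w \<in> lists {1..<l} \<Longrightarrow>
      k (hecke_coset l (basis_vec w)) = hecke_coset n (basis_vec (shift_word m w))"
    and le: "m + l \<le> n"
    and a: "a \<in> carrier (hecke m)" and b: "b \<in> carrier (hecke l)"
  shows "h a \<otimes>\<^bsub>hecke n\<^esub> k b = k b \<otimes>\<^bsub>hecke n\<^esub> h a"
proof -
  note hom = algebra_homD(1,2,5) [OF h] algebra_homD(1,2,5) [OF k]
  note distr = hecke_pair.A.l_distr hecke_pair.A.r_distr
    hecke_pair.A.asmult_mult_l hecke_pair.A.asmult_mult_r
  show ?thesis
    using a
  proof (induction rule: hecke_induct)
    case (basis u)
    note u = this
    then have hu: "h (hecke_coset m (basis_vec u)) \<in> carrier (hecke n)"
      by (intro algebra_homD(1) [OF h] hecke_coset_closed) simp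
    show ?case
      using b
    proof (induction rule: hecke_induct)
      case (basis v)
      have mn: "m + 0 \<le> n" and ln: "l + m \<le> n"
        using le by simp_all
      have "i + 2 \<le> j" if "i \<in> set (shift_word 0 u)" "j \<in> set (shift_word m v)" for i j
        using that u basis by (fastforce simp: in_lists_conv_set)
      with u basis show ?case
        unfolding h_word [OF u] k_word [OF basis]
        by (intro hecke_words_commute shift_word_lists [OF _ mn] shift_word_lists [OF _ ln])
    qed (simp_all only: hom hu distr)
  qed (simp_all only: hom b distr)
qed

lemma hecke_tensor_identification_exists:
  assumes "m \<le> n"
  obtains \<iota> where "hecke_tensor_identification n m \<iota>"
proof -
  let ?l = "n - m"
  let ?T = "tensor_algebra (hecke m) (hecke ?l)"
  let ?D = "tensor_relations (hecke m) (hecke ?l)" and ?G = "hecke m \<times>\<times> hecke ?l"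
    and ?p = "pure_tensor (hecke m) (hecke ?l)"
  let ?c = "\<lambda>N w. hecke_coset N (basis_vec w)"
  have le: "m + 0 \<le> n" "?l + m \<le> n" "m + ?l \<le> n"
    using assms by simp_all
  obtain h where h: "algebra_hom (hecke m) (hecke n) h"
    and h_word: "\<And>w. w \<in> lists {1..<m} \<Longrightarrow> h (?c m w) = ?c n (shift_word 0 w)"
    using hecke_shift_exists [OF le(1)] by blast
  obtain k where k: "algebra_hom (hecke ?l) (hecke n) k"
    and k_word: "\<And>w. w \<in> lists {1..<?l} \<Longrightarrow> k (?c ?l w) = ?c n (shift_word m w)"
    using hecke_shift_exists [OF le(2)] by blast
  obtain \<iota> where \<iota>: "algebra_hom ?T (hecke n) \<iota>"
    and \<iota>_pure: "\<And>a b. \<lbrakk>a \<in> carrier (hecke m); b \<in> carrier (hecke ?l)\<rbrakk> \<Longrightarrow>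
      \<iota> (?p a b) = h a \<otimes>\<^bsub>hecke n\<^esub> k b"
    using hecke_pair.tensor_algebra_hom_exists [OF hecke_monoid_quotient hecke_eq h k
        hecke_shifts_commute [OF h k h_word k_word le(3)]] by blast
  have gen: "hecke_gen n i \<in> carrier (hecke n)" if "i \<in> {1..<n}" for i
    using that by (rule hecke_gen_closed)
  have \<iota>_left: "\<iota> (?p (hecke_gen m i) \<one>\<^bsub>hecke ?l\<^esub>) = hecke_gen n i"
    if "i \<in> {1..<m}" for i
  proof -
    have "h (hecke_gen m i) = hecke_gen n i"
      using h_word [of "[i]"] that by (simp add: hecke_gen_eq)
    moreover have "i \<in> {1..<n}"
      using that assms by auto
    ultimately show ?thesis
      using that gen by (simp add: \<iota>_pure hecke_gen_closed hecke_one_closed algebra_homD(4) [OF k])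
  qed
  have \<iota>_right: "\<iota> (?p \<one>\<^bsub>hecke m\<^esub> (hecke_gen ?l i)) = hecke_gen n (i + m)"
    if "i \<in> {1..<?l}" for i
  proof -
    have "k (hecke_gen ?l i) = hecke_gen n (i + m)"
      using k_word [of "[i]"] that by (simp add: hecke_gen_eq)
    moreover have "i + m \<in> {1..<n}"
      using that assms by auto
    ultimately show ?thesis
      using that gen by (simp add: \<iota>_pure hecke_gen_closed hecke_one_closed algebra_homD(4) [OF h])
  qed
  \<comment> \<open>These separate the letters on the two sides of \<open>m\<close>, with those
    above translated back to start from 1. A surviving word has no letter \<open>m\<close>, so no
    letter is lost.\<close>
  define below above where "below = filter (\<lambda>i. i < m)"
    and "above w = map (\<lambda>i. i - m) (filter (\<lambda>i. m < i) w)" for w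
  let ?\<phi> = "\<lambda>w. if m \<in> set w then 0 else basis_vec (?c m (below w), ?c ?l (above w))"
  have words: "below w \<in> lists {1..<m}" "above w \<in> lists {1..<?l}" if "w \<in> lists {1..<n}" for w
    using that by (auto simp: below_def above_def in_lists_conv_set)
  have coset_app: "?c N (u @ v) = ?c N u \<otimes>\<^bsub>hecke N\<^esub> ?c N v"
    if "u \<in> lists {1..<N}" "v \<in> lists {1..<N}" for u v N
    by (subst hecke_coset_simps(3)) (use that in auto)
  have one: "?c N [] = \<one>\<^bsub>hecke N\<^esub>" for N
    by (simp only: hecke_coset_simps)
  obtain \<rho> where \<rho>: "algebra_hom (hecke n) ?T \<rho>"
    and \<rho>_coset: "\<And>f. keys f \<subseteq> lists {1..<n} \<Longrightarrow>
      \<rho> (hecke_coset n f) = hecke_pair.AB.q m ?l (linear_ext ?\<phi> f)"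
  proof (rule quotient_algebra_hom_exists
      [OF hecke_monoid_quotient [of n] hecke_pair.AB.monoid_quotient_axioms [of m ?l], of ?\<phi>])
    note zero = pm.subspace_0 [OF subspace_tensor_relations]
    show keys: "keys (?\<phi> w) \<subseteq> carrier (?G)"
      if "w \<in> carrier (word_monoid n)" for w
      using words [of w] that by (auto simp: hecke_pair.carrier_AB intro!: hecke_coset_closed)
    have mult: "?\<phi> (u @ v) = bilinear_ext (mult (?G)) (?\<phi> u) (?\<phi> v)"
      if "u \<in> lists {1..<n}" "v \<in> lists {1..<n}" for u v
      using coset_app [OF words(1) [OF that(1)] words(1) [OF that(2)]]
        coset_app [OF words(2) [OF that(1)] words(2) [OF that(2)]]
      by (simp add: below_def above_def DirProd_def)
    show "?\<phi> (u \<otimes>\<^bsub>word_monoid n\<^esub> v) -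
        bilinear_ext (mult (?G)) (?\<phi> u) (?\<phi> v) \<in> ?D"
      if "u \<in> carrier (word_monoid n)" "v \<in> carrier (word_monoid n)" for u v
      using mult [of u v] that by (simp only: monoid.simps partial_object.simps diff_self zero)
    show "?\<phi> \<one>\<^bsub>word_monoid n\<^esub> - basis_vec \<one>\<^bsub>?G\<^esub> \<in> ?D"
      using zero by (simp add: below_def above_def hecke_pair.one_AB one)
    show "linear_ext ?\<phi> f \<in> ?D" if "f \<in> hecke_ideal n" for f
    proof (rule linear_ext_hecke_ideal [OF hecke_pair.AB.monoid_quotient_axioms _ mult _ that])
      fix r assume "r \<in> hecke_relations n"
      \<comment> \<open>The value is \<open>0\<close> and not merely a tensor relation: the basis of
        the free space above the tensor algebra consists of pairs of Hecke algebra elements, between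
        which the Hecke relations are already equalities. Commuting letters on different sides of
        \<open>m\<close> end up in different components, where their order is invisible.\<close>
      then have "linear_ext ?\<phi> r = 0"
      proof (cases rule: hecke_relations_cases)
        case (idem i)
        then consider "i = m" | "i < m" | "m < i" by linarith
        then show ?thesis
          using hecke_coset_relations(1) [of i m] hecke_coset_relations(1) [of "i - m" ?l] idem
          by cases (simp_all add: linear_ext_linear below_def above_def)
      next
        case (braid i)
        then consider "i = m" | "i + 1 = m" | "i + 1 < m" | "m < i" by linarith
        then show ?thesis
          using hecke_coset_relations(2) [of i m] hecke_coset_relations(2) [of "i - m" ?l] braid
          by cases (simp_all add: linear_ext_linear below_def above_def Suc_diff_le)
      next
        case (comm i j)
        have shifted: "?c ?l [i - m, j - m] = ?c ?l [j - m, i - m]" if "m < i" "m < j"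
          by (rule hecke_coset_relations(3)) (use comm that in linarith)+
        from comm consider "i = m \<or> j = m" | "i < m" "j < m" | "m < i" "m < j" | "i < m" "m < j" | "m < i" "j < m"
          by linarith
        then show ?thesis
          using hecke_coset_relations(3) [of i m j] shifted comm
          by cases (auto simp: linear_ext_linear below_def above_def)
      qed
      then show "linear_ext ?\<phi> r \<in> ?D"
        using zero by simp
    qed (use keys in simp_all)
    fix \<rho>
    assume "algebra_hom (quotient_algebra (monoid_algebra (word_monoid n)) (hecke_ideal n))
        (quotient_algebra (monoid_algebra (?G)) (?D)) \<rho>"
      and "\<And>f. keys f \<subseteq> carrier (word_monoid n) \<Longrightarrow>
        \<rho> (hecke_coset n f) = hecke_pair.AB.q m ?l (linear_ext ?\<phi> f)"
    then show thesis
      by (intro that [of \<rho>]) (simp_all add: hecke_eq [of n] hecke_pair.tensor_algebra_eq)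
  qed
  have \<rho>_left: "\<rho> (hecke_gen n i) = ?p (hecke_gen m i) \<one>\<^bsub>hecke ?l\<^esub>"
    if "i \<in> {1..<m}" for i
    using \<rho>_coset [of "basis_vec [i]"] that assms
    by (auto simp: hecke_gen_eq pure_tensor_eq below_def above_def one)
  have \<rho>_right: "\<rho> (hecke_gen n (i + m)) = ?p \<one>\<^bsub>hecke m\<^esub> (hecke_gen ?l i)"
    if "i \<in> {1..<?l}" for i
    using \<rho>_coset [of "basis_vec [i + m]"] that assms
    by (auto simp: hecke_gen_eq pure_tensor_eq below_def above_def one)
  have "(\<rho> \<circ> \<iota>) x = x" if "x \<in> carrier ?T" for x
  proof (rule complex_algebra.algebra_hom_fix_generated
      [OF hecke_pair.complex_algebra_tensor algebra_hom_comp [OF \<iota> \<rho>] tensor_gens_closed])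
    show "(\<rho> \<circ> \<iota>) s = s" if "s \<in> tensor_gens m ?l" for s
      using that by (elim UnE imageE) (simp_all only: comp_apply \<iota>_left \<iota>_right \<rho>_left \<rho>_right)
    show "x \<in> generated_subalgebra ?T (tensor_gens m ?l)"
      using that by (simp only: generated_tensor_hecke)
  qed
  then have "inj_on \<iota> (carrier ?T)"
    by (intro inj_on_inverseI [of _ \<rho>]) simp
  moreover have "\<iota> ` carrier ?T = generated_subalgebra (hecke n) (hecke_gen n ` ({1..<n} - {m}))"
  proof -
    have "(\<lambda>i. i + m) ` {1..<?l} = {m + 1..<n}"
      using assms by (auto simp: image_iff)
    then have "{1..<n} - {m} = {1..<m} \<union> (\<lambda>i. i + m) ` {1..<?l}"
      using assms by auto
    then have "\<iota> ` tensor_gens m ?l = hecke_gen n ` ({1..<n} - {m})"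
      by (simp only: image_Un image_image \<iota>_left \<iota>_right cong: image_cong)
    then show ?thesis
      using generated_subalgebra_hom [OF hecke_pair.complex_algebra_tensor complex_algebra_hecke \<iota>
          tensor_gens_closed] by (simp only: generated_tensor_hecke)
  qed
  moreover have "\<iota> (?p \<one>\<^bsub>hecke m\<^esub> (hecke_gen ?l (i - m))) = hecke_gen n i"
    if "i \<in> {m + 1..<n}" for i
  proof -
    have "i - m \<in> {1..<?l}" "i - m + m = i"
      using that by auto
    then show ?thesis
      using \<iota>_right [of "i - m"] by simp
  qed
  ultimately have "hecke_tensor_identification n m \<iota>"
    unfolding hecke_tensor_identification_def algebra_embedding_eq using \<iota> \<iota>_left by blast
  then show thesis
    by (rule that)
qed

section \<open>The modules on standard immaculate tableaux\<close>

text \<open>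
  The entries in two conflicting cells are ordered in the same way in every tableau. Two
  consecutive entries of a tableau can therefore be switched iff their cells do not conflict.
\<close>

definition conflict :: "nat \<times> nat \<Rightarrow> nat \<times> nat \<Rightarrow> bool"
  where "conflict x y \<longleftrightarrow> fst x = fst y \<or> snd x = 1 \<and> snd y = 1"

text \<open>Merges the conditions on rows and on the leftmost column into one relation along which
  every tableau increases, so that monotonicity is argued only once.\<close>

definition precedes :: "nat \<times> nat \<Rightarrow> nat \<times> nat \<Rightarrow> bool"
  where "precedes x y \<longleftrightarrow>
    fst x = fst y \<and> snd x < snd y \<or> snd x = 1 \<and> snd y = 1 \<and> fst x < fst y"

lemma conflict_iff: "x \<noteq> y \<Longrightarrow> conflict x y \<longleftrightarrow> precedes x y \<or> precedes y x"
  by (cases x; cases y) (auto simp: conflict_def precedes_def)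

lemma SIT_iff:
  "T \<in> SIT \<alpha> \<beta> \<longleftrightarrow>
    bij_betw T (skew_diagram \<alpha> \<beta>) {1..sum_list \<alpha> - sum_list \<beta>} \<and>
    (\<forall>x. x \<notin> skew_diagram \<alpha> \<beta> \<longrightarrow> T x = 0) \<and>
    (\<forall>x\<in>skew_diagram \<alpha> \<beta>. \<forall>y\<in>skew_diagram \<alpha> \<beta>. precedes x y \<longrightarrow> T x < T y)"
  unfolding SIT_def precedes_def by auto

text \<open>Meaningful for the genuine entries only: the dummy value \<open>0\<close> sits in
  infinitely many cells.\<close>

definition cell_of :: "filling \<Rightarrow> nat \<Rightarrow> nat \<times> nat"
  where "cell_of T k = (THE x. T x = k)"

lemma cell_of_eqI: "(\<And>y. T y = k \<longleftrightarrow> y = x) \<Longrightarrow> cell_of T k = x"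
  by (simp add: cell_of_def)

lemma entry_row_eq:
  assumes "\<exists>!x. T x = k"
  shows "entry_row T k = fst (cell_of T k)"
proof -
  obtain r c where rc: "\<And>y. T y = k \<longleftrightarrow> y = (r, c)"
    using assms by (metis surj_pair)
  then show ?thesis
    by (simp add: entry_row_def cell_of_eqI [OF rc])
qed

context
  fixes \<alpha> \<beta> :: "nat list" and T :: filling
  assumes T: "T \<in> SIT \<alpha> \<beta>"
begin

lemma SIT_bij: "bij_betw T (skew_diagram \<alpha> \<beta>) {1..sum_list \<alpha> - sum_list \<beta>}"
  using T unfolding SIT_iff by blast

lemma SIT_outside: "x \<notin> skew_diagram \<alpha> \<beta> \<Longrightarrow> T x = 0"
  using T unfolding SIT_iff by blast

lemma SIT_mono:
  "\<lbrakk>x \<in> skew_diagram \<alpha> \<beta>; y \<in> skew_diagram \<alpha> \<beta>; precedes x y\<rbrakk> \<Longrightarrow> T x < T y"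
  using T unfolding SIT_iff by blast

lemma SIT_pos_iff: "0 < T x \<longleftrightarrow> x \<in> skew_diagram \<alpha> \<beta>"
  using bij_betwE [OF SIT_bij] SIT_outside [of x] by fastforce

lemma SIT_le: "T x \<le> sum_list \<alpha> - sum_list \<beta>"
  using bij_betwE [OF SIT_bij] SIT_outside [of x] by (cases "x \<in> skew_diagram \<alpha> \<beta>") auto

lemma SIT_eq_iff: "0 < T x \<Longrightarrow> T x = T y \<longleftrightarrow> x = y"
  using bij_betw_imp_inj_on [OF SIT_bij] SIT_pos_iff [of x] SIT_pos_iff [of y]
  by (auto dest: inj_onD)

lemma SIT_ex1:
  assumes "1 \<le> k" "k \<le> sum_list \<alpha> - sum_list \<beta>"
  shows "\<exists>!x. T x = k"
proof -
  have "k \<in> T ` skew_diagram \<alpha> \<beta>"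
    using bij_betw_imp_surj_on [OF SIT_bij] assms by simp
  then obtain x where "T x = k"
    by blast
  then show ?thesis
    using SIT_eq_iff [of x] assms by (intro ex1I [of _ x]) (simp_all, metis)
qed

lemma cell_of_iff:
  "\<lbrakk>1 \<le> k; k \<le> sum_list \<alpha> - sum_list \<beta>\<rbrakk> \<Longrightarrow> cell_of T k = x \<longleftrightarrow> T x = k"
  using SIT_ex1 [of k] theI' [of "\<lambda>x. T x = k"] unfolding cell_of_def by blast

lemma SIT_cell_of: "\<lbrakk>1 \<le> k; k \<le> sum_list \<alpha> - sum_list \<beta>\<rbrakk> \<Longrightarrow> T (cell_of T k) = k"
  using cell_of_iff by blast

lemma cell_of_mem:
  "\<lbrakk>1 \<le> k; k \<le> sum_list \<alpha> - sum_list \<beta>\<rbrakk> \<Longrightarrow> cell_of T k \<in> skew_diagram \<alpha> \<beta>"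
  using SIT_cell_of [of k] SIT_pos_iff [of "cell_of T k"] by simp

lemma cell_of_swap:
  assumes i: "1 \<le> i" "i < sum_list \<alpha> - sum_list \<beta>" and k: "1 \<le> k" "k \<le> sum_list \<alpha> - sum_list \<beta>"
  shows "cell_of (swap_entries i T) k = cell_of T (Transposition.transpose i (i + 1) k)"
proof (rule cell_of_eqI)
  let ?k = "Transposition.transpose i (i + 1) k"
  have "1 \<le> ?k" "?k \<le> sum_list \<alpha> - sum_list \<beta>"
    using i k by (auto simp: Transposition.transpose_def)
  then have "y = cell_of T ?k \<longleftrightarrow> T y = ?k" for y
    using cell_of_iff by metis
  moreover have "swap_entries i T y = k \<longleftrightarrow> T y = ?k" for y
    by (auto simp: swap_entries_def)
  ultimately show "swap_entries i T y = k \<longleftrightarrow> y = cell_of T ?k" for y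
    by simp
qed

lemma swap_SIT_iff:
  assumes i: "1 \<le> i" "i < sum_list \<alpha> - sum_list \<beta>"
  shows "swap_entries i T \<in> SIT \<alpha> \<beta> \<longleftrightarrow> \<not> conflict (cell_of T i) (cell_of T (i + 1))"
proof -
  let ?x = "cell_of T i" and ?y = "cell_of T (i + 1)" and ?t = "Transposition.transpose i (i + 1)"
  have xy: "T ?x = i" "T ?y = i + 1" "?x \<in> skew_diagram \<alpha> \<beta>" "?y \<in> skew_diagram \<alpha> \<beta>"
    using i by (simp_all add: SIT_cell_of cell_of_mem)
  have "?x \<noteq> ?y"
    using xy by auto
  show ?thesis
  proof
    assume swap: "swap_entries i T \<in> SIT \<alpha> \<beta>"
    have "\<not> precedes ?x ?y"
    proof
      assume "precedes ?x ?y"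
      then have "swap_entries i T ?x < swap_entries i T ?y"
        using swap xy(3,4) unfolding SIT_iff by blast
      then show False
        using xy(1,2) by (simp add: swap_entries_def)
    qed
    moreover have "\<not> precedes ?y ?x"
      using SIT_mono [of ?y ?x] xy by auto
    ultimately show "\<not> conflict ?x ?y"
      using conflict_iff [OF \<open>?x \<noteq> ?y\<close>] by simp
  next
    assume nc: "\<not> conflict ?x ?y"
    have "bij_betw (?t \<circ> T) (skew_diagram \<alpha> \<beta>) {1..sum_list \<alpha> - sum_list \<beta>}"
    proof (rule bij_betw_trans [OF SIT_bij])
      show "bij_betw ?t {1..sum_list \<alpha> - sum_list \<beta>} {1..sum_list \<alpha> - sum_list \<beta>}"
        using i by (intro bij_betw_byWitness [where f' = ?t]) (auto simp: Transposition.transpose_def)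
    qed
    moreover have "?t (T x) = 0" if "x \<notin> skew_diagram \<alpha> \<beta>" for x
      using SIT_outside [OF that] i by (simp add: Transposition.transpose_def)
    moreover have "?t (T u) < ?t (T v)"
      if uv: "u \<in> skew_diagram \<alpha> \<beta>" "v \<in> skew_diagram \<alpha> \<beta>" "precedes u v" for u v
    proof -
      have "T u < T v"
        using uv by (rule SIT_mono)
      \<comment> \<open>The transposition reverses the order of no pair of entries other than
        \<open>i\<close> and \<open>i + 1\<close>, so excluding this pair is enough.\<close>
      moreover have "\<not> (T u = i \<and> T v = i + 1)"
      proof
        assume "T u = i \<and> T v = i + 1"
        then have "?x = u" "?y = v"
          using i cell_of_iff [of i u] cell_of_iff [of "i + 1" v] by simp_all
        then show False
          using nc uv(3) conflict_iff [OF \<open>?x \<noteq> ?y\<close>] by simp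
      qed
      ultimately show ?thesis
        by (auto simp: Transposition.transpose_def)
    qed
    ultimately show "swap_entries i T \<in> SIT \<alpha> \<beta>"
      unfolding SIT_iff swap_entries_def comp_apply by blast
  qed
qed

text \<open>Expresses descents and admissible switches through the two cells alone. The Hecke
  relations then become case distinctions on how a few fixed cells compare.\<close>

lemma pi_basis_eq:
  assumes i: "1 \<le> i" "i < sum_list \<alpha> - sum_list \<beta>"
  shows "pi_basis a \<alpha> \<beta> i T =
    (if \<not> row_condition a (fst (cell_of T i)) (fst (cell_of T (i + 1))) then basis_vec T
     else if conflict (cell_of T i) (cell_of T (i + 1)) then 0
     else basis_vec (swap_entries i T))"
  using i swap_SIT_iff [OF i] SIT_ex1 [of i] SIT_ex1 [of "i + 1"]
  by (simp add: pi_basis_def Des_def entry_row_eq)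

end

section \<open>The 0-Hecke relations on tableaux\<close>

lemma row_condition_trans: "\<lbrakk>row_condition a r s; row_condition a s t\<rbrakk> \<Longrightarrow> row_condition a r t"
  by (cases a) auto

lemma row_condition_antisym: "\<lbrakk>row_condition a r s; row_condition a s r\<rbrakk> \<Longrightarrow> r = s"
  by (cases a) auto

lemma keys_pi_basis:
  assumes "T \<in> SIT \<alpha> \<beta>"
  shows "keys (pi_basis a \<alpha> \<beta> i T) \<subseteq> SIT \<alpha> \<beta>"
  using assms by (simp add: pi_basis_def)

lemma swap_entries_relations:
  "i + 2 \<le> j \<or> j + 2 \<le> i \<Longrightarrow> swap_entries i (swap_entries j T) = swap_entries j (swap_entries i T)"
  "swap_entries i (swap_entries (i + 1) (swap_entries i T)) =
    swap_entries (i + 1) (swap_entries i (swap_entries (i + 1) T))"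
  by (auto simp: swap_entries_def fun_eq_iff Transposition.transpose_def)

text \<open>If \<open>i\<close> and \<open>i + 1\<close> are really switched, their cells lie in
  different rows, and by antisymmetry \<open>i\<close> is no longer a descent afterwards, so the
  result is fixed. Otherwise the first application already gives \<open>T\<close> or
  \<open>0\<close>.\<close>

lemma pi_basis_idem:
  assumes T: "T \<in> SIT \<alpha> \<beta>" and i: "1 \<le> i" "i < sum_list \<alpha> - sum_list \<beta>"
  shows "linear_ext (pi_basis a \<alpha> \<beta> i) (pi_basis a \<alpha> \<beta> i T) = pi_basis a \<alpha> \<beta> i T"
proof -
  let ?x = "cell_of T i" and ?y = "cell_of T (i + 1)"
  show ?thesis
  proof (cases "row_condition a (fst ?x) (fst ?y) \<and> \<not> conflict ?x ?y")
    case True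
    then have "swap_entries i T \<in> SIT \<alpha> \<beta>"
      using swap_SIT_iff [OF T i] by simp
    moreover have "\<not> row_condition a (fst ?y) (fst ?x)"
      using True row_condition_antisym by (auto simp: conflict_def)
    ultimately show ?thesis
      using True i by (simp add: pi_basis_eq [OF _ i] T cell_of_swap [OF T i])
  next
    case False
    then show ?thesis
      by (auto simp: pi_basis_eq [OF T i])
  qed
qed

text \<open>The two switches concern disjoint pairs of entries, so neither moves the cells that
  decide about the other.\<close>

lemma pi_basis_commute:
  assumes T: "T \<in> SIT \<alpha> \<beta>" and i: "1 \<le> i" "i < sum_list \<alpha> - sum_list \<beta>"
    and j: "1 \<le> j" "j < sum_list \<alpha> - sum_list \<beta>" and far: "i + 2 \<le> j \<or> j + 2 \<le> i"
  shows "linear_ext (pi_basis a \<alpha> \<beta> i) (pi_basis a \<alpha> \<beta> j T) =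
    linear_ext (pi_basis a \<alpha> \<beta> j) (pi_basis a \<alpha> \<beta> i T)"
proof -
  have fixed: "Transposition.transpose i (Suc i) j = j"
    "Transposition.transpose i (Suc i) (Suc j) = Suc j"
    "Transposition.transpose j (Suc j) i = i"
    "Transposition.transpose j (Suc j) (Suc i) = Suc i"
    using far by (auto simp: Transposition.transpose_def)
  note eqs = pi_basis_eq [OF _ i] pi_basis_eq [OF _ j] T cell_of_swap [OF T i] cell_of_swap [OF T j]
    swap_SIT_iff [OF T i] swap_SIT_iff [OF T j] fixed
  show ?thesis
    using i j far swap_entries_relations(1) [of i j T]
    by (cases "row_condition a (fst (cell_of T i)) (fst (cell_of T (i + 1)))";
        cases "row_condition a (fst (cell_of T j)) (fst (cell_of T (j + 1)))";
        cases "conflict (cell_of T i) (cell_of T (i + 1))";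
        cases "conflict (cell_of T j) (cell_of T (j + 1))")
      (simp_all add: eqs)
qed

text \<open>Only the cells x, y, z of \<open>i\<close>, \<open>i + 1\<close>, \<open>i + 2\<close>
  matter. Both sides sort them by adjacent comparisons, in two different orders, and vanish when a
  descent meets a conflict. Transitivity rules out that x, y and y, z are out of order but x, z are
  not; antisymmetry ensures that an executed switch is not undone. The remaining configurations are
  checked one by one.\<close>

lemma pi_basis_braid:
  assumes T: "T \<in> SIT \<alpha> \<beta>" and i: "1 \<le> i" "i + 1 < sum_list \<alpha> - sum_list \<beta>"
  shows "linear_ext (pi_basis a \<alpha> \<beta> i) (linear_ext (pi_basis a \<alpha> \<beta> (i + 1)) (pi_basis a \<alpha> \<beta> i T)) =
    linear_ext (pi_basis a \<alpha> \<beta> (i + 1)) (linear_ext (pi_basis a \<alpha> \<beta> i) (pi_basis a \<alpha> \<beta> (i + 1) T))"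
proof -
  let ?P = "pi_basis a \<alpha> \<beta>" and ?N = "sum_list \<alpha> - sum_list \<beta>"
  define C where "C x y = row_condition a (fst x) (fst y)" for x y :: "nat \<times> nat"
  have i': "i < ?N" "1 \<le> i + 1"
    using i by simp_all
  \<comment> \<open>One move, stated for an arbitrary tableau with three known cells, so that it
    applies to each intermediate tableau.\<close>
  have step: "?P i U = (if \<not> C x y then basis_vec U else if conflict x y then 0
        else basis_vec (swap_entries i U))"
      "?P (i + 1) U = (if \<not> C y z then basis_vec U else if conflict y z then 0
        else basis_vec (swap_entries (i + 1) U))"
      "swap_entries i U \<in> SIT \<alpha> \<beta> \<longleftrightarrow> \<not> conflict x y"
      "swap_entries (i + 1) U \<in> SIT \<alpha> \<beta> \<longleftrightarrow> \<not> conflict y z"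
      "cell_of (swap_entries i U) i = y" "cell_of (swap_entries i U) (i + 1) = x"
      "cell_of (swap_entries i U) (i + 2) = z" "cell_of (swap_entries (i + 1) U) i = x"
      "cell_of (swap_entries (i + 1) U) (i + 1) = z" "cell_of (swap_entries (i + 1) U) (i + 2) = y"
    if "U \<in> SIT \<alpha> \<beta>" "cell_of U i = x" "cell_of U (i + 1) = y" "cell_of U (i + 2) = z" for U x y z
  proof -
    have *: "i + 1 + 1 = i + 2" "i + 2 \<le> ?N"
      using i by simp_all
    show "?P i U = (if \<not> C x y then basis_vec U else if conflict x y then 0
        else basis_vec (swap_entries i U))"
      unfolding pi_basis_eq [OF that(1) i(1) i'(1)] that C_def ..
    show "?P (i + 1) U = (if \<not> C y z then basis_vec U else if conflict y z then 0
        else basis_vec (swap_entries (i + 1) U))"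
      unfolding pi_basis_eq [OF that(1) i'(2) i(2)] * that C_def ..
    show "swap_entries i U \<in> SIT \<alpha> \<beta> \<longleftrightarrow> \<not> conflict x y"
      unfolding swap_SIT_iff [OF that(1) i(1) i'(1)] that ..
    show "swap_entries (i + 1) U \<in> SIT \<alpha> \<beta> \<longleftrightarrow> \<not> conflict y z"
      unfolding swap_SIT_iff [OF that(1) i'(2) i(2)] * that ..
  qed (use i that in \<open>simp_all add: cell_of_swap Transposition.transpose_def\<close>)
  let ?x = "cell_of T i" and ?y = "cell_of T (i + 1)" and ?z = "cell_of T (i + 2)"
  have trans: "C u w" if "C u v" "C v w" for u v w
    using that row_condition_trans unfolding C_def by blast
  have asym: "\<not> C v u" if "C u v" "\<not> conflict u v" for u v
    using that row_condition_antisym unfolding C_def conflict_def by blast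
  note T0 = step [OF T refl refl refl]
  \<comment> \<open>The cells of \<open>i\<close>, \<open>i + 1\<close>, \<open>i + 2\<close> are y,
    x, z in \<open>S1\<close>, x, z, y in \<open>S2\<close>, y, z, x in \<open>S12\<close> and z, x,
    y in \<open>S21\<close>. A further switch of \<open>S12\<close> or \<open>S21\<close> leads to
    z, y, x, where the two routes meet.\<close>
  define S1 S2 where "S1 = swap_entries i T" and "S2 = swap_entries (i + 1) T"
  define S12 S21 where "S12 = swap_entries (i + 1) S1" and "S21 = swap_entries i S2"
  have S1: "S1 \<in> SIT \<alpha> \<beta>" "cell_of S1 i = ?y" "cell_of S1 (i + 1) = ?x" "cell_of S1 (i + 2) = ?z"
    if "\<not> conflict ?x ?y"
    using T0 that unfolding S1_def by simp_all
  have S2: "S2 \<in> SIT \<alpha> \<beta>" "cell_of S2 i = ?x" "cell_of S2 (i + 1) = ?z" "cell_of S2 (i + 2) = ?y"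
    if "\<not> conflict ?y ?z"
    using T0 that unfolding S2_def by simp_all
  have S12: "S12 \<in> SIT \<alpha> \<beta>" "cell_of S12 i = ?y" "cell_of S12 (i + 1) = ?z" "cell_of S12 (i + 2) = ?x"
    if "\<not> conflict ?x ?y" "\<not> conflict ?x ?z"
    using step [OF S1 [OF that(1)]] that(2) unfolding S12_def by simp_all
  have S21: "S21 \<in> SIT \<alpha> \<beta>" "cell_of S21 i = ?z" "cell_of S21 (i + 1) = ?x" "cell_of S21 (i + 2) = ?y"
    if "\<not> conflict ?y ?z" "\<not> conflict ?x ?z"
    using step [OF S2 [OF that(1)]] that(2) unfolding S21_def by simp_all
  note action = T0(1,2) [folded S1_def S2_def] step(1,2) [OF S1, folded S12_def] step(1,2) [OF S2, folded S21_def]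
    step(1,2) [OF S12] step(1,2) [OF S21]
  have eq: "swap_entries i S12 = swap_entries (i + 1) S21"
    unfolding S1_def S2_def S12_def S21_def by (rule swap_entries_relations(2))
  show ?thesis
    using trans [of ?x ?y ?z] asym [of ?x ?y] asym [of ?x ?z] asym [of ?y ?z]
    by (cases "C ?x ?y"; cases "C ?x ?z"; cases "C ?y ?z";
        cases "conflict ?x ?y"; cases "conflict ?x ?z"; cases "conflict ?y ?z")
      (simp_all add: action eq del: One_nat_def add_2_eq_Suc')
qed

section \<open>The action of words and of the free algebra\<close>

lemma word_action_Nil [simp]: "word_action a \<alpha> \<beta> [] v = v"
  by (simp add: word_action_def)

lemma word_action_Cons [simp]:
  "word_action a \<alpha> \<beta> (i # w) v = linear_ext (pi_basis a \<alpha> \<beta> i) (word_action a \<alpha> \<beta> w v)"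
  by (simp add: word_action_def)

lemma word_action_append:
  "word_action a \<alpha> \<beta> (u @ w) v = word_action a \<alpha> \<beta> u (word_action a \<alpha> \<beta> w v)"
  by (simp add: word_action_def)

lemma word_action_linear:
  "word_action a \<alpha> \<beta> w (u + v) = word_action a \<alpha> \<beta> w u + word_action a \<alpha> \<beta> w v"
  "word_action a \<alpha> \<beta> w (pm_smult c v) = pm_smult c (word_action a \<alpha> \<beta> w v)"
  "word_action a \<alpha> \<beta> w 0 = 0"
  by (induction w) (simp_all add: linear_ext_linear)

lemma keys_word_action:
  "keys v \<subseteq> SIT \<alpha> \<beta> \<Longrightarrow> keys (word_action a \<alpha> \<beta> w v) \<subseteq> SIT \<alpha> \<beta>"
proof (induction w)
  case (Cons i w)
  show ?case
    unfolding word_action_Cons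
    by (intro keys_linear_ext keys_pi_basis) (use Cons in blast)
qed simp

text \<open>The action before passing to the quotient: \<open>SIT_module\<close> lets a coset act by
  the common value of this map on its elements.\<close>

definition free_action ::
  "variant \<Rightarrow> nat list \<Rightarrow> nat list \<Rightarrow> (nat list \<Rightarrow>\<^sub>0 complex) \<Rightarrow> (filling \<Rightarrow>\<^sub>0 complex) \<Rightarrow> filling \<Rightarrow>\<^sub>0 complex"
  where "free_action a \<alpha> \<beta> f v = linear_ext (\<lambda>w. word_action a \<alpha> \<beta> w v) f"

lemma free_action_linear:
  "free_action a \<alpha> \<beta> (f + g) v = free_action a \<alpha> \<beta> f v + free_action a \<alpha> \<beta> g v"
  "free_action a \<alpha> \<beta> (f - g) v = free_action a \<alpha> \<beta> f v - free_action a \<alpha> \<beta> g v"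
  "free_action a \<alpha> \<beta> (pm_smult c f) v = pm_smult c (free_action a \<alpha> \<beta> f v)"
  "free_action a \<alpha> \<beta> 0 v = 0"
  "free_action a \<alpha> \<beta> f (u + v) = free_action a \<alpha> \<beta> f u + free_action a \<alpha> \<beta> f v"
  "free_action a \<alpha> \<beta> f (pm_smult c v) = pm_smult c (free_action a \<alpha> \<beta> f v)"
  "free_action a \<alpha> \<beta> f 0 = 0"
  by (simp_all add: free_action_def linear_ext_linear word_action_linear linear_ext_fun_add
      linear_ext_fun_smult)

lemma free_action_basis [simp]: "free_action a \<alpha> \<beta> (basis_vec w) v = word_action a \<alpha> \<beta> w v"
  by (simp add: free_action_def)

lemma keys_free_action:
  "keys v \<subseteq> SIT \<alpha> \<beta> \<Longrightarrow> keys (free_action a \<alpha> \<beta> f v) \<subseteq> SIT \<alpha> \<beta>"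
  unfolding free_action_def by (intro keys_linear_ext keys_word_action)

lemma free_action_mult:
  "free_action a \<alpha> \<beta> (bilinear_ext (@) f g) v = free_action a \<alpha> \<beta> f (free_action a \<alpha> \<beta> g v)"
  \<comment> \<open>Words act linearly on all finitely supported functions, so the induction runs
    without any restriction of the support.\<close>
  using subset_UNIV [of "keys f"]
proof (induction f rule: free_on_induct)
  case (basis u)
  show ?case
    using subset_UNIV [of "keys g"]
    by (induction g rule: free_on_induct)
      (simp_all add: bilinear_ext_linear free_action_linear word_action_append word_action_linear)
qed (simp_all add: bilinear_ext_linear free_action_linear)

lemma free_action_relation:
  assumes r: "r \<in> hecke_relations (sum_list \<alpha> - sum_list \<beta>)" and v: "keys v \<subseteq> SIT \<alpha> \<beta>"
  shows "free_action a \<alpha> \<beta> r v = 0"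
  using v
proof (induction v rule: free_on_induct)
  case (basis T)
  show ?case
    using r
  proof (cases rule: hecke_relations_cases)
    case (idem i)
    then show ?thesis
      using pi_basis_idem [OF basis, of i] by (simp add: free_action_linear)
  next
    case (braid i)
    then show ?thesis
      using pi_basis_braid [OF basis, of i] by (simp add: free_action_linear)
  next
    case (comm i j)
    then show ?thesis
      using pi_basis_commute [OF basis, of i j] by (simp add: free_action_linear)
  qed
qed (simp_all add: free_action_linear)

text \<open>The vector \<open>v\<close> is quantified inside the induction: a product acts on
  \<open>v\<close> as its left factor on the image of \<open>v\<close> under the right factor, so
  the hypothesis is needed at that other vector.\<close>

lemma free_action_hecke_ideal:
  assumes f: "f \<in> hecke_ideal (sum_list \<alpha> - sum_list \<beta>)" and v: "keys v \<subseteq> SIT \<alpha> \<beta>"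
  shows "free_action a \<alpha> \<beta> f v = 0"
proof -
  have sub: "pm.subspace {f. \<forall>v. keys v \<subseteq> SIT \<alpha> \<beta> \<longrightarrow> free_action a \<alpha> \<beta> f v = 0}"
    by (auto simp: pm.subspace_def free_action_linear)
  have "\<forall>v. keys v \<subseteq> SIT \<alpha> \<beta> \<longrightarrow> free_action a \<alpha> \<beta> f v = 0"
    by (rule hecke_ideal_induct [OF f sub])
      (simp_all add: free_action_mult free_action_linear keys_free_action free_action_relation)
  with v show ?thesis
    by blast
qed

lemma SIT_module_simps [simp]:
  "carrier (SIT_module a \<alpha> \<beta>) = free_on (SIT \<alpha> \<beta>)" "\<zero>\<^bsub>SIT_module a \<alpha> \<beta>\<^esub> = 0"
  "add (SIT_module a \<alpha> \<beta>) = (+)"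
  by (simp_all add: SIT_module_def)

text \<open>The ideal acts as zero, so all elements of a coset act alike and \<open>the_elem\<close>
  is applied to a singleton.\<close>

lemma smult_SIT_module:
  assumes v: "keys v \<subseteq> SIT \<alpha> \<beta>"
  shows "hecke_coset (sum_list \<alpha> - sum_list \<beta>) f \<odot>\<^bsub>SIT_module a \<alpha> \<beta>\<^esub> v = free_action a \<alpha> \<beta> f v"
proof -
  let ?C = "hecke_coset (sum_list \<alpha> - sum_list \<beta>) f"
  have "free_action a \<alpha> \<beta> g v = free_action a \<alpha> \<beta> f v" if "g \<in> ?C" for g
    using free_action_hecke_ideal [of "g - f" \<alpha> \<beta> v a] that v
    by (simp add: mem_lin_coset_iff free_action_linear)
  then have "(\<lambda>g. free_action a \<alpha> \<beta> g v) ` ?C = (\<lambda>_. free_action a \<alpha> \<beta> f v) ` ?C"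
    by (rule image_cong [OF refl])
  also have "\<dots> = {free_action a \<alpha> \<beta> f v}"
    by (rule image_constant [OF hecke.q_self])
  finally have "(\<lambda>g. free_action a \<alpha> \<beta> g v) ` ?C = {free_action a \<alpha> \<beta> f v}" .
  then show ?thesis
    by (simp add: SIT_module_def free_action_def)
qed

lemma left_module_SIT_module: "left_module (hecke (sum_list \<alpha> - sum_list \<beta>)) (SIT_module a \<alpha> \<beta>)"
proof (intro left_module.intro abelian_groupI left_module_axioms.intro)
  let ?M = "SIT_module a \<alpha> \<beta>"
  let ?N = "sum_list \<alpha> - sum_list \<beta>"
  show "ring (hecke ?N)"
    by (intro complex_algebra.axioms(1) complex_algebra_hecke)
  note cases = hecke.Q_cases [of _ ?N, folded hecke_eq, unfolded partial_object.simps]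
  note simps = smult_SIT_module keys_free_action free_action_linear free_action_mult hecke_coset_simps
  fix x y C C' assume xy: "x \<in> carrier (?M)" "y \<in> carrier (?M)"
    and C: "C \<in> carrier (hecke ?N)" and C': "C' \<in> carrier (hecke ?N)"
  obtain f where f: "keys f \<subseteq> lists {1..<?N}" "C = hecke_coset ?N f"
    using C by (rule cases)
  obtain f' where f': "keys f' \<subseteq> lists {1..<?N}" "C' = hecke_coset ?N f'"
    using C' by (rule cases)
  show "C \<odot>\<^bsub>?M\<^esub> x \<in> carrier (?M)"
    using xy f by (simp add: simps)
  show "(C \<oplus>\<^bsub>hecke ?N\<^esub> C') \<odot>\<^bsub>?M\<^esub> x =
      C \<odot>\<^bsub>?M\<^esub> x \<oplus>\<^bsub>?M\<^esub> C' \<odot>\<^bsub>?M\<^esub> x"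
    using xy f f' by (simp add: simps)
  show "C \<odot>\<^bsub>?M\<^esub> (x \<oplus>\<^bsub>?M\<^esub> y) =
      C \<odot>\<^bsub>?M\<^esub> x \<oplus>\<^bsub>?M\<^esub> C \<odot>\<^bsub>?M\<^esub> y"
    using xy f by (simp add: simps free_on_add)
  show "(C \<otimes>\<^bsub>hecke ?N\<^esub> C') \<odot>\<^bsub>?M\<^esub> x =
      C \<odot>\<^bsub>?M\<^esub> (C' \<odot>\<^bsub>?M\<^esub> x)"
  proof -
    have "C \<otimes>\<^bsub>hecke ?N\<^esub> C' = hecke_coset ?N (bilinear_ext (@) f f')"
      unfolding f(2) f'(2) by (rule hecke_coset_simps(3)) (use f f' in simp_all)
    then show ?thesis
      using xy f f' by (simp add: simps)
  qed
next
  let ?M = "SIT_module a \<alpha> \<beta>"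
  fix x assume "x \<in> carrier (?M)"
  then show "\<exists>y\<in>carrier (?M). y \<oplus>\<^bsub>?M\<^esub> x = \<zero>\<^bsub>?M\<^esub>"
    by (intro bexI [of _ "- x"]) auto
  show "\<one>\<^bsub>hecke (sum_list \<alpha> - sum_list \<beta>)\<^esub> \<odot>\<^bsub>?M\<^esub> x = x"
    if "x \<in> carrier (?M)" for x
    using that by (simp add: hecke_coset_simps smult_SIT_module)
qed (simp_all add: free_on_add ac_simps)

lemma smult_gen_SIT_module:
  assumes "keys v \<subseteq> SIT \<alpha> \<beta>" and "N = sum_list \<alpha> - sum_list \<beta>"
  shows "hecke_gen N i \<odot>\<^bsub>SIT_module a \<alpha> \<beta>\<^esub> v = linear_ext (pi_basis a \<alpha> \<beta> i) v"
  using assms by (simp add: hecke_gen_eq smult_SIT_module)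

text \<open>The complex structure that \<open>complex_space\<close> puts on the module is thus the
  one of the free space, so the tensor relations are the expected ones.\<close>

lemma smult_scalar_SIT_module:
  assumes "keys v \<subseteq> SIT \<alpha> \<beta>" and "N = sum_list \<alpha> - sum_list \<beta>"
  shows "(c \<odot>\<^bsub>hecke N\<^esub> \<one>\<^bsub>hecke N\<^esub>) \<odot>\<^bsub>SIT_module a \<alpha> \<beta>\<^esub> v = pm_smult c v"
  using assms by (simp add: hecke_coset_simps smult_SIT_module free_action_linear)

section \<open>Cutting and glueing tableaux\<close>

lemma diagram_Nil [simp]: "diagram [] = {}"
  by (auto simp: diagram_def)

lemma skew_diagram_Nil [simp]: "skew_diagram \<alpha> [] = diagram \<alpha>"
  by (simp add: skew_diagram_def)

lemma diagram_eq_Sigma: "diagram \<beta> = (SIGMA r:{1..length \<beta>}. {1..\<beta> ! (r - 1)})"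
  by (auto simp: diagram_def)

lemma finite_diagram: "finite (diagram \<beta>)"
  unfolding diagram_eq_Sigma by auto

lemma card_diagram: "card (diagram \<beta>) = sum_list \<beta>"
proof -
  have "card (diagram \<beta>) = (\<Sum>r\<in>{1..length \<beta>}. \<beta> ! (r - 1))"
    unfolding diagram_eq_Sigma by (subst card_SigmaI) auto
  also have "\<dots> = (\<Sum>r\<in>{0..<length \<beta>}. \<beta> ! r)"
    by (rule sum.reindex_bij_witness [of _ Suc "\<lambda>r. r - 1"]) auto
  finally show ?thesis
    by (simp add: sum_list_sum_nth)
qed

text \<open>Since parts are positive, each row of \<open>\<beta>\<close> has a last cell, and the
  position of this cell inside \<open>\<alpha>\<close> bounds the row.\<close>

lemma diagram_subset_iff:
  assumes "\<forall>p\<in>set \<beta>. 0 < p"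
  shows "diagram \<beta> \<subseteq> diagram \<alpha> \<longleftrightarrow> comp_subset \<beta> \<alpha>"
proof
  assume sub: "diagram \<beta> \<subseteq> diagram \<alpha>"
  have row: "j < length \<alpha> \<and> \<beta> ! j \<le> \<alpha> ! j" if "j < length \<beta>" for j
  proof -
    have "(Suc j, \<beta> ! j) \<in> diagram \<beta>"
      using that assms by (auto simp: diagram_def Suc_le_eq)
    then have "(Suc j, \<beta> ! j) \<in> diagram \<alpha>"
      using sub by blast
    then show ?thesis
      by (simp add: diagram_def)
  qed
  have "length \<beta> \<le> length \<alpha>"
    using row [of "length \<beta> - 1"] by (cases \<beta>) auto
  with row show "comp_subset \<beta> \<alpha>"
    by (simp add: comp_subset_def)
next
  assume sub: "comp_subset \<beta> \<alpha>"
  show "diagram \<beta> \<subseteq> diagram \<alpha>"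
  proof
    fix x assume "x \<in> diagram \<beta>"
    then obtain r c where x: "x = (r, c)" "1 \<le> r" "r \<le> length \<beta>" "1 \<le> c" "c \<le> \<beta> ! (r - 1)"
      by (auto simp: diagram_def)
    moreover have "\<beta> ! (r - 1) \<le> \<alpha> ! (r - 1)" "length \<beta> \<le> length \<alpha>"
      using sub x by (auto simp: comp_subset_def)
    ultimately show "x \<in> diagram \<alpha>"
      by (auto simp: diagram_def)
  qed
qed

lemma diagram_inject:
  assumes \<beta>: "\<forall>p\<in>set \<beta>. 0 < p" and \<gamma>: "\<forall>p\<in>set \<gamma>. 0 < p" and eq: "diagram \<beta> = diagram \<gamma>"
  shows "\<beta> = \<gamma>"
proof -
  have "comp_subset \<beta> \<gamma>" "comp_subset \<gamma> \<beta>"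
    using diagram_subset_iff [OF \<beta>] diagram_subset_iff [OF \<gamma>] eq by blast+
  then show ?thesis
    by (intro nth_equalityI) (auto simp: comp_subset_def intro: antisym)
qed

text \<open>Rows are initial segments, and positivity of the parts puts the first cell of every
  lower row into the diagram.\<close>

lemma diagram_precedes:
  assumes "\<forall>p\<in>set \<beta>. 0 < p" and "precedes x y" and "y \<in> diagram \<beta>" and "1 \<le> fst x" "1 \<le> snd x"
  shows "x \<in> diagram \<beta>"
  using assms by (cases x; cases y) (auto simp: precedes_def diagram_def Suc_le_eq)

lemma down_closed_eq_atLeastAtMost:
  fixes A :: "nat set"
  assumes "finite A" and "0 \<notin> A" and down: "\<And>x y. \<lbrakk>x \<in> A; 1 \<le> y; y \<le> x\<rbrakk> \<Longrightarrow> y \<in> A"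
  shows "A = {1..card A}"
proof (cases "A = {}")
  case False
  have "A = {1..Max A}"
  proof (intro equalityI subsetI)
    fix x assume "x \<in> A"
    then show "x \<in> {1..Max A}"
      using assms(1,2) by (cases x) auto
  next
    fix x assume "x \<in> {1..Max A}"
    then show "x \<in> A"
      using down [OF Max_in [OF assms(1) False]] by simp
  qed
  then show ?thesis
    by (metis card_atLeastAtMost diff_Suc_1)
qed simp

text \<open>The closure conditions make each row and the set of occupied rows initial segments, so
  the list of row lengths is the composition. The condition on column 1 prevents gaps between rows
  and hence zero parts.\<close>

lemma diagram_exists:
  assumes fin: "finite X" and pos: "\<And>r c. (r, c) \<in> X \<Longrightarrow> 1 \<le> r \<and> 1 \<le> c"
    and row: "\<And>r c c'. \<lbrakk>(r, c) \<in> X; 1 \<le> c'; c' \<le> c\<rbrakk> \<Longrightarrow> (r, c') \<in> X"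
    and col: "\<And>r r'. \<lbrakk>(r, 1) \<in> X; 1 \<le> r'; r' \<le> r\<rbrakk> \<Longrightarrow> (r', 1) \<in> X"
  shows "\<exists>\<beta>. (\<forall>p\<in>set \<beta>. 0 < p) \<and> diagram \<beta> = X"
proof -
  define R where "R = {r. (r, 1) \<in> X}"
  define C where "C r = {c. (r, c) \<in> X}" for r
  have "finite R"
    using finite_subset [of R "fst ` X"] fin by (force simp: R_def)
  moreover have "0 \<notin> R"
    using pos [of 0 1] by (auto simp: R_def)
  ultimately have R: "R = {1..card R}"
    by (rule down_closed_eq_atLeastAtMost) (unfold R_def mem_Collect_eq, rule col)
  have finC: "finite (C r)" for r
    using finite_subset [of "C r" "snd ` X"] fin by (force simp: C_def)
  moreover have "0 \<notin> C r" for r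
    using pos [of r 0] by (auto simp: C_def)
  ultimately have C: "C r = {1..card (C r)}" for r
    by (rule down_closed_eq_atLeastAtMost) (unfold C_def mem_Collect_eq, rule row)
  \<comment> \<open>List positions start at 0 and rows at 1, hence \<open>Suc\<close>.\<close>
  define \<beta> where "\<beta> = map (\<lambda>r. card (C (Suc r))) [0..<card R]"
  have "0 < card (C r)" if "r \<in> R" for r
    using that finC by (auto simp: card_gt_0_iff C_def R_def)
  moreover have "Suc r \<in> R" if "r < card R" for r
    by (subst R) (use that in simp)
  ultimately have "0 < card (C (Suc r))" if "r < card R" for r
    using that by blast
  then have "\<forall>p\<in>set \<beta>. 0 < p"
    by (auto simp: \<beta>_def)
  moreover have "(r, c) \<in> diagram \<beta> \<longleftrightarrow> (r, c) \<in> X" for r c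
  proof -
    have "(r, c) \<in> diagram \<beta> \<longleftrightarrow> r \<in> {1..card R} \<and> c \<in> {1..card (C r)}"
      by (cases r) (auto simp: diagram_def \<beta>_def)
    also have "\<dots> \<longleftrightarrow> r \<in> R \<and> c \<in> C r"
      by (simp only: R [symmetric] C [symmetric])
    also have "\<dots> \<longleftrightarrow> (r, c) \<in> X"
      using pos row [of r c 1] by (auto simp: R_def C_def)
    finally show ?thesis .
  qed
  ultimately show ?thesis
    by (intro exI [of _ \<beta>]) auto
qed

section \<open>Splitting a filling at m\<close>

definition low_part :: "nat \<Rightarrow> filling \<Rightarrow> filling"
  where "low_part m T = (\<lambda>x. if T x \<le> m then T x else 0)"

text \<open>The truncated subtraction turns all entries \<open>\<le> m\<close> into the dummy value \<open>0\<close>.\<close>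

definition high_part :: "nat \<Rightarrow> filling \<Rightarrow> filling"
  where "high_part m T = (\<lambda>x. T x - m)"

text \<open>The dummy value \<open>0\<close> of \<open>U\<close> marks the cells outside the skew
  diagram, where the lower filling takes over.\<close>

definition glue :: "nat \<Rightarrow> filling \<Rightarrow> filling \<Rightarrow> filling"
  where "glue m T U = (\<lambda>x. if U x = 0 then T x else U x + m)"

definition low_cells :: "nat \<Rightarrow> filling \<Rightarrow> (nat \<times> nat) set"
  where "low_cells m T = {x. 0 < T x \<and> T x \<le> m}"

lemma glue_low_high [simp]: "glue m (low_part m T) (high_part m T) = T"
  by (auto simp: glue_def low_part_def high_part_def)

lemma cell_of_low_part: "\<lbrakk>1 \<le> k; k \<le> m\<rbrakk> \<Longrightarrow> cell_of (low_part m T) k = cell_of T k"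
  unfolding cell_of_def low_part_def by (rule arg_cong [of _ _ The]) auto

text \<open>For \<open>k \<ge> 1\<close> truncation is invisible: a difference with \<open>m\<close>
  equals \<open>k\<close> iff the entry is \<open>k + m\<close>.\<close>

lemma cell_of_high_part: "1 \<le> k \<Longrightarrow> cell_of (high_part m T) k = cell_of T (k + m)"
  unfolding cell_of_def high_part_def by (rule arg_cong [of _ _ The]) auto

text \<open>With \<open>i < m\<close> both switched entries are at most \<open>m\<close>. In
  \<open>swap_high\<close> both exceed \<open>m\<close>. Only the switch of \<open>m\<close> with
  \<open>m + 1\<close> would cross the cut.\<close>

lemma swap_low:
  assumes "1 \<le> i" "i < m"
  shows "low_part m (swap_entries i T) = swap_entries i (low_part m T)"
    and "high_part m (swap_entries i T) = high_part m T"
    and "low_cells m (swap_entries i T) = low_cells m T"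
  using assms
  by (auto simp: low_part_def high_part_def low_cells_def swap_entries_def fun_eq_iff
      Transposition.transpose_def)

lemma swap_high:
  assumes "1 \<le> i"
  shows "low_part m (swap_entries (i + m) T) = low_part m T"
    and "high_part m (swap_entries (i + m) T) = swap_entries i (high_part m T)"
    and "low_cells m (swap_entries (i + m) T) = low_cells m T"
  using assms
  by (auto simp: low_part_def high_part_def low_cells_def swap_entries_def fun_eq_iff
      Transposition.transpose_def)

section \<open>The bijection between tableaux and pairs of tableaux\<close>

locale composition_cut =
  fixes \<alpha> :: "nat list" and n m :: nat
  assumes \<alpha>: "composition n \<alpha>" and mn: "m \<le> n"
begin

definition lower :: "nat list set"
  where "lower = {\<beta>. composition m \<beta> \<and> comp_subset \<beta> \<alpha>}"

lemma sum_\<alpha> [simp]: "sum_list \<alpha> = n"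
  using \<alpha> by (simp add: composition_def)

lemma lowerD:
  assumes "\<beta> \<in> lower"
  shows "\<forall>p\<in>set \<beta>. 0 < p" "sum_list \<beta> = m" "diagram \<beta> \<subseteq> diagram \<alpha>"
    "\<gamma> \<in> lower \<Longrightarrow> diagram \<gamma> = diagram \<beta> \<longleftrightarrow> \<gamma> = \<beta>"
proof -
  show pos: "\<forall>p\<in>set \<beta>. 0 < p" and "sum_list \<beta> = m"
    using assms by (auto simp: lower_def composition_def)
  show "diagram \<beta> \<subseteq> diagram \<alpha>"
    using assms diagram_subset_iff [OF pos] by (simp add: lower_def)
  show "diagram \<gamma> = diagram \<beta> \<longleftrightarrow> \<gamma> = \<beta>" if "\<gamma> \<in> lower"
    using diagram_inject [of \<gamma> \<beta>] that pos by (auto simp: lower_def composition_def)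
qed

lemma finite_lower: "finite lower"
proof (rule finite_subset)
  show "lower \<subseteq> {\<beta>. set \<beta> \<subseteq> {..m} \<and> length \<beta> \<le> length \<alpha>}"
    using member_le_sum_list by (fastforce simp: lower_def composition_def comp_subset_def)
  show "finite {\<beta>. set \<beta> \<subseteq> {..m} \<and> length \<beta> \<le> length \<alpha>}"
    by (rule finite_lists_length_le) simp
qed

lemma bij_low_cells:
  assumes T: "T \<in> SIT \<alpha> []"
  shows "low_cells m T \<subseteq> diagram \<alpha>" "bij_betw T (low_cells m T) {1..m}"
    "bij_betw T (diagram \<alpha> - low_cells m T) {m + 1..n}"
proof -
  have bij: "bij_betw T (diagram \<alpha>) {1..n}"
    using SIT_bij [OF T] by simp
  show sub: "low_cells m T \<subseteq> diagram \<alpha>"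
    using SIT_pos_iff [OF T] by (auto simp: low_cells_def)
  have surj: "T ` diagram \<alpha> = {1..n}"
    by (rule bij_betw_imp_surj_on [OF bij])
  have "T ` low_cells m T = {1..m}"
  proof
    show "T ` low_cells m T \<subseteq> {1..m}"
      by (auto simp: low_cells_def)
    show "{1..m} \<subseteq> T ` low_cells m T"
    proof
      fix k assume k: "k \<in> {1..m}"
      then have "k \<in> T ` diagram \<alpha>"
        using surj mn by auto
      then show "k \<in> T ` low_cells m T"
        using k by (auto simp: low_cells_def)
    qed
  qed
  then show low: "bij_betw T (low_cells m T) {1..m}"
    by (rule bij_betw_subset [OF bij sub])
  have "bij_betw T (diagram \<alpha> - low_cells m T) ({1..n} - {1..m})"
    using bij_betw_DiffI [OF bij low sub] mn by auto
  moreover have "{1..n} - {1..m} = {m + 1..n}"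
    by auto
  ultimately show "bij_betw T (diagram \<alpha> - low_cells m T) {m + 1..n}"
    by (simp only:)
qed

text \<open>Entries increase along \<open>precedes\<close>, so the cells with entries at most
  \<open>m\<close> are closed under predecessors within \<open>\<alpha>\<close> and form a diagram.
  It has \<open>m\<close> cells because the tableau maps them bijectively onto
  \<open>{1..m}\<close>.\<close>

lemma cut_exists:
  assumes T: "T \<in> SIT \<alpha> []"
  shows "\<exists>\<beta>\<in>lower. diagram \<beta> = low_cells m T"
proof -
  have down: "x \<in> low_cells m T" if "y \<in> low_cells m T" "x \<in> diagram \<alpha>" "precedes x y" for x y
  proof -
    have "y \<in> diagram \<alpha>"
      using that bij_low_cells(1) [OF T] by blast
    then show ?thesis
      using SIT_mono [OF T, of x y] SIT_pos_iff [OF T, of x] that by (simp add: low_cells_def)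
  qed
  have "\<exists>\<beta>. (\<forall>p\<in>set \<beta>. 0 < p) \<and> diagram \<beta> = low_cells m T"
  proof (rule diagram_exists)
    show "finite (low_cells m T)"
      using bij_low_cells(1) [OF T] finite_diagram by (rule finite_subset)
    show "1 \<le> r \<and> 1 \<le> c" if "(r, c) \<in> low_cells m T" for r c
      using that bij_low_cells(1) [OF T] by (auto simp: diagram_def)
    show "(r, c') \<in> low_cells m T" if "(r, c) \<in> low_cells m T" "1 \<le> c'" "c' \<le> c" for r c c'
    proof (cases "c' = c")
      case False
      have "(r, c) \<in> diagram \<alpha>"
        using that bij_low_cells(1) [OF T] by blast
      then show ?thesis
        by (intro down [OF that(1)]) (use that False in \<open>auto simp: diagram_def precedes_def\<close>)
    qed (use that in simp)
    show "(r', 1) \<in> low_cells m T" if "(r, 1) \<in> low_cells m T" "1 \<le> r'" "r' \<le> r" for r r'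
    proof (cases "r' = r")
      case False
      have "(r, 1) \<in> diagram \<alpha>"
        using that bij_low_cells(1) [OF T] by blast
      \<comment> \<open>The first cell of every lower row lies in \<open>\<alpha>\<close> because
        the parts of \<open>\<alpha>\<close> are positive.\<close>
      moreover have "0 < \<alpha> ! (r' - 1)" if "r' \<le> length \<alpha>" "1 \<le> r'"
        using \<alpha> that by (simp add: composition_def)
      ultimately show ?thesis
        by (intro down [OF that(1)]) (use that False in \<open>auto simp: diagram_def precedes_def Suc_le_eq\<close>)
    qed (use that in simp)
  qed
  then obtain \<beta> where \<beta>: "\<forall>p\<in>set \<beta>. 0 < p" "diagram \<beta> = low_cells m T"
    by blast
  have "sum_list \<beta> = m"
    using bij_betw_same_card [OF bij_low_cells(2) [OF T]] card_diagram [of \<beta>] \<beta>(2) by simp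
  then have "\<beta> \<in> lower"
    using \<beta> bij_low_cells(1) [OF T] diagram_subset_iff [OF \<beta>(1), of \<alpha>]
    by (simp add: lower_def composition_def)
  with \<beta> show ?thesis
    by blast
qed

lemma low_part_SIT:
  assumes T: "T \<in> SIT \<alpha> []" and \<beta>: "\<beta> \<in> lower" "diagram \<beta> = low_cells m T"
  shows "low_part m T \<in> SIT \<beta> []"
proof -
  have eq: "low_part m T x = T x" if "x \<in> diagram \<beta>" for x
    using that \<beta> by (simp add: low_part_def low_cells_def)
  have "bij_betw (low_part m T) (diagram \<beta>) {1..m}"
    using bij_low_cells(2) [OF T] bij_betw_cong [of "diagram \<beta>" "low_part m T" T "{1..m}"] eq
    unfolding \<beta>(2) [symmetric] by blast
  moreover have "low_part m T x = 0" if "x \<notin> diagram \<beta>" for x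
    using that \<beta>(2) by (auto simp: low_part_def low_cells_def)
  moreover have "low_part m T x < low_part m T y"
    if "x \<in> diagram \<beta>" "y \<in> diagram \<beta>" "precedes x y" for x y
    using SIT_mono [OF T, of x y] that lowerD(3) [OF \<beta>(1)] by (auto simp: eq)
  ultimately show ?thesis
    unfolding SIT_iff skew_diagram_Nil lowerD(2) [OF \<beta>(1)] sum_list.Nil diff_zero by blast
qed

lemma high_part_SIT:
  assumes T: "T \<in> SIT \<alpha> []" and \<beta>: "\<beta> \<in> lower" "diagram \<beta> = low_cells m T"
  shows "high_part m T \<in> SIT \<alpha> \<beta>"
proof -
  have skew: "skew_diagram \<alpha> \<beta> = diagram \<alpha> - low_cells m T"
    by (simp add: skew_diagram_def \<beta>(2))
  have "bij_betw (\<lambda>k. k - m) {m + 1..n} {1..n - m}"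
    by (rule bij_betw_byWitness [where f' = "\<lambda>k. k + m"]) (use mn in auto)
  then have "bij_betw (high_part m T) (skew_diagram \<alpha> \<beta>) {1..n - m}"
    using bij_betw_trans [OF bij_low_cells(3) [OF T]] by (simp add: skew high_part_def comp_def)
  moreover have "high_part m T x = 0" if "x \<notin> skew_diagram \<alpha> \<beta>" for x
    using that SIT_outside [OF T, of x] by (auto simp: skew high_part_def low_cells_def)
  moreover have "high_part m T x < high_part m T y"
    if "x \<in> skew_diagram \<alpha> \<beta>" "y \<in> skew_diagram \<alpha> \<beta>" "precedes x y" for x y
  proof -
    \<comment> \<open>The smaller of the two entries already exceeds \<open>m\<close>, so the
      truncated subtraction preserves the strict inequality.\<close>
    have "x \<in> diagram \<alpha>" "y \<in> diagram \<alpha>" "\<not> T x \<le> m"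
      using that SIT_pos_iff [OF T, of x] by (auto simp: skew low_cells_def)
    then show ?thesis
      using SIT_mono [OF T, of x y] that(3) by (simp add: high_part_def)
  qed
  ultimately show ?thesis
    unfolding SIT_iff lowerD(2) [OF \<beta>(1)] sum_\<alpha> by blast
qed

context
  fixes \<beta> :: "nat list" and T U :: filling
  assumes \<beta>: "\<beta> \<in> lower" and T: "T \<in> SIT \<beta> []" and U: "U \<in> SIT \<alpha> \<beta>"
begin

lemma glue_low: "x \<in> diagram \<beta> \<Longrightarrow> glue m T U x = T x"
  using SIT_outside [OF U, of x] by (simp add: glue_def skew_diagram_def)

lemma glue_high: "x \<in> skew_diagram \<alpha> \<beta> \<Longrightarrow> glue m T U x = U x + m"
  using SIT_pos_iff [OF U, of x] by (simp add: glue_def)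

lemma low_part_glue: "low_part m (glue m T U) = T"
proof
  fix x show "low_part m (glue m T U) x = T x"
    using SIT_le [OF T, of x] SIT_pos_iff [OF U, of x] SIT_outside [OF T, of x]
    by (auto simp: low_part_def glue_def lowerD(2) [OF \<beta>] skew_diagram_def)
qed

lemma high_part_glue: "high_part m (glue m T U) = U"
proof
  fix x show "high_part m (glue m T U) x = U x"
    using SIT_le [OF T, of x] by (auto simp: high_part_def glue_def lowerD(2) [OF \<beta>])
qed

lemma low_cells_glue: "low_cells m (glue m T U) = diagram \<beta>"
proof (intro equalityI subsetI)
  fix x assume "x \<in> low_cells m (glue m T U)"
  then have "0 < T x"
    by (auto simp: low_cells_def glue_def split: if_splits)
  then show "x \<in> diagram \<beta>"
    using SIT_pos_iff [OF T, of x] by simp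
next
  fix x assume "x \<in> diagram \<beta>"
  then show "x \<in> low_cells m (glue m T U)"
    using glue_low [of x] SIT_pos_iff [OF T, of x] SIT_le [OF T, of x]
    by (simp add: low_cells_def lowerD(2) [OF \<beta>])
qed

text \<open>For a pair in the relation \<open>precedes\<close>, an upper cell never comes before a
  lower one since the diagram of \<open>\<beta>\<close> is closed under predecessors. In the mixed
  case entries at most \<open>m\<close> meet entries above \<open>m\<close>.\<close>

lemma glue_SIT: "glue m T U \<in> SIT \<alpha> []"
proof -
  have eq: "diagram \<alpha> = diagram \<beta> \<union> skew_diagram \<alpha> \<beta>" "{1..n} = {1..m} \<union> {m + 1..n}"
    using lowerD(3) [OF \<beta>] mn by (auto simp: skew_diagram_def)
  have "bij_betw (\<lambda>k. k + m) {1..n - m} {m + 1..n}"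
    by (rule bij_betw_byWitness [where f' = "\<lambda>k. k - m"]) (use mn in auto)
  then have "bij_betw (\<lambda>x. U x + m) (skew_diagram \<alpha> \<beta>) {m + 1..n}"
    using bij_betw_trans [OF SIT_bij [OF U]] by (simp add: comp_def lowerD(2) [OF \<beta>])
  then have "bij_betw (glue m T U) (skew_diagram \<alpha> \<beta>) {m + 1..n}"
    using bij_betw_cong [of "skew_diagram \<alpha> \<beta>" "glue m T U" "\<lambda>x. U x + m"] glue_high by blast
  moreover have "bij_betw (glue m T U) (diagram \<beta>) {1..m}"
    using bij_betw_cong [of "diagram \<beta>" "glue m T U" T] glue_low SIT_bij [OF T]
    by (simp add: lowerD(2) [OF \<beta>])
  ultimately have "bij_betw (glue m T U) (diagram \<alpha>) {1..n}"
    unfolding eq by (intro bij_betw_combine) auto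
  moreover have "glue m T U x = 0" if "x \<notin> diagram \<alpha>" for x
  proof -
    have "x \<notin> diagram \<beta>" "x \<notin> skew_diagram \<alpha> \<beta>"
      using that eq by auto
    then show ?thesis
      using SIT_outside [OF T, of x] SIT_outside [OF U, of x] by (simp add: glue_def)
  qed
  moreover have "glue m T U x < glue m T U y"
    if xy: "x \<in> diagram \<alpha>" "y \<in> diagram \<alpha>" "precedes x y" for x y
  proof -
    have "1 \<le> fst x" "1 \<le> snd x"
      using xy(1) by (auto simp: diagram_def)
    then have "x \<in> diagram \<beta>" if "y \<in> diagram \<beta>"
      using diagram_precedes [OF lowerD(1) [OF \<beta>] xy(3) that] by simp
    then consider "x \<in> diagram \<beta>" "y \<in> diagram \<beta>" | "x \<in> diagram \<beta>" "y \<in> skew_diagram \<alpha> \<beta>"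
      | "x \<in> skew_diagram \<alpha> \<beta>" "y \<in> skew_diagram \<alpha> \<beta>"
      using xy eq by blast
    then show ?thesis
    proof cases
      case 1
      then show ?thesis
        using SIT_mono [OF T, of x y] xy(3) by (simp add: glue_low)
    next
      case 2
      then show ?thesis
        using SIT_le [OF T, of x] SIT_pos_iff [OF U, of y]
        by (simp add: glue_low glue_high lowerD(2) [OF \<beta>])
    next
      case 3
      then show ?thesis
        using SIT_mono [OF U, of x y] xy(3) by (simp add: glue_high)
    qed
  qed
  ultimately show ?thesis
    unfolding SIT_iff skew_diagram_Nil sum_\<alpha> sum_list.Nil diff_zero by blast
qed

end

text \<open>Shaped for proving equivariance: either both sides vanish, or both lead to one tableau
  \<open>T'\<close>. Unchanged low cells mean that the summand stays the same, and the unchanged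
  upper part means that the second tensor factor is untouched.\<close>

lemma pi_basis_low:
  assumes T: "T \<in> SIT \<alpha> []" and \<beta>: "\<beta> \<in> lower" "diagram \<beta> = low_cells m T"
    and i: "1 \<le> i" "i < m"
  shows "pi_basis a \<alpha> [] i T = 0 \<and> pi_basis a \<beta> [] i (low_part m T) = 0 \<or>
    (\<exists>T'\<in>SIT \<alpha> []. pi_basis a \<alpha> [] i T = basis_vec T' \<and>
      pi_basis a \<beta> [] i (low_part m T) = basis_vec (low_part m T') \<and>
      high_part m T' = high_part m T \<and> low_cells m T' = low_cells m T)"
proof -
  have i': "i < sum_list \<alpha> - sum_list []" "i < sum_list \<beta> - sum_list []"
    using i mn lowerD(2) [OF \<beta>(1)] by simp_all
  let ?x = "cell_of T i" and ?y = "cell_of T (i + 1)"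
  have cells: "cell_of (low_part m T) i = ?x" "cell_of (low_part m T) (i + 1) = ?y"
    using i by (simp_all add: cell_of_low_part)
  note eqs = pi_basis_eq [OF T i(1) i'(1)] pi_basis_eq [OF low_part_SIT [OF T \<beta>] i(1) i'(2), unfolded cells]
  consider "\<not> row_condition a (fst ?x) (fst ?y)" | "row_condition a (fst ?x) (fst ?y)" "conflict ?x ?y"
    | "row_condition a (fst ?x) (fst ?y)" "\<not> conflict ?x ?y"
    by blast
  then show ?thesis
  proof cases
    case 1
    then show ?thesis
      unfolding eqs using T by (intro disjI2 bexI [of _ T]) simp_all
  next
    case 2
    then show ?thesis
      unfolding eqs by (intro disjI1) simp
  next
    case 3
    then show ?thesis
      unfolding eqs using swap_low [OF i, of T] swap_SIT_iff [OF T i(1) i'(1)]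
      by (intro disjI2 bexI [of _ "swap_entries i T"]) simp_all
  qed
qed

lemma pi_basis_high:
  assumes T: "T \<in> SIT \<alpha> []" and \<beta>: "\<beta> \<in> lower" "diagram \<beta> = low_cells m T"
    and i: "1 \<le> i" "i < n - m"
  shows "pi_basis a \<alpha> [] (i + m) T = 0 \<and> pi_basis a \<alpha> \<beta> i (high_part m T) = 0 \<or>
    (\<exists>T'\<in>SIT \<alpha> []. pi_basis a \<alpha> [] (i + m) T = basis_vec T' \<and>
      pi_basis a \<alpha> \<beta> i (high_part m T) = basis_vec (high_part m T') \<and>
      low_part m T' = low_part m T \<and> low_cells m T' = low_cells m T)"
proof -
  have i': "1 \<le> i + m" "i + m < sum_list \<alpha> - sum_list []" "i < sum_list \<alpha> - sum_list \<beta>"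
    using i mn lowerD(2) [OF \<beta>(1)] by simp_all
  let ?x = "cell_of T (i + m)" and ?y = "cell_of T (i + m + 1)"
  have cells: "cell_of (high_part m T) i = ?x" "cell_of (high_part m T) (i + 1) = ?y"
    using i by (simp_all add: cell_of_high_part)
  note eqs = pi_basis_eq [OF T i'(1,2)] pi_basis_eq [OF high_part_SIT [OF T \<beta>] i(1) i'(3), unfolded cells]
  consider "\<not> row_condition a (fst ?x) (fst ?y)" | "row_condition a (fst ?x) (fst ?y)" "conflict ?x ?y"
    | "row_condition a (fst ?x) (fst ?y)" "\<not> conflict ?x ?y"
    by blast
  then show ?thesis
  proof cases
    case 1
    then show ?thesis
      unfolding eqs using T by (intro disjI2 bexI [of _ T]) simp_all
  next
    case 2
    then show ?thesis
      unfolding eqs by (intro disjI1) simp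
  next
    case 3
    then show ?thesis
      unfolding eqs using swap_high [OF i(1), of m T] swap_SIT_iff [OF T i'(1,2)]
      by (intro disjI2 bexI [of _ "swap_entries (i + m) T"]) simp_all
  qed
qed

section \<open>Restriction to the tensor product\<close>

context
  fixes a :: variant
begin

abbreviation "low_module \<beta> \<equiv> SIT_module a \<beta> []"
abbreviation "high_module \<beta> \<equiv> SIT_module a \<alpha> \<beta>"
abbreviation "low_high \<beta> \<equiv> tensor_module (hecke m) (hecke (n - m)) (low_module \<beta>) (high_module \<beta>)"
abbreviation "relations \<beta> \<equiv> tensor_relations
  (complex_space (hecke m) (low_module \<beta>)) (complex_space (hecke (n - m)) (high_module \<beta>))"
abbreviation "pairs \<beta> \<equiv> free_on (SIT \<beta> []) \<times> free_on (SIT \<alpha> \<beta>)"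

text \<open>The component of cutting in the summand of \<open>\<beta>\<close>. The outer
  \<open>basis_vec\<close> lives in the free space above the tensor product, whose basis consists of
  all pairs of module vectors; the inner ones are such vectors.\<close>

definition cut_basis :: "nat list \<Rightarrow> filling \<Rightarrow> (filling \<Rightarrow>\<^sub>0 complex) \<times> (filling \<Rightarrow>\<^sub>0 complex) \<Rightarrow>\<^sub>0 complex"
  where "cut_basis \<beta> T =
    (if diagram \<beta> = low_cells m T then basis_vec (basis_vec (low_part m T), basis_vec (high_part m T)) else 0)"

text \<open>Glueing has to be defined on pairs of arbitrary vectors, not only of tableaux, and
  bilinearly, in order to descend to the tensor product.\<close>

definition glue_pairs :: "((filling \<Rightarrow>\<^sub>0 complex) \<times> (filling \<Rightarrow>\<^sub>0 complex) \<Rightarrow>\<^sub>0 complex) \<Rightarrow> filling \<Rightarrow>\<^sub>0 complex"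
  where "glue_pairs = linear_ext (\<lambda>(u, v). bilinear_ext (glue m) u v)"

lemma SIT_left_modules:
  "left_module (hecke n) (SIT_module a \<alpha> [])"
  "\<beta> \<in> lower \<Longrightarrow> left_module (hecke m) (low_module \<beta>)"
  "\<beta> \<in> lower \<Longrightarrow> left_module (hecke (n - m)) (high_module \<beta>)"
  using left_module_SIT_module [of \<alpha> "[]" a] left_module_SIT_module [of \<beta> "[]" a]
    left_module_SIT_module [of \<alpha> \<beta> a] lowerD(2) [of \<beta>] by simp_all

lemma tensor_modules_lower:
  "\<beta> \<in> lower \<Longrightarrow> tensor_modules (hecke m) (hecke (n - m)) (low_module \<beta>) (high_module \<beta>)"
  by (intro tensor_modules.intro algebra_pair.intro complex_algebra_hecke SIT_left_modules)

lemma relations_mem: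
  assumes "\<beta> \<in> lower" and u: "keys u \<subseteq> SIT \<beta> []" and v: "keys v \<subseteq> SIT \<alpha> \<beta>"
  shows "keys u' \<subseteq> SIT \<beta> [] \<Longrightarrow>
      basis_vec (u + u', v) - basis_vec (u, v) - basis_vec (u', v) \<in> relations \<beta>"
    and "keys v' \<subseteq> SIT \<alpha> \<beta> \<Longrightarrow>
      basis_vec (u, v + v') - basis_vec (u, v) - basis_vec (u, v') \<in> relations \<beta>"
    and "basis_vec (pm_smult c u, v) - pm_smult c (basis_vec (u, v)) \<in> relations \<beta>"
    and "basis_vec (u, pm_smult c v) - pm_smult c (basis_vec (u, v)) \<in> relations \<beta>"
    and "basis_vec (0, v) \<in> relations \<beta>" and "basis_vec (u, 0) \<in> relations \<beta>"
proof -
  let ?U = "complex_space (hecke m) (low_module \<beta>)" and ?V = "complex_space (hecke (n - m)) (high_module \<beta>)"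
  show "basis_vec (u + u', v) - basis_vec (u, v) - basis_vec (u', v) \<in> relations \<beta>"
    if "keys u' \<subseteq> SIT \<beta> []"
    using tensor_relations_base(1) [of u ?U u' v ?V] u v that by simp
  show "basis_vec (u, v + v') - basis_vec (u, v) - basis_vec (u, v') \<in> relations \<beta>"
    if "keys v' \<subseteq> SIT \<alpha> \<beta>"
    using tensor_relations_base(2) [of u ?U v ?V v'] u v that by simp
  show left: "basis_vec (pm_smult c u, v) - pm_smult c (basis_vec (u, v)) \<in> relations \<beta>" for c
    using tensor_relations_base(3) [of u ?U v ?V c] u v lowerD(2) [OF assms(1)]
    by (simp add: smult_scalar_SIT_module)
  show right: "basis_vec (u, pm_smult c v) - pm_smult c (basis_vec (u, v)) \<in> relations \<beta>" for c
    using tensor_relations_base(4) [of u ?U v ?V c] u v lowerD(2) [OF assms(1)]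
    by (simp add: smult_scalar_SIT_module)
  show "basis_vec (0, v) \<in> relations \<beta>" "basis_vec (u, 0) \<in> relations \<beta>"
    \<comment> \<open>Pairs with a zero component are basis vectors of the covering space; they
      become relations by scaling with 0.\<close>
    using left [of 0] right [of 0] by simp_all
qed

lemmas relations_subspace = subspace_tensor_relations
  [of "complex_space (hecke m) (low_module \<beta>)" "complex_space (hecke (n - m)) (high_module \<beta>)" for \<beta>]

lemmas relations_zero = pm.subspace_0 [OF relations_subspace]

lemma glue_pairs_linear:
  "glue_pairs (h + h') = glue_pairs h + glue_pairs h'"
  "glue_pairs (h - h') = glue_pairs h - glue_pairs h'"
  "glue_pairs (pm_smult c h) = pm_smult c (glue_pairs h)"
  "glue_pairs 0 = 0" "glue_pairs (basis_vec (u, v)) = bilinear_ext (glue m) u v"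
  by (simp_all add: glue_pairs_def linear_ext_linear)

text \<open>A bilinear map kills the tensor relations. Hence glueing has a well-defined value on
  each coset.\<close>

lemma glue_pairs_relations:
  assumes "\<beta> \<in> lower" and h: "h \<in> relations \<beta>"
  shows "glue_pairs h = 0"
proof -
  have "glue_pairs h \<in> {0}"
    unfolding glue_pairs_def using h
    by (rule linear_ext_tensor_relations [OF _ pm.subspace_single_0])
      (simp_all add: bilinear_ext_linear smult_scalar_SIT_module lowerD(2) [OF assms(1)])
  then show ?thesis
    by simp
qed

lemma keys_glue_pairs:
  assumes \<beta>: "\<beta> \<in> lower" and h: "keys h \<subseteq> pairs \<beta>"
  shows "keys (glue_pairs h) \<subseteq> SIT \<alpha> []"
  unfolding glue_pairs_def
proof (rule keys_linear_ext)
  fix x assume "x \<in> keys h"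
  then have "x \<in> pairs \<beta>"
    using h by blast
  then obtain u v where x: "x = (u, v)" "keys u \<subseteq> SIT \<beta> []" "keys v \<subseteq> SIT \<alpha> \<beta>"
    by blast
  have "keys (bilinear_ext (glue m) u v) \<subseteq> SIT \<alpha> []"
    by (rule keys_bilinear_ext, rule glue_SIT [OF \<beta>]) (use x(2,3) in blast)+
  then show "keys (case x of (u, v) \<Rightarrow> bilinear_ext (glue m) u v) \<subseteq> SIT \<alpha> []"
    by (simp add: x(1))
qed

lemma keys_cut:
  assumes \<beta>: "\<beta> \<in> lower" and x: "keys x \<subseteq> SIT \<alpha> []"
  shows "keys (linear_ext (cut_basis \<beta>) x) \<subseteq> pairs \<beta>"
proof (rule keys_linear_ext)
  fix T assume "T \<in> keys x"
  then have "T \<in> SIT \<alpha> []"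
    using x by blast
  then show "keys (cut_basis \<beta> T) \<subseteq> pairs \<beta>"
    using low_part_SIT [of T \<beta>] high_part_SIT [of T \<beta>] \<beta> by (simp add: cut_basis_def)
qed

lemma cut_basis_glue:
  assumes "\<beta> \<in> lower" "\<gamma> \<in> lower" "T \<in> SIT \<beta> []" "U \<in> SIT \<alpha> \<beta>"
  shows "cut_basis \<gamma> (glue m T U) = (if \<beta> = \<gamma> then basis_vec (basis_vec T, basis_vec U) else 0)"
  using assms lowerD(4) [of \<beta> \<gamma>]
  by (auto simp: cut_basis_def low_cells_glue low_part_glue high_part_glue)

lemma cut_glue_neq:
  assumes "\<beta> \<in> lower" "\<gamma> \<in> lower" "\<beta> \<noteq> \<gamma>" and h: "keys h \<subseteq> pairs \<beta>"
  shows "linear_ext (cut_basis \<gamma>) (glue_pairs h) = 0"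
  using h
proof (induction h rule: free_on_induct)
  case (basis x)
  then obtain u v where x: "x = (u, v)" and u: "keys u \<subseteq> SIT \<beta> []"
    and v: "keys v \<subseteq> SIT \<alpha> \<beta>"
    by blast
  have "linear_ext (cut_basis \<gamma>) (bilinear_ext (glue m) u v) = 0"
    using u
  proof (induction u rule: free_on_induct)
    case (basis T)
    show ?case
      using v by (induction v rule: free_on_induct)
        (use assms basis in \<open>simp_all add: bilinear_ext_linear linear_ext_linear cut_basis_glue\<close>)
  qed (simp_all add: bilinear_ext_linear linear_ext_linear)
  then show ?case
    by (simp add: x glue_pairs_linear)
qed (simp_all add: glue_pairs_linear linear_ext_linear)

text \<open>Equality can hold only modulo the relations: \<open>h\<close> may involve pairs of
  arbitrary vectors, while cutting returns combinations of pairs of tableaux. The relations are what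
  expands a general pair into the latter.\<close>

lemma cut_glue:
  assumes \<beta>: "\<beta> \<in> lower" and h: "keys h \<subseteq> pairs \<beta>"
  shows "linear_ext (cut_basis \<beta>) (glue_pairs h) - h \<in> relations \<beta>"
proof -
  let ?q = "lin_coset (relations \<beta>)"
  have q_eq: "?q f = ?q g \<longleftrightarrow> f - g \<in> relations \<beta>" for f g
    by (rule lin_coset_eq_iff [OF relations_subspace])
  have q_add: "?q (f + g) = ?q (f' + g')" if "?q f = ?q f'" "?q g = ?q g'" for f g f' g'
    using that pm.subspace_add [OF relations_subspace, of "f - f'" \<beta> "g - g'"]
    by (simp add: q_eq algebra_simps)
  have q_smult: "?q (pm_smult c f) = ?q (pm_smult c f')" if "?q f = ?q f'" for c f f'
    using that pm.subspace_scale [OF relations_subspace, of "f - f'" \<beta> c]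
    by (simp add: q_eq pm.scale_right_diff_distrib)
  have pair: "?q (linear_ext (cut_basis \<beta>) (bilinear_ext (glue m) u v)) = ?q (basis_vec (u, v))"
    if u: "keys u \<subseteq> SIT \<beta> []" and v: "keys v \<subseteq> SIT \<alpha> \<beta>" for u v
    using u
  proof (induction u rule: free_on_induct)
    case zero
    have "?q (basis_vec (0, v)) = ?q 0"
      unfolding q_eq using relations_mem(5) [OF \<beta> _ v, of 0] by simp
    then show ?case
      by (simp only: bilinear_ext_zero linear_ext_zero)
  next
    case (add u u')
    have "?q (basis_vec (u + u', v)) = ?q (basis_vec (u, v) + basis_vec (u', v))"
      unfolding q_eq using relations_mem(1) [OF \<beta> add(1) v add(2)] by (simp add: diff_diff_eq)
    then show ?case
      using q_add [OF add(3,4)]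
      by (simp only: bilinear_ext_linear linear_ext_linear)
  next
    case (smult c u)
    have "?q (basis_vec (pm_smult c u, v)) = ?q (pm_smult c (basis_vec (u, v)))"
      unfolding q_eq by (rule relations_mem(3) [OF \<beta> smult(1) v])
    then show ?case
      using q_smult [OF smult(2)]
      by (simp only: bilinear_ext_linear linear_ext_linear)
  next
    case (basis T)
    then have T: "keys (basis_vec T) \<subseteq> SIT \<beta> []"
      by simp
    show ?case
      using v
    proof (induction v rule: free_on_induct)
      case zero
      have "?q (basis_vec (basis_vec T, 0)) = ?q 0"
        unfolding q_eq using relations_mem(6) [OF \<beta> T, of 0] by simp
      then show ?case
        by (simp only: bilinear_ext_zero linear_ext_zero)
    next
      case (add v v')
      have "?q (basis_vec (basis_vec T, v + v')) =
          ?q (basis_vec (basis_vec T, v) + basis_vec (basis_vec T, v'))"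
        unfolding q_eq using relations_mem(2) [OF \<beta> T add(1,2)] by (simp add: diff_diff_eq)
      then show ?case
        using q_add [OF add(3,4)]
        by (simp only: bilinear_ext_linear linear_ext_linear)
    next
      case (smult c v)
      have "?q (basis_vec (basis_vec T, pm_smult c v)) = ?q (pm_smult c (basis_vec (basis_vec T, v)))"
        unfolding q_eq by (rule relations_mem(4) [OF \<beta> T smult(1)])
      then show ?case
        using q_smult [OF smult(2)]
        by (simp only: bilinear_ext_linear linear_ext_linear)
    next
      case (basis U)
      then show ?case
        using \<beta> \<open>T \<in> _\<close> by (simp add: cut_basis_glue)
    qed
  qed
  have "?q (linear_ext (cut_basis \<beta>) (glue_pairs h)) = ?q h"
    using h
  proof (induction h rule: free_on_induct)
    case (basis x)
    then obtain u v where x: "x = (u, v)" and "keys u \<subseteq> SIT \<beta> []"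
      "keys v \<subseteq> SIT \<alpha> \<beta>"
      by blast
    then show ?case
      by (simp only: x glue_pairs_linear pair)
  next
    case (add f g)
    then show ?case
      using q_add [OF add(3,4)] by (simp only: glue_pairs_linear linear_ext_linear)
  next
    case (smult c f)
    then show ?case
      using q_smult [OF smult(2)] by (simp only: glue_pairs_linear linear_ext_linear)
  qed (simp only: glue_pairs_linear linear_ext_zero)
  then show ?thesis
    by (simp only: q_eq)
qed

text \<open>For a single tableau exactly one composition matches its low cells. All other summands
  vanish, and glueing the two parts gives the tableau back.\<close>

lemma glue_cut:
  assumes x: "keys x \<subseteq> SIT \<alpha> []"
  shows "(\<Sum>\<beta>\<in>lower. glue_pairs (linear_ext (cut_basis \<beta>) x)) = x"
  using x
proof (induction x rule: free_on_induct)
  case (basis T)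
  then obtain \<gamma> where \<gamma>: "\<gamma> \<in> lower" "diagram \<gamma> = low_cells m T"
    using cut_exists by blast
  have "glue_pairs (linear_ext (cut_basis \<beta>) (basis_vec T)) = (if \<beta> = \<gamma> then basis_vec T else 0)"
    if "\<beta> \<in> lower" for \<beta>
    using lowerD(4) [OF \<gamma>(1) that] \<gamma>(2) by (auto simp: cut_basis_def glue_pairs_linear)
  then have "(\<Sum>\<beta>\<in>lower. glue_pairs (linear_ext (cut_basis \<beta>) (basis_vec T))) =
      (\<Sum>\<beta>\<in>lower. if \<beta> = \<gamma> then basis_vec T else 0)"
    by (rule sum.cong [OF refl])
  also have "\<dots> = basis_vec T"
    using \<gamma>(1) finite_lower by simp
  finally show ?case .
qed (simp_all add: linear_ext_linear glue_pairs_linear sum.distrib flip: pm.scale_sum_right)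

text \<open>The relations enter where the generator kills a tableau: cutting then gives
  \<open>0\<close>, whereas the action on the pair gives the basis vector of a pair with first
  component \<open>0\<close>. For a \<open>\<beta>\<close> other than the cut of the tableau both
  sides vanish, since the generator does not change the low cells.\<close>

lemma cut_equivariant_low:
  assumes \<beta>: "\<beta> \<in> lower" and i: "i \<in> {1..<m}" and x: "keys x \<subseteq> SIT \<alpha> []"
  shows "linear_ext (cut_basis \<beta>) (linear_ext (pi_basis a \<alpha> [] i) x) -
    bilinear_ext (\<lambda>(s, t) (u, v). (s \<odot>\<^bsub>low_module \<beta>\<^esub> u, t \<odot>\<^bsub>high_module \<beta>\<^esub> v))
      (basis_vec (hecke_gen m i, \<one>\<^bsub>hecke (n - m)\<^esub>)) (linear_ext (cut_basis \<beta>) x) \<in> relations \<beta>"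
  unfolding bilinear_ext_eq linear_ext_single pm.scale_one
proof (rule linear_ext_commute_mod [OF relations_subspace _ x])
  fix T assume T: "T \<in> SIT \<alpha> []"
  let ?L = "linear_ext (cut_basis \<beta>) (pi_basis a \<alpha> [] i T)"
  let ?R = "linear_ext (\<lambda>y. basis_vec ((\<lambda>(s, t) (u, v). (s \<odot>\<^bsub>low_module \<beta>\<^esub> u, t \<odot>\<^bsub>high_module \<beta>\<^esub> v))
      (hecke_gen m i, \<one>\<^bsub>hecke (n - m)\<^esub>) y)) (cut_basis \<beta> T)"
  obtain \<gamma> where \<gamma>: "\<gamma> \<in> lower" "diagram \<gamma> = low_cells m T"
    using cut_exists [OF T] by blast
  have i': "1 \<le> i" "i < m"
    using i by simp_all
  show "?L - ?R \<in> relations \<beta>"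
  proof (cases "\<beta> = \<gamma>")
    case True
    have low: "low_part m T \<in> SIT \<gamma> []" and high: "high_part m T \<in> SIT \<alpha> \<gamma>"
      using low_part_SIT [OF T \<gamma>] high_part_SIT [OF T \<gamma>] .
    have R: "?R =
        basis_vec (pi_basis a \<gamma> [] i (low_part m T), basis_vec (high_part m T))"
      using low high \<gamma> lowerD(2) [OF \<gamma>(1)] left_module.lsmult_one [OF SIT_left_modules(3) [OF \<gamma>(1)]]
      by (simp add: True cut_basis_def smult_gen_SIT_module)
    show ?thesis
      unfolding R using pi_basis_low [OF T \<gamma> i', of a]
    proof (elim disjE bexE conjE)
      assume "pi_basis a \<alpha> [] i T = 0" "pi_basis a \<gamma> [] i (low_part m T) = 0"
      then show "?L - basis_vec (pi_basis a \<gamma> [] i (low_part m T), basis_vec (high_part m T))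
          \<in> relations \<beta>"
        using relations_mem(5) [OF \<gamma>(1), of 0 "basis_vec (high_part m T)"] high
          pm.subspace_neg [OF relations_subspace] by (simp add: True)
    next
      fix T' assume "pi_basis a \<alpha> [] i T = basis_vec T'"
        "pi_basis a \<gamma> [] i (low_part m T) = basis_vec (low_part m T')"
        "high_part m T' = high_part m T" "low_cells m T' = low_cells m T"
      then show "?L - basis_vec (pi_basis a \<gamma> [] i (low_part m T), basis_vec (high_part m T))
          \<in> relations \<beta>"
        using relations_zero \<gamma> by (simp add: True cut_basis_def)
    qed
  next
    case False
    then have neq: "diagram \<beta> \<noteq> low_cells m T"
      using lowerD(4) [OF \<gamma>(1) \<beta>] \<gamma>(2) by auto
    have "?R = 0"
      using neq by (simp add: cut_basis_def)
    moreover have "?L = 0"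
      using pi_basis_low [OF T \<gamma> i', of a]
    proof (elim disjE bexE conjE)
      fix T' assume "pi_basis a \<alpha> [] i T = basis_vec T'" "low_cells m T' = low_cells m T"
      then show ?thesis
        using neq by (simp add: cut_basis_def)
    qed simp
    ultimately show ?thesis
      using relations_zero by (simp only: diff_0_right)
  qed
qed

text \<open>The same argument with the factors exchanged. The generator with index \<open>i\<close>
  of the second factor corresponds to the index \<open>i + m\<close>.\<close>

lemma cut_equivariant_high:
  assumes \<beta>: "\<beta> \<in> lower" and i: "i \<in> {1..<n - m}" and x: "keys x \<subseteq> SIT \<alpha> []"
  shows "linear_ext (cut_basis \<beta>) (linear_ext (pi_basis a \<alpha> [] (i + m)) x) -
    bilinear_ext (\<lambda>(s, t) (u, v). (s \<odot>\<^bsub>low_module \<beta>\<^esub> u, t \<odot>\<^bsub>high_module \<beta>\<^esub> v))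
      (basis_vec (\<one>\<^bsub>hecke m\<^esub>, hecke_gen (n - m) i)) (linear_ext (cut_basis \<beta>) x) \<in> relations \<beta>"
  unfolding bilinear_ext_eq linear_ext_single pm.scale_one
proof (rule linear_ext_commute_mod [OF relations_subspace _ x])
  fix T assume T: "T \<in> SIT \<alpha> []"
  let ?L = "linear_ext (cut_basis \<beta>) (pi_basis a \<alpha> [] (i + m) T)"
  let ?R = "linear_ext (\<lambda>y. basis_vec ((\<lambda>(s, t) (u, v). (s \<odot>\<^bsub>low_module \<beta>\<^esub> u, t \<odot>\<^bsub>high_module \<beta>\<^esub> v))
      (\<one>\<^bsub>hecke m\<^esub>, hecke_gen (n - m) i) y)) (cut_basis \<beta> T)"
  obtain \<gamma> where \<gamma>: "\<gamma> \<in> lower" "diagram \<gamma> = low_cells m T"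
    using cut_exists [OF T] by blast
  have i': "1 \<le> i" "i < n - m"
    using i by simp_all
  show "?L - ?R \<in> relations \<beta>"
  proof (cases "\<beta> = \<gamma>")
    case True
    have low: "low_part m T \<in> SIT \<gamma> []" and high: "high_part m T \<in> SIT \<alpha> \<gamma>"
      using low_part_SIT [OF T \<gamma>] high_part_SIT [OF T \<gamma>] .
    have R: "?R =
        basis_vec (basis_vec (low_part m T), pi_basis a \<alpha> \<gamma> i (high_part m T))"
      using low high \<gamma> lowerD(2) [OF \<gamma>(1)] left_module.lsmult_one [OF SIT_left_modules(2) [OF \<gamma>(1)]]
      by (simp add: True cut_basis_def smult_gen_SIT_module)
    show ?thesis
      unfolding R using pi_basis_high [OF T \<gamma> i', of a]
    proof (elim disjE bexE conjE)
      assume "pi_basis a \<alpha> [] (i + m) T = 0" "pi_basis a \<alpha> \<gamma> i (high_part m T) = 0"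
      then show "?L - basis_vec (basis_vec (low_part m T), pi_basis a \<alpha> \<gamma> i (high_part m T))
          \<in> relations \<beta>"
        using relations_mem(6) [OF \<gamma>(1), of "basis_vec (low_part m T)" 0] low
          pm.subspace_neg [OF relations_subspace] by (simp add: True)
    next
      fix T' assume "pi_basis a \<alpha> [] (i + m) T = basis_vec T'"
        "pi_basis a \<alpha> \<gamma> i (high_part m T) = basis_vec (high_part m T')"
        "low_part m T' = low_part m T" "low_cells m T' = low_cells m T"
      then show "?L - basis_vec (basis_vec (low_part m T), pi_basis a \<alpha> \<gamma> i (high_part m T))
          \<in> relations \<beta>"
        using relations_zero \<gamma> by (simp add: True cut_basis_def)
    qed
  next
    case False
    then have neq: "diagram \<beta> \<noteq> low_cells m T"
      using lowerD(4) [OF \<gamma>(1) \<beta>] \<gamma>(2) by auto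
    have "?R = 0"
      using neq by (simp add: cut_basis_def)
    moreover have "?L = 0"
      using pi_basis_high [OF T \<gamma> i', of a]
    proof (elim disjE bexE conjE)
      fix T' assume "pi_basis a \<alpha> [] (i + m) T = basis_vec T'" "low_cells m T' = low_cells m T"
      then show ?thesis
        using neq by (simp add: cut_basis_def)
    qed simp
    ultimately show ?thesis
      using relations_zero by (simp only: diff_0_right)
  qed
qed

lemma module_iso_tensor_restriction:
  assumes "hecke_tensor_identification n m \<iota>"
  shows "module_iso (tensor_algebra (hecke m) (hecke (n - m)))
    (restrict_scalars \<iota> (SIT_module a \<alpha> [])) (direct_sum lower low_high)"
proof -
  let ?T = "tensor_algebra (hecke m) (hecke (n - m))"
  let ?p = "pure_tensor (hecke m) (hecke (n - m))"
  let ?S = "tensor_gens m (n - m) \<union> {c \<odot>\<^bsub>?T\<^esub> \<one>\<^bsub>?T\<^esub> |c. True}" and ?V = "restrict_scalars \<iota> (SIT_module a \<alpha> [])"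
  let ?q = "\<lambda>\<beta>. lin_coset (relations \<beta>)"
  let ?L = "\<lambda>\<beta>. linear_ext (cut_basis \<beta>)"
  have \<iota>: "algebra_hom ?T (hecke n) \<iota>"
    and \<iota>_left: "\<And>i. i \<in> {1..<m} \<Longrightarrow>
      \<iota> (?p (hecke_gen m i) \<one>\<^bsub>hecke (n - m)\<^esub>) = hecke_gen n i"
    and \<iota>_right: "\<And>i. i \<in> {m + 1..<n} \<Longrightarrow>
      \<iota> (?p \<one>\<^bsub>hecke m\<^esub> (hecke_gen (n - m) (i - m))) = hecke_gen n i"
    using assms unfolding hecke_tensor_identification_def algebra_embedding_eq by blast+
  have ring: "ring ?T"
    using hecke_pair.complex_algebra_tensor by (rule complex_algebra.axioms)
  \<comment> \<open>The inverse map picks an arbitrary representative of a coset; glueing does not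
    depend on the choice.\<close>
  have glue: "glue_pairs (SOME h. h \<in> ?q \<beta> h') = glue_pairs h'" if "\<beta> \<in> lower" for \<beta> h'
  proof -
    have "h' \<in> ?q \<beta> h'"
      using relations_zero by (simp add: mem_lin_coset_iff)
    then have "(SOME h. h \<in> ?q \<beta> h') \<in> ?q \<beta> h'"
      by (rule someI)
    then have "glue_pairs ((SOME h. h \<in> ?q \<beta> h') - h') = 0"
      using glue_pairs_relations [OF that] by (simp only: mem_lin_coset_iff)
    then show ?thesis
      by (simp add: glue_pairs_linear)
  qed
  \<comment> \<open>Ring generators include the scalar multiples of one besides the pure tensors of
    generators, hence three kinds of \<open>s\<close>.\<close>
  have gen: "?q \<beta> (?L \<beta> (\<iota> s \<odot>\<^bsub>SIT_module a \<alpha> []\<^esub> x)) = s \<odot>\<^bsub>low_high \<beta>\<^esub> ?q \<beta> (?L \<beta> x)"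
    if \<beta>: "\<beta> \<in> lower" and s: "s \<in> ?S"
      and x: "keys x \<subseteq> SIT \<alpha> []" for \<beta> s x
  proof -
    interpret tensor_modules "hecke m" "hecke (n - m)" "low_module \<beta>" "high_module \<beta>"
      by (rule tensor_modules_lower [OF \<beta>])
    have Lx: "keys (?L \<beta> x) \<subseteq> carrier (low_module \<beta>) \<times> carrier (high_module \<beta>)"
      using keys_cut [OF \<beta> x] by simp
    have smult: "lin_coset (tensor_relations (hecke m) (hecke (n - m))) (basis_vec (C, C')) \<odot>\<^bsub>low_high \<beta>\<^esub> ?q \<beta> (?L \<beta> x) =
        ?q \<beta> (act (basis_vec (C, C')) (?L \<beta> x))"
      if "C \<in> carrier (hecke m)" "C' \<in> carrier (hecke (n - m))" for C C'
      by (rule smult_tensor_module [OF _ Lx]) (use that in simp)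
    have gen_smult: "hecke_gen n i \<odot>\<^bsub>SIT_module a \<alpha> []\<^esub> x = linear_ext (pi_basis a \<alpha> [] i) x" for i
      using x by (simp add: smult_gen_SIT_module)
    from s consider (left) i where "i \<in> {1..<m}"
        "s = ?p (hecke_gen m i) \<one>\<^bsub>hecke (n - m)\<^esub>"
      | (right) i where "i \<in> {1..<n - m}"
        "s = ?p \<one>\<^bsub>hecke m\<^esub> (hecke_gen (n - m) i)"
      | (scalar) c where "s = c \<odot>\<^bsub>?T\<^esub> \<one>\<^bsub>?T\<^esub>"
      by blast
    then show ?thesis
    proof cases
      case left
      have "?q \<beta> (?L \<beta> (\<iota> s \<odot>\<^bsub>SIT_module a \<alpha> []\<^esub> x)) =
          ?q \<beta> (act (basis_vec (hecke_gen m i, \<one>\<^bsub>hecke (n - m)\<^esub>)) (?L \<beta> x))"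
        unfolding left(2) \<iota>_left [OF left(1)] gen_smult lin_coset_eq_iff [OF relations_subspace]
        by (rule cut_equivariant_low [OF \<beta> left(1) x])
      then show ?thesis
        unfolding left(2) pure_tensor_eq smult [OF hecke_gen_closed [OF left(1)] hecke_one_closed] .
    next
      case right
      have i: "i + m \<in> {m + 1..<n}"
        using right(1) by auto
      have "?q \<beta> (?L \<beta> (\<iota> s \<odot>\<^bsub>SIT_module a \<alpha> []\<^esub> x)) =
          ?q \<beta> (act (basis_vec (\<one>\<^bsub>hecke m\<^esub>, hecke_gen (n - m) i)) (?L \<beta> x))"
        unfolding right(2) \<iota>_right [OF i, unfolded diff_add_inverse2] gen_smult
          lin_coset_eq_iff [OF relations_subspace]
        by (rule cut_equivariant_high [OF \<beta> right(1) x])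
      then show ?thesis
        unfolding right(2) pure_tensor_eq smult [OF hecke_one_closed hecke_gen_closed [OF right(1)]] .
    next
      case scalar
      have "\<one>\<^bsub>?T\<^esub> \<in> carrier ?T"
        by (intro monoid.one_closed ring.is_monoid ring)
      then have "\<iota> s \<odot>\<^bsub>SIT_module a \<alpha> []\<^esub> x = pm_smult c x"
        using x by (simp add: scalar algebra_homD [OF \<iota>] smult_scalar_SIT_module)
      moreover have "s = lin_coset (tensor_relations (hecke m) (hecke (n - m))) (pm_smult c (basis_vec (\<one>\<^bsub>hecke m\<^esub>, \<one>\<^bsub>hecke (n - m)\<^esub>)))"
        by (simp only: scalar hecke_pair.tensor_algebra_eq hecke_pair.AB.one_Q hecke_pair.AB.smult_Q
            hecke_pair.one_AB)
      moreover have "keys (pm_smult c (basis_vec (\<one>\<^bsub>hecke m\<^esub>, \<one>\<^bsub>hecke (n - m)\<^esub>)))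
          \<subseteq> carrier (hecke m) \<times> carrier (hecke (n - m))"
        by (rule free_on_smult) (simp add: hecke_one_closed)
      ultimately show ?thesis
        by (simp only: smult_tensor_module [OF _ Lx] bilinear_ext_linear act_one [OF Lx] linear_ext_linear)
    qed
  qed
  show ?thesis
  proof (rule module_iso_direct_sumI [where f = "\<lambda>\<beta> x. ?q \<beta> (?L \<beta> x)"
        and g = "\<lambda>\<beta> C. glue_pairs (SOME h. h \<in> C)"])
    show "carrier ?T = generate_ring ?T ?S"
      using generated_tensor_hecke [of m "n - m"] by (simp only: generated_subalgebra_def)
    show "left_module ?T ?V"
      by (rule left_module_restrict_scalars [OF SIT_left_modules(1) ring algebra_homD(6) [OF \<iota>]])
    fix \<beta> assume \<beta>: "\<beta> \<in> lower"
    interpret tensor_modules "hecke m" "hecke (n - m)" "low_module \<beta>" "high_module \<beta>"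
      by (rule tensor_modules_lower [OF \<beta>])
    note car = tensor_module_simps(1) [unfolded SIT_module_simps]
    show "left_module ?T (low_high \<beta>)"
      by (rule left_module_tensor_module)
    fix x assume "x \<in> carrier ?V"
    then have x: "keys x \<subseteq> SIT \<alpha> []"
      by simp
    show "?q \<beta> (?L \<beta> x) \<in> carrier (low_high \<beta>)"
      using keys_cut [OF \<beta> x] unfolding car by (intro imageI) blast
    show "?q \<beta> (?L \<beta> (x + y)) = ?q \<beta> (?L \<beta> x) \<oplus>\<^bsub>low_high \<beta>\<^esub> ?q \<beta> (?L \<beta> y)" for y
      by (simp only: linear_ext_linear tensor_module_simps)
    show "?q \<beta> (?L \<beta> (s \<odot>\<^bsub>?V\<^esub> x)) = s \<odot>\<^bsub>low_high \<beta>\<^esub> ?q \<beta> (?L \<beta> x)"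
      if "s \<in> ?S" for s
      unfolding restrict_scalars_simps by (rule gen [OF \<beta> that x])
  next
    fix \<beta> C assume \<beta>: "\<beta> \<in> lower" and "C \<in> carrier (low_high \<beta>)"
    interpret tensor_modules "hecke m" "hecke (n - m)" "low_module \<beta>" "high_module \<beta>"
      by (rule tensor_modules_lower [OF \<beta>])
    obtain h where h: "keys h \<subseteq> pairs \<beta>" and C: "C = ?q \<beta> h"
      using \<open>C \<in> _\<close> unfolding tensor_module_simps(1) SIT_module_simps by blast
    show "glue_pairs (SOME h. h \<in> C) \<in> carrier ?V"
      unfolding C glue [OF \<beta>] using keys_glue_pairs [OF \<beta> h] by simp
    fix \<gamma> assume \<gamma>: "\<gamma> \<in> lower"
    show "?q \<gamma> (?L \<gamma> (glue_pairs (SOME h. h \<in> C))) = (if \<beta> = \<gamma> then C else \<zero>\<^bsub>low_high \<gamma>\<^esub>)"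
    proof (cases "\<beta> = \<gamma>")
      case True
      then show ?thesis
        unfolding C glue [OF \<beta>] using cut_glue [OF \<beta> h] by (simp add: lin_coset_eq_iff relations_subspace)
    next
      case False
      then show ?thesis
        unfolding C glue [OF \<beta>] using cut_glue_neq [OF \<beta> \<gamma> False h]
        by (simp add: tensor_modules.tensor_module_simps(2) [OF tensor_modules_lower [OF \<gamma>]])
    qed
  next
    fix x assume "x \<in> carrier ?V"
    then have x: "keys x \<subseteq> SIT \<alpha> []"
      by simp
    show "(\<Sum>\<beta>\<in>lower. glue_pairs (SOME h. h \<in> ?q \<beta> (?L \<beta> x))) = x"
      using glue_cut [OF x] by (simp add: glue cong: sum.cong)
  qed (simp_all add: finite_lower)
qed

section \<open>Restriction to the predecessor\<close>

definition unit_filling :: "nat list \<Rightarrow> filling"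
  where "unit_filling \<beta> = (\<lambda>x. if x \<in> skew_diagram \<alpha> \<beta> then 1 else 0)"

text \<open>Comparing sizes leaves one skew cell, and its entry can only be 1. The factor belonging
  to \<alpha>/\<beta> is therefore one-dimensional.\<close>

lemma SIT_single_cell:
  assumes \<beta>: "\<beta> \<in> lower" and n: "n = m + 1"
  shows "SIT \<alpha> \<beta> = {unit_filling \<beta>}"
proof -
  have "card (skew_diagram \<alpha> \<beta>) = card (diagram \<alpha>) - card (diagram \<beta>)"
    unfolding skew_diagram_def by (rule card_Diff_subset [OF finite_diagram lowerD(3) [OF \<beta>]])
  then have "card (skew_diagram \<alpha> \<beta>) = 1"
    by (simp add: card_diagram lowerD(2) [OF \<beta>] n)
  then obtain z where z: "skew_diagram \<alpha> \<beta> = {z}"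
    by (rule card_1_singletonE)
  have range: "{1..sum_list \<alpha> - sum_list \<beta>} = {1}"
    by (simp add: lowerD(2) [OF \<beta>] n)
  have "unit_filling \<beta> \<in> SIT \<alpha> \<beta>"
    unfolding SIT_iff range z by (auto simp: unit_filling_def z bij_betw_def precedes_def)
  moreover have "T = unit_filling \<beta>" if T: "T \<in> SIT \<alpha> \<beta>" for T
  proof
    fix x show "T x = unit_filling \<beta> x"
      using SIT_bij [OF T] SIT_outside [OF T, of x] unfolding range z
      by (auto simp: unit_filling_def z bij_betw_def)
  qed
  ultimately show ?thesis
    by blast
qed

text \<open>Records only the lower tableau, since the upper one is forced. Working with it directly
  avoids a detour through the tensor product with a one-dimensional module over H_1(0).\<close>

definition low_basis :: "nat list \<Rightarrow> filling \<Rightarrow> filling \<Rightarrow>\<^sub>0 complex"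
  where "low_basis \<beta> T = (if diagram \<beta> = low_cells m T then basis_vec (low_part m T) else 0)"

definition glue_unit :: "nat list \<Rightarrow> (filling \<Rightarrow>\<^sub>0 complex) \<Rightarrow> filling \<Rightarrow>\<^sub>0 complex"
  where "glue_unit \<beta> = linear_ext (\<lambda>T. basis_vec (glue m T (unit_filling \<beta>)))"

text \<open>In contrast to \<open>cut_equivariant_low\<close> this is an exact equality, because the
  target is a free space and not a quotient.\<close>

lemma low_equivariant:
  assumes \<beta>: "\<beta> \<in> lower" and i: "i \<in> {1..<m}" and x: "keys x \<subseteq> SIT \<alpha> []"
  shows "linear_ext (low_basis \<beta>) (linear_ext (pi_basis a \<alpha> [] i) x) =
    linear_ext (pi_basis a \<beta> [] i) (linear_ext (low_basis \<beta>) x)"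
  using x
proof (induction x rule: free_on_induct)
  case (basis T)
  obtain \<gamma> where \<gamma>: "\<gamma> \<in> lower" "diagram \<gamma> = low_cells m T"
    using cut_exists [OF basis] by blast
  have eq: "diagram \<beta> = low_cells m T \<longleftrightarrow> \<beta> = \<gamma>"
    using lowerD(4) [OF \<gamma>(1) \<beta>] \<gamma>(2) by simp
  have "1 \<le> i" "i < m"
    using i by simp_all
  from pi_basis_low [OF basis \<gamma> this, of a] show ?case
  proof (elim disjE bexE conjE)
    assume "pi_basis a \<alpha> [] i T = 0" "pi_basis a \<gamma> [] i (low_part m T) = 0"
    then show ?thesis
      by (simp add: low_basis_def eq)
  next
    fix T' assume "pi_basis a \<alpha> [] i T = basis_vec T'"
      "pi_basis a \<gamma> [] i (low_part m T) = basis_vec (low_part m T')" "low_cells m T' = low_cells m T"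
    then show ?thesis
      by (simp add: low_basis_def eq)
  qed
qed (simp_all add: linear_ext_linear)

lemma module_iso_pred_restriction:
  assumes n: "n = m + 1" and "hecke_pred_identification n \<iota>"
  shows "module_iso (hecke m) (restrict_scalars \<iota> (SIT_module a \<alpha> []))
    (direct_sum lower (\<lambda>\<beta>. SIT_module a \<beta> []))"
proof -
  let ?V = "restrict_scalars \<iota> (SIT_module a \<alpha> [])"
  let ?L = "\<lambda>\<beta>. linear_ext (low_basis \<beta>)"
  have \<iota>: "algebra_hom (hecke m) (hecke n) \<iota>"
    and \<iota>_gen: "\<And>i. i \<in> {1..<m} \<Longrightarrow> \<iota> (hecke_gen m i) = hecke_gen n i"
    using assms(2) unfolding hecke_pred_identification_def algebra_embedding_eq n by simp_all
  have ring: "ring (hecke m)"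
    using complex_algebra_hecke by (rule complex_algebra.axioms)
  have keys_L: "keys (?L \<beta> x) \<subseteq> SIT \<beta> []"
    if \<beta>: "\<beta> \<in> lower" and x: "keys x \<subseteq> SIT \<alpha> []" for \<beta> x
  proof (rule keys_linear_ext)
    fix T assume "T \<in> keys x"
    then have "T \<in> SIT \<alpha> []"
      using x by blast
    then show "keys (low_basis \<beta> T) \<subseteq> SIT \<beta> []"
      using low_part_SIT [of T \<beta>] \<beta> by (simp add: low_basis_def)
  qed
  have unit: "unit_filling \<beta> \<in> SIT \<alpha> \<beta>" if "\<beta> \<in> lower" for \<beta>
    using SIT_single_cell [OF that n] by simp
  show ?thesis
  proof (rule module_iso_direct_sumI [where f = ?L and g = glue_unit])
    show "carrier (hecke m) =
        generate_ring (hecke m) (hecke_gen m ` {1..<m} \<union> {c \<odot>\<^bsub>hecke m\<^esub> \<one>\<^bsub>hecke m\<^esub> |c. True})"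
      using generated_hecke [of m] by (simp only: generated_subalgebra_def)
    show "left_module (hecke m) ?V"
      by (rule left_module_restrict_scalars [OF SIT_left_modules(1) ring algebra_homD(6) [OF \<iota>]])
    fix \<beta> assume \<beta>: "\<beta> \<in> lower"
    show "left_module (hecke m) (SIT_module a \<beta> [])"
      by (rule SIT_left_modules(2) [OF \<beta>])
    fix x assume "x \<in> carrier ?V"
    then have x: "keys x \<subseteq> SIT \<alpha> []"
      by simp
    show "?L \<beta> x \<in> carrier (SIT_module a \<beta> [])"
      using keys_L [OF \<beta> x] by simp
    show "?L \<beta> (x + y) = ?L \<beta> x \<oplus>\<^bsub>SIT_module a \<beta> []\<^esub> ?L \<beta> y" for y
      by (simp add: linear_ext_linear)
    show "?L \<beta> (s \<odot>\<^bsub>?V\<^esub> x) = s \<odot>\<^bsub>SIT_module a \<beta> []\<^esub> ?L \<beta> x"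
      if "s \<in> hecke_gen m ` {1..<m} \<union> {c \<odot>\<^bsub>hecke m\<^esub> \<one>\<^bsub>hecke m\<^esub> |c. True}" for s
      using that
    proof (elim UnE imageE CollectE exE conjE)
      fix i assume s: "s = hecke_gen m i" and i: "i \<in> {1..<m}"
      show ?thesis
        unfolding s restrict_scalars_simps \<iota>_gen [OF i]
        using low_equivariant [OF \<beta> i x] keys_L [OF \<beta> x] x
        by (simp add: smult_gen_SIT_module lowerD(2) [OF \<beta>])
    next
      fix c assume s: "s = c \<odot>\<^bsub>hecke m\<^esub> \<one>\<^bsub>hecke m\<^esub>"
      show ?thesis
        unfolding s restrict_scalars_simps algebra_homD(5) [OF \<iota> hecke_one_closed] algebra_homD(4) [OF \<iota>]
        using keys_L [OF \<beta> x] x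
        by (simp add: smult_scalar_SIT_module lowerD(2) [OF \<beta>] linear_ext_linear)
    qed
  next
    fix \<beta> w assume \<beta>: "\<beta> \<in> lower" and "w \<in> carrier (SIT_module a \<beta> [])"
    then have w: "keys w \<subseteq> SIT \<beta> []"
      by simp
    have "keys (glue_unit \<beta> w) \<subseteq> SIT \<alpha> []"
      unfolding glue_unit_def
    proof (rule keys_linear_ext)
      fix T assume "T \<in> keys w"
      then have "glue m T (unit_filling \<beta>) \<in> SIT \<alpha> []"
        using glue_SIT [OF \<beta> _ unit [OF \<beta>]] w by blast
      then show "keys (basis_vec (glue m T (unit_filling \<beta>))) \<subseteq> SIT \<alpha> []"
        by simp
    qed
    then show "glue_unit \<beta> w \<in> carrier ?V"
      by simp
    fix \<gamma> assume \<gamma>: "\<gamma> \<in> lower"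
    show "?L \<gamma> (glue_unit \<beta> w) = (if \<beta> = \<gamma> then w else \<zero>\<^bsub>SIT_module a \<gamma> []\<^esub>)"
      using w
    proof (induction w rule: free_on_induct)
      case (basis T)
      then show ?case
        using lowerD(4) [OF \<beta> \<gamma>] low_cells_glue [OF \<beta> basis unit [OF \<beta>]]
          low_part_glue [OF \<beta> basis unit [OF \<beta>]]
        by (auto simp: glue_unit_def low_basis_def)
    qed (simp_all add: glue_unit_def linear_ext_linear)
  next
    fix x assume "x \<in> carrier ?V"
    then have "keys x \<subseteq> SIT \<alpha> []"
      by simp
    then show "(\<Sum>\<beta>\<in>lower. glue_unit \<beta> (?L \<beta> x)) = x"
    proof (induction x rule: free_on_induct)
      case (basis T)
      then obtain \<gamma> where \<gamma>: "\<gamma> \<in> lower" "diagram \<gamma> = low_cells m T"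
        using cut_exists by blast
      \<comment> \<open>The upper part is the unique filling of its single cell, so glueing with
        \<open>unit_filling\<close> restores the tableau.\<close>
      have "high_part m T = unit_filling \<gamma>"
        using high_part_SIT [OF basis \<gamma>] SIT_single_cell [OF \<gamma>(1) n] by simp
      then have glue: "glue m (low_part m T) (unit_filling \<gamma>) = T"
        using glue_low_high [of m T] by simp
      have "glue_unit \<beta> (?L \<beta> (basis_vec T)) = (if \<beta> = \<gamma> then basis_vec T else 0)"
        if "\<beta> \<in> lower" for \<beta>
        using lowerD(4) [OF \<gamma>(1) that] \<gamma>(2) glue by (auto simp: low_basis_def glue_unit_def)
      then have "(\<Sum>\<beta>\<in>lower. glue_unit \<beta> (?L \<beta> (basis_vec T))) =
          (\<Sum>\<beta>\<in>lower. if \<beta> = \<gamma> then basis_vec T else 0)"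
        by (rule sum.cong [OF refl])
      also have "\<dots> = basis_vec T"
        using \<gamma>(1) finite_lower by simp
      finally show ?case .
    qed (simp_all add: glue_unit_def linear_ext_linear sum.distrib flip: pm.scale_sum_right)
  qed (simp_all add: finite_lower)
qed

end

end

theorem theorem5p4:
  fixes a :: variant and \<alpha> :: "nat list" and n m :: nat
  assumes "composition n \<alpha>" and "m \<le> n"
  shows
    "((\<exists>\<iota>. hecke_tensor_identification n m \<iota>) \<and>
      (\<forall>\<iota>. hecke_tensor_identification n m \<iota> \<longrightarrow>
        module_iso (tensor_algebra (hecke m) (hecke (n - m)))
          (restrict_scalars \<iota> (SIT_module a \<alpha> []))
          (direct_sum {\<beta>. composition m \<beta> \<and> comp_subset \<beta> \<alpha>}
            (\<lambda>\<beta>. tensor_module (hecke m) (hecke (n - m))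
              (SIT_module a \<beta> []) (SIT_module a \<alpha> \<beta>))))) \<and>
     (n \<ge> 1 \<longrightarrow>
      (\<exists>\<iota>. hecke_pred_identification n \<iota>) \<and>
      (\<forall>\<iota>. hecke_pred_identification n \<iota> \<longrightarrow>
        module_iso (hecke (n - 1))
          (restrict_scalars \<iota> (SIT_module a \<alpha> []))
          (direct_sum {\<beta>. composition (n - 1) \<beta> \<and> comp_subset \<beta> \<alpha> \<and> \<beta> \<noteq> \<alpha>}
            (\<lambda>\<beta>. SIT_module a \<beta> []))))"
proof (intro conjI impI allI)
  interpret cut: composition_cut \<alpha> n m
    using assms by unfold_locales
  show "\<exists>\<iota>. hecke_tensor_identification n m \<iota>"
    using hecke_tensor_identification_exists [OF assms(2)] by blast
  show "module_iso (tensor_algebra (hecke m) (hecke (n - m))) (restrict_scalars \<iota> (SIT_module a \<alpha> []))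
      (direct_sum {\<beta>. composition m \<beta> \<and> comp_subset \<beta> \<alpha>}
        (\<lambda>\<beta>. tensor_module (hecke m) (hecke (n - m)) (SIT_module a \<beta> []) (SIT_module a \<alpha> \<beta>)))"
    if "hecke_tensor_identification n m \<iota>" for \<iota>
    using cut.module_iso_tensor_restriction [OF that] by (simp only: cut.lower_def)
next
  assume n: "1 \<le> n"
  interpret cut: composition_cut \<alpha> n "n - 1"
    using assms by unfold_locales simp_all
  show "\<exists>\<iota>. hecke_pred_identification n \<iota>"
    using hecke_pred_identification_exists [OF n] by blast
  \<comment> \<open>For \<open>n \<ge> 1\<close> the sizes \<open>n - 1\<close> and \<open>n\<close>
    differ, so proper containment describes exactly the index set \<open>lower\<close> of the cut at
    \<open>n - 1\<close>.\<close>
  have "\<not> composition (n - 1) \<alpha>"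
    using assms(1) n by (auto simp: composition_def)
  then have "{\<beta>. composition (n - 1) \<beta> \<and> comp_subset \<beta> \<alpha> \<and> \<beta> \<noteq> \<alpha>} = cut.lower"
    unfolding cut.lower_def by blast
  then show "module_iso (hecke (n - 1)) (restrict_scalars \<iota> (SIT_module a \<alpha> []))
      (direct_sum {\<beta>. composition (n - 1) \<beta> \<and> comp_subset \<beta> \<alpha> \<and> \<beta> \<noteq> \<alpha>} (\<lambda>\<beta>. SIT_module a \<beta> []))"
    if "hecke_pred_identification n \<iota>" for \<iota>
    using cut.module_iso_pred_restriction [OF _ that, of a] n by simp
qed

end
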